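(* Let $p(x)=c_kx^k+\ldots+c_1x+c_0$ and $q(x)=d_\ell x^\ell+\ldots+d_1x+d_0$ be two polynomials with real coefficients and suppose at least one of the coefficients $c_1,\ldots,c_k$ is irrational and at least one of the coefficients $d_1,\ldots,d_\ell$ is irrational. Then the sequence $\big(p(n),q(\Omega(n))\big)_{n\in\mathbb{N}}$ is uniformly distributed in the two-dimensional torus $\mathbb{T}^2$.
   Context: $\mathbb{N}=\{1,2,3,\ldots\}$, $\mathbb{T}=\mathbb{R}/\mathbb{Z}$ (coordinates are taken mod $1$). $\Omega(n)$ denotes the number of prime factors of $n$ counted with multiplicities. Uniform distribution in $\mathbb{T}^2$ is with respect to normalized Haar measure. *)

theory Defs
  imports "HOL-Probability.Probability" "HOL-Computational_Algebra.Polynomial"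
    "HOL-Computational_Algebra.Primes"
begin

quotient_type circle = real / "\<lambda>x y :: real. x - y \<in> \<int>"
  morphisms rep_circle to_circle
proof (rule equivpI)
  show "reflp (\<lambda>x y :: real. x - y \<in> \<int>)"
    by (simp add: reflp_def)
  show "symp (\<lambda>x y :: real. x - y \<in> \<int>)"
  proof (rule sympI)
    fix x y :: real
    assume "x - y \<in> \<int>"
    from Ints_minus[OF this] show "y - x \<in> \<int>" by simp
  qed
  show "transp (\<lambda>x y :: real. x - y \<in> \<int>)"
  proof (rule transpI)
    fix x y z :: real
    assume "x - y \<in> \<int>" "y - z \<in> \<int>"
    from Ints_add[OF this] show "x - z \<in> \<int>" by simp
  qed
qed

lemma to_circle_eq_iff: "to_circle x = to_circle y \<longleftrightarrow> x - y \<in> \<int>"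
  by (rule circle.abs_eq_iff)

lemma to_circle_surj: "\<exists>x. to_circle x = c"
  by (induct c rule: circle.abs_induct) blast

instantiation circle :: ab_group_add
begin

lift_definition zero_circle :: circle is "0 :: real" .

lift_definition plus_circle :: "circle \<Rightarrow> circle \<Rightarrow> circle" is "(+) :: real \<Rightarrow> _"
proof -
  fix a b c d :: real
  assume "a - b \<in> \<int>" "c - d \<in> \<int>"
  from Ints_add[OF this] show "(a + c) - (b + d) \<in> \<int>" by (simp only: add_diff_add)
qed

lift_definition uminus_circle :: "circle \<Rightarrow> circle" is "uminus :: real \<Rightarrow> _"
proof -
  fix a b :: real
  assume "a - b \<in> \<int>"
  from Ints_minus[OF this] show "(- a) - (- b) \<in> \<int>" by (simp only: minus_diff_minus)
qed

lift_definition minus_circle :: "circle \<Rightarrow> circle \<Rightarrow> circle" is "(-) :: real \<Rightarrow> _"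
proof -
  fix a b c d :: real
  assume "a - b \<in> \<int>" "c - d \<in> \<int>"
  from Ints_diff[OF this] have "(a - b) - (c - d) \<in> \<int>" .
  also have "(a - b) - (c - d) = (a - c) - (b - d)" by simp
  finally show "(a - c) - (b - d) \<in> \<int>" .
qed

instance
  by standard (transfer, simp add: algebra_simps)+

end

instantiation circle :: topological_space
begin

definition open_circle :: "circle set \<Rightarrow> bool" where
  "open_circle U \<longleftrightarrow> open (to_circle -` U)"

instance
proof
  show "open (UNIV :: circle set)" by (simp add: open_circle_def)
  show "open (S \<inter> T)" if "open S" "open T" for S T :: "circle set"
    using that by (auto simp: open_circle_def)
  show "open (\<Union>K)" if "\<forall>S\<in>K. open S" for K :: "circle set set"
    using that by (auto simp: open_circle_def vimage_Union)
qed

end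

lemma continuous_to_circle: "continuous_on UNIV to_circle"
  unfolding continuous_on_open_vimage[OF open_UNIV] by (simp add: open_circle_def)

lemma measurable_to_circle [measurable]: "to_circle \<in> borel_measurable borel"
  by (rule borel_measurable_continuous_onI[OF continuous_to_circle])

lemma open_to_circle_image:
  assumes "open U"
  shows "open (to_circle ` U)"
proof -
  have "to_circle -` (to_circle ` U) = (\<Union>k\<in>\<int>. (+) k ` U)"
  proof (intro set_eqI iffI)
    fix x assume "x \<in> to_circle -` (to_circle ` U)"
    then obtain u where "u \<in> U" "x - u \<in> \<int>" by (auto simp: to_circle_eq_iff)
    then show "x \<in> (\<Union>k\<in>\<int>. (+) k ` U)"
      by (intro UN_I[of "x - u"] image_eqI[of _ _ u]) auto
  next
    fix x assume "x \<in> (\<Union>k\<in>\<int>. (+) k ` U)"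
    then obtain k u where "k \<in> \<int>" "u \<in> U" "x = k + u" by auto
    then show "x \<in> to_circle -` (to_circle ` U)"
      by (auto simp: to_circle_eq_iff intro!: image_eqI[of _ _ u])
  qed
  then show ?thesis
    unfolding open_circle_def using assms by (simp add: open_UN open_translation)
qed

instance circle :: second_countable_topology
proof
  have "\<exists>B :: real set set. countable B \<and> topological_basis B"
    by (rule ex_countable_basis)
  then obtain B :: "real set set" where B: "countable B" "topological_basis B"
    by (elim exE conjE)
  have "topological_basis ((`) to_circle ` B)"
  proof (rule topological_basisI)
    fix C assume "C \<in> (`) to_circle ` B"
    then obtain b where "b \<in> B" "C = to_circle ` b" by (elim imageE)
    then show "open C"
      using open_to_circle_image[OF topological_basis_open[OF B(2)]] by simp
  next
    fix V :: "circle set" and c assume V: "open V" "c \<in> V"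
    obtain x where x: "to_circle x = c" using to_circle_surj[of c] by (elim exE)
    have "open (to_circle -` V)" "x \<in> to_circle -` V"
      using V x by (auto simp: open_circle_def)
    with B(2) obtain b where "b \<in> B" "x \<in> b" "b \<subseteq> to_circle -` V"
      by (rule topological_basisE)
    then show "\<exists>C\<in>(`) to_circle ` B. c \<in> C \<and> C \<subseteq> V"
      using x by (intro bexI[of _ "to_circle ` b"]) auto
  qed
  then have "open = generate_topology ((`) to_circle ` B)"
    by (rule topological_basis_imp_subbasis)
  moreover have "countable ((`) to_circle ` B)"
    using B(1) by (rule countable_image)
  ultimately show "\<exists>B :: circle set set. countable B \<and> open = generate_topology B"
    by (intro exI conjI)
qed

text \<open>The normalized Haar measure of \<open>\<real>/\<int>\<close>, as the image of Lebesgue measure on the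
  fundamental domain \<open>[0, 1)\<close>.\<close>

definition haar_circle :: "circle measure" where
  "haar_circle = distr (restrict_space lborel {0..<1}) borel to_circle"

lemma sets_haar_circle [simp, measurable_cong]: "sets haar_circle = sets borel"
  by (simp add: haar_circle_def)

lemma space_haar_circle [simp]: "space haar_circle = UNIV"
  by (simp add: haar_circle_def)

lemma emeasure_haar_circle:
  assumes "A \<in> sets borel"
  shows "emeasure haar_circle A = emeasure lborel (to_circle -` A \<inter> {0..<1})"
proof -
  have "to_circle \<in> measurable (restrict_space lborel {0..<1}) borel"
    by (rule measurable_restrict_space1) simp
  then show ?thesis
    using assms by (simp add: haar_circle_def emeasure_distr space_restrict_space
      emeasure_restrict_space)
qed

interpretation haar_circle: prob_space haar_circle
  by standard (simp add: emeasure_haar_circle)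

lemma measurable_plus_circle: "(+) c \<in> measurable borel (borel :: circle measure)"
proof (rule borel_measurable_continuous_onI)
  obtain a where a: "to_circle a = c" using to_circle_surj by blast
  have "open (to_circle -` ((+) c -` V))" if "open V" for V :: "circle set"
  proof -
    have "to_circle -` ((+) c -` V) = (+) a -` (to_circle -` V)"
      by (auto simp: a[symmetric] plus_circle.abs_eq)
    moreover have "open ((+) a -` (to_circle -` V))"
      by (rule open_vimage) (use that in \<open>auto simp: open_circle_def intro!: continuous_intros\<close>)
    ultimately show ?thesis by simp
  qed
  then show "continuous_on UNIV ((+) c)"
    unfolding continuous_on_open_vimage[OF open_UNIV] by (simp add: open_circle_def)
qed

lemma haar_circle_invariant: "distr haar_circle borel ((+) c) = haar_circle"
proof (rule measure_eqI)
  obtain x where x: "to_circle x = c" using to_circle_surj by blast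
  define a where "a = frac x"
  have "a - x \<in> \<int>" by (simp add: a_def frac_def)
  then have a: "to_circle a = c" "0 \<le> a" "a < 1"
    using x by (auto simp: a_def to_circle_eq_iff frac_lt_1)
  fix A assume "A \<in> sets (distr haar_circle borel ((+) c))"
  then have A: "A \<in> sets borel" by simp
  define S where "S = to_circle -` A"
  have S [measurable]: "S \<in> sets borel"
    unfolding S_def using measurable_sets_borel[OF measurable_to_circle A] by simp
  have per: "1 + y \<in> S \<longleftrightarrow> y \<in> S" for y
  proof -
    have "to_circle (1 + y) = to_circle y" by (simp add: to_circle_eq_iff)
    then show ?thesis by (simp add: S_def)
  qed
  have shift: "emeasure lborel ((+) t -` T) = emeasure lborel T" if "T \<in> sets borel" for t and T :: "real set"
  proof -
    have "emeasure lborel T = emeasure (distr lborel borel ((+) t)) T"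
      using lborel_distr_plus[of t] by simp
    also have "\<dots> = emeasure lborel ((+) t -` T)"
      using that by (subst emeasure_distr) auto
    finally show ?thesis by simp
  qed
  have "(+) c \<in> measurable haar_circle borel"
    using measurable_plus_circle measurable_cong_sets[OF sets_haar_circle refl] by blast
  then have "emeasure (distr haar_circle borel ((+) c)) A = emeasure haar_circle ((+) c -` A)"
    using A by (simp add: emeasure_distr)
  also have "\<dots> = emeasure lborel (to_circle -` ((+) c -` A) \<inter> {0..<1})"
    using measurable_sets_borel[OF measurable_plus_circle A] by (simp add: emeasure_haar_circle)
  also have "to_circle -` ((+) c -` A) \<inter> {0..<1} = (+) a -` (S \<inter> {a..<1 + a})"
    by (auto simp: S_def a(1)[symmetric] plus_circle.abs_eq)
  also have "emeasure lborel \<dots> = emeasure lborel (S \<inter> {a..<1 + a})"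
    by (rule shift) simp
  also have "S \<inter> {a..<1 + a} = (S \<inter> {a..<1}) \<union> (S \<inter> {1..<1 + a})"
    using a by auto
  also have "emeasure lborel \<dots> = emeasure lborel (S \<inter> {a..<1}) + emeasure lborel (S \<inter> {1..<1 + a})"
    by (rule plus_emeasure[symmetric]) auto
  also have "emeasure lborel (S \<inter> {1..<1 + a}) = emeasure lborel ((+) 1 -` (S \<inter> {1..<1 + a}))"
    by (rule shift[symmetric]) simp
  also have "(+) 1 -` (S \<inter> {1..<1 + a}) = S \<inter> {0..<a}"
    by (auto simp: per)
  also have "emeasure lborel (S \<inter> {a..<1}) + emeasure lborel (S \<inter> {0..<a})
      = emeasure lborel ((S \<inter> {a..<1}) \<union> (S \<inter> {0..<a}))"
    by (rule plus_emeasure) auto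
  also have "(S \<inter> {a..<1}) \<union> (S \<inter> {0..<a}) = S \<inter> {0..<1}"
    using a by auto
  also have "emeasure lborel (S \<inter> {0..<1}) = emeasure haar_circle A"
    using A by (simp add: emeasure_haar_circle S_def)
  finally show "emeasure (distr haar_circle borel ((+) c)) A = emeasure haar_circle A" .
qed (simp only: sets_distr sets_haar_circle)

type_synonym torus2 = "circle \<times> circle"

definition haar_torus2 :: "torus2 measure" where
  "haar_torus2 = haar_circle \<Otimes>\<^sub>M haar_circle"

lemma sets_haar_torus2 [simp, measurable_cong]: "sets haar_torus2 = sets borel"
proof -
  have "sets haar_torus2 = sets ((borel :: circle measure) \<Otimes>\<^sub>M (borel :: circle measure))"
    unfolding haar_torus2_def by (intro sets_pair_measure_cong sets_haar_circle)
  then show ?thesis by (simp only: borel_prod)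
qed

lemma prob_space_haar_torus2: "prob_space haar_torus2"
  unfolding haar_torus2_def by (intro prob_space_pair haar_circle.prob_space_axioms)

lemma haar_torus2_invariant: "distr haar_torus2 borel ((+) g) = haar_torus2"
proof -
  obtain a b where g: "g = (a, b)" by (cases g)
  have m: "(+) c \<in> measurable haar_circle borel" for c
    using measurable_plus_circle measurable_cong_sets[OF sets_haar_circle refl] by blast
  have "haar_torus2 = distr haar_circle borel ((+) a) \<Otimes>\<^sub>M distr haar_circle borel ((+) b)"
    unfolding haar_torus2_def haar_circle_invariant ..
  also have "\<dots> = distr haar_torus2 (borel \<Otimes>\<^sub>M borel) (\<lambda>(x, y). (a + x, b + y))"
    unfolding haar_torus2_def
    by (rule pair_measure_distr[OF m m])
       (unfold haar_circle_invariant, rule haar_circle.sigma_finite_measure_axioms)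
  also have "(\<lambda>(x, y). (a + x, b + y)) = (+) g"
    by (auto simp: g)
  finally show ?thesis by (simp only: borel_prod)
qed

text \<open>Sequences are indexed by \<open>{1, 2, 3, \<dots>}\<close>; the value \<open>x 0\<close> is ignored.
  Testing against all continuous complex-valued functions is the appropriate definition on compact
  spaces.\<close>

definition uniformly_distributed ::
    "'a :: topological_space measure \<Rightarrow> (nat \<Rightarrow> 'a) \<Rightarrow> bool" where
  "uniformly_distributed \<mu> x \<longleftrightarrow>
     (\<forall>f :: 'a \<Rightarrow> complex. continuous_on UNIV f \<longrightarrow>
        (\<lambda>N. (\<Sum>n = 1..N. f (x n)) / of_nat N) \<longlonglongrightarrow> integral\<^sup>L \<mu> f)"

definition big_Omega :: "nat \<Rightarrow> nat" where
  "big_Omega n = size (prime_factorization n)"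

end

(*
By Weyl's criterion it suffices that e(h p(n) + k q(Omega(n))) has mean 0 for (h, k) <> (0, 0).

If h <> 0, the Daboussi-Katai argument applies: Omega(rn) = Omega(n) + 1 for every prime r, so after
averaging over primes r (Turan-Kubilius) and Cauchy-Schwarz only the correlations
e(h p(rn) - h p(sn)) with primes r <> s remain, and these have mean 0 by Weyl's theorem.

If h = 0, let S_a(N) be the mean of a(Omega(n)) over n <= N for a bounded sequence a. The prime
number theorem (proved here by Selberg's elementary method) shows that S_a(N) is asymptotically the
logarithmic mean of a(Omega(n) + 1), hence S_a(N/r) - S_a(N) -> 0 for each fixed r. Averaging over
primes r as above, S_a is asymptotically unchanged when a is shifted by 1. For a(m) = e(k q(m)) the
averages over J consecutive shifts tend to 0 uniformly as J grows, so S_a(N) -> 0.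
*)

theory Submission
  imports Defs "HOL-Number_Theory.Prime_Powers" "HOL-Computational_Algebra.Squarefree"
begin

section \<open>Divisor sums and Chebyshev bounds\<close>

text \<open>Turan--Kubilius turns a mean of a(Omega(n)) up to N into means of the shifted sequence
  up to N/r. For h = 0 the obstacle is this change of scale: for a bounded function such as n^(it),
  t nonzero, the means up to N and N/r need not approach each other, and there is no oscillating
  factor left to exploit. For functions of Omega the prime number theorem excludes this. Logarithmic
  means vary slowly for trivial reasons, and writing ln n as the sum of Lambda(d) over d | n,
  together with psi(y) ~ y, ties the natural mean to a logarithmic one. The windows over which
  consecutive shifts are averaged start at Omega(n), over which there is no control; hence mean
  values of polynomial phases are proved uniformly in the starting point. Both prime averages lose
  O(sqrt L) against a gain of L, where L is the sum of 1/p over a finite set of primes, so L >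
  (4/e)^2 suffices for an error e. The numerical constants in the Selberg part are not optimised.
  What matters is that the gain of one contraction step does not depend on the bound being
  improved.\<close>

definition nats_le :: "real \<Rightarrow> nat set" where
  "nats_le x = {n. 0 < n \<and> real n \<le> x}"

lemma nats_le_conv: "nats_le x = {1..nat \<lfloor>x\<rfloor>}"
  unfolding nats_le_def by (auto simp: Suc_le_eq le_nat_floor) linarith

lemma finite_nats_le [simp, intro]: "finite (nats_le x)"
  by (simp add: nats_le_conv)

lemma nats_le_of_nat [simp]: "nats_le (real N) = {1..N}"
  by (simp add: nats_le_conv)

lemma nats_le_empty [simp]: "x < 1 \<Longrightarrow> nats_le x = {}"
  by (auto simp: nats_le_def)

lemma nats_le_mono: "x \<le> y \<Longrightarrow> nats_le x \<subseteq> nats_le y"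
  by (auto simp: nats_le_def)

lemma nats_leD: "n \<in> nats_le x \<Longrightarrow> 0 < n" "n \<in> nats_le x \<Longrightarrow> real n \<le> x"
  "n \<in> nats_le x \<Longrightarrow> 1 \<le> x / real n" "n \<in> nats_le x \<Longrightarrow> 1 \<le> x"
  by (auto simp: nats_le_def field_simps)

lemma card_nats_le_le: "0 \<le> x \<Longrightarrow> real (card (nats_le x)) \<le> x"
  by (simp add: nats_le_conv)

lemma card_nats_le_ge: "x - 1 \<le> real (card (nats_le x))"
  by (simp add: nats_le_conv) linarith

lemma nats_le_times_iff: "0 < d \<Longrightarrow> 0 < m \<Longrightarrow> d * m \<in> nats_le x \<longleftrightarrow> m \<in> nats_le (x / real d)"
  by (auto simp: nats_le_def field_simps)

text \<open>The pairs (n, d) with d dividing n correspond to (d, n div d); this is how Dirichlet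
  convolutions are summed below. Cutoffs are real so that \<open>x / real d\<close> enters without
  floors.\<close>

lemma sum_divisors_nats_le:
  fixes g :: "nat \<Rightarrow> nat \<Rightarrow> 'a :: comm_monoid_add"
  shows "(\<Sum>n\<in>nats_le x. \<Sum>d | d dvd n. g d (n div d)) =
    (\<Sum>d\<in>nats_le x. \<Sum>m\<in>nats_le (x / real d). g d m)"
proof -
  have "(\<Sum>n\<in>nats_le x. \<Sum>d | d dvd n. g d (n div d)) =
      (\<Sum>(n,d)\<in>Sigma (nats_le x) (\<lambda>n. {d. d dvd n}). g d (n div d))"
    by (rule sum.Sigma) (auto dest: nats_leD)
  also have "\<dots> = (\<Sum>(d,m)\<in>Sigma (nats_le x) (\<lambda>d. nats_le (x / real d)). g d m)"
  proof (rule sum.reindex_bij_witness[of _ "\<lambda>(d,m). (d * m, d)" "\<lambda>(n,d). (d, n div d)"], goal_cases)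
    case (2 a)
    then obtain n d where a: "a = (n,d)" "n \<in> nats_le x" "d dvd n" by auto
    then obtain m where m: "n = d * m" by auto
    have "0 < d" "0 < m" using a m nats_leD(1)[of n x] by auto
    have "d * 1 \<le> d * m" using \<open>0 < m\<close> by (intro mult_left_mono) auto
    then have "real d \<le> real n" using m by (simp only: of_nat_le_iff mult_1_right)
    moreover have "real n \<le> x" using a nats_leD(2) by blast
    ultimately have "d \<in> nats_le x" using \<open>0 < d\<close> by (simp add: nats_le_def)
    then show ?case using a m \<open>0 < d\<close> \<open>0 < m\<close> nats_le_times_iff[of d m x] by simp
  next
    case (4 b)
    then obtain d m where b: "b = (d,m)" "d \<in> nats_le x" "m \<in> nats_le (x / real d)" by auto
    then show ?case using nats_le_times_iff[of d m x] by (auto dest: nats_leD)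
  qed (auto dest: nats_leD)
  also have "\<dots> = (\<Sum>d\<in>nats_le x. \<Sum>m\<in>nats_le (x / real d). g d m)"
    by (rule sum.Sigma[symmetric]) auto
  finally show ?thesis .
qed

lemma sum_divisors_nats_le':
  fixes g :: "nat \<Rightarrow> nat \<Rightarrow> 'a :: comm_monoid_add"
  shows "(\<Sum>d\<in>nats_le x. \<Sum>m\<in>nats_le (x / real d). g d (d * m)) =
    (\<Sum>n\<in>nats_le x. \<Sum>d | d dvd n. g d n)"
  unfolding sum_divisors_nats_le[of "\<lambda>d m. g d (d * m)", symmetric]
  by (intro sum.cong refl) auto

definition psi :: "real \<Rightarrow> real" where
  "psi x = (\<Sum>n\<in>nats_le x. mangoldt n)"

definition log_fact :: "real \<Rightarrow> real" where
  "log_fact x = (\<Sum>n\<in>nats_le x. ln (real n))"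

lemma psi_nonneg: "0 \<le> psi x"
  unfolding psi_def by (intro sum_nonneg mangoldt_nonneg)

lemma psi_mono: "x \<le> y \<Longrightarrow> psi x \<le> psi y"
  unfolding psi_def by (intro sum_mono2 mangoldt_nonneg nats_le_mono) auto

lemma psi_less_1 [simp]: "x < 1 \<Longrightarrow> psi x = 0"
  by (simp add: psi_def)

text \<open>Legendre's formula for the factorial of floor(x): expand each ln n as a divisor sum of
  \<open>mangoldt\<close> and count the multiples of d.\<close>

lemma log_fact_eq_sum_mangoldt:
  "log_fact x = (\<Sum>d\<in>nats_le x. mangoldt d * real (card (nats_le (x / real d))))"
proof -
  have "log_fact x = (\<Sum>n\<in>nats_le x. \<Sum>d | d dvd n. mangoldt d)"
    unfolding log_fact_def by (intro sum.cong refl) (use mangoldt_sum[where ?'a = real] nats_leD in force)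
  also have "\<dots> = (\<Sum>d\<in>nats_le x. \<Sum>m\<in>nats_le (x / real d). mangoldt d)"
    by (rule sum_divisors_nats_le[of "\<lambda>d m. mangoldt d :: real"])
  finally show ?thesis by (simp add: mult.commute)
qed

lemma nats_le_divide:
  assumes d: "0 < d"
  shows "nats_le (x / real d) = {m\<in>nats_le x. d * m \<in> nats_le x}"
proof (intro set_eqI iffI)
  fix m assume m: "m \<in> nats_le (x / real d)"
  then have dm: "d * m \<in> nats_le x" using nats_le_times_iff[of d m x] d by (auto dest: nats_leD)
  have "real m \<le> real (d * m)" unfolding of_nat_le_iff using d by simp
  also have "\<dots> \<le> x" using dm by (rule nats_leD)
  finally show "m \<in> {m\<in>nats_le x. d * m \<in> nats_le x}" using m dm by (simp add: nats_le_def)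
next
  fix m assume "m \<in> {m\<in>nats_le x. d * m \<in> nats_le x}"
  then show "m \<in> nats_le (x / real d)"
    using nats_le_times_iff[of d m x] d by (auto dest: nats_leD)
qed

text \<open>Both orders run over the pairs with d m <= x, a symmetric condition.\<close>

lemma sum_swap_nats_le:
  fixes g :: "nat \<Rightarrow> nat \<Rightarrow> 'a :: comm_monoid_add"
  shows "(\<Sum>d\<in>nats_le x. \<Sum>m\<in>nats_le (x / real d). g d m) =
    (\<Sum>m\<in>nats_le x. \<Sum>d\<in>nats_le (x / real m). g d m)"
proof -
  have "(\<Sum>d\<in>nats_le x. \<Sum>m\<in>nats_le (x / real d). g d m) =
      (\<Sum>d\<in>nats_le x. \<Sum>m | m \<in> nats_le x \<and> d * m \<in> nats_le x. g d m)"
    by (intro sum.cong refl nats_le_divide) (rule nats_leD)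
  also have "\<dots> = (\<Sum>m\<in>nats_le x. \<Sum>d | d \<in> nats_le x \<and> d * m \<in> nats_le x. g d m)"
    by (rule sum.swap_restrict) auto
  also have "\<dots> = (\<Sum>m\<in>nats_le x. \<Sum>d\<in>nats_le (x / real m). g d m)"
    using nats_le_divide[OF nats_leD(1)] by (intro sum.cong refl) (auto simp: mult.commute)
  finally show ?thesis .
qed

lemma log_fact_eq_sum_psi: "log_fact x = (\<Sum>n\<in>nats_le x. psi (x / real n))"
proof -
  have "log_fact x = (\<Sum>d\<in>nats_le x. \<Sum>m\<in>nats_le (x / real d). mangoldt d)"
    by (simp add: log_fact_eq_sum_mangoldt mult.commute)
  also have "\<dots> = (\<Sum>n\<in>nats_le x. psi (x / real n))"
    by (subst sum_swap_nats_le) (simp add: psi_def)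
  finally show ?thesis .
qed

text \<open>A weak Stirling formula. The two induction steps rest on n ln(1 + 1/n) <= 1 <= (n + 1)
  ln(1 + 1/n).\<close>

lemma log_fact_bounds_nat:
  "real (Suc N) * ln (real (Suc N)) - real (Suc N) + 1 \<le> (\<Sum>n=1..Suc N. ln (real n))"
  "(\<Sum>n=1..Suc N. ln (real n)) \<le> real (Suc N) * ln (real (Suc N)) - real (Suc N) + 1 + ln (real (Suc N))"
proof (induction N)
  case (Suc N)
  define a where "a = real (Suc N)"
  have a: "a > 0" by (simp add: a_def)
  have "ln (a + 1) - ln a \<le> 1 / a"
    using a ln_diff_le_inverse[of a] by (simp add: a_def field_simps)
  then have u: "a * (ln (a + 1) - ln a) \<le> 1" using a by (simp add: field_simps)
  have "ln (a / (a+1)) \<le> a / (a + 1) - 1" using a by (intro ln_le_minus_one) auto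
  then have "(a+1) * (ln a - ln (a + 1)) \<le> (a+1) * (a / (a + 1) - 1)"
    using a by (intro mult_left_mono) (auto simp: ln_div)
  also have "\<dots> = -1" using a by (simp add: field_simps)
  finally have l: "1 \<le> (a+1) * (ln (a+1) - ln a)" by (simp add: algebra_simps)
  have s: "(\<Sum>n=1..Suc (Suc N). ln (real n)) = (\<Sum>n=1..Suc N. ln (real n)) + ln (a + 1)"
    by (simp add: a_def add.commute)
  have e: "real (Suc (Suc N)) = a + 1" by (simp add: a_def)
  case 1
  show ?case using Suc(1) u unfolding s e a_def[symmetric] by (simp add: algebra_simps)
  case 2
  show ?case using Suc(2) l unfolding s e a_def[symmetric] by (simp add: algebra_simps)
qed auto

lemma log_fact_bound:
  assumes "x \<ge> 1"
  shows "\<bar>log_fact x - (x * ln x - x)\<bar> \<le> ln x + 1"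
proof -
  define N where "N = nat \<lfloor>x\<rfloor>"
  have N: "real N \<le> x" "x < real N + 1" "N \<ge> 1"
    using assms by (auto simp: N_def le_nat_floor)
  have lf: "log_fact x = (\<Sum>n=1..N. ln (real n))"
    by (simp add: log_fact_def nats_le_conv N_def)
  define a where "a = real N"
  have a: "a \<ge> 1" "a \<le> x" "x < a + 1" using N by (auto simp: a_def)
  have b: "a * ln a - a + 1 \<le> log_fact x" "log_fact x \<le> a * ln a - a + 1 + ln a"
    using log_fact_bounds_nat[of "N - 1"] N(3) unfolding lf a_def by simp_all
  have "ln (a / x) \<le> a / x - 1" using a by (intro ln_le_minus_one) auto
  then have "x * (ln a - ln x) \<le> x * (a / x - 1)" using a by (intro mult_left_mono) (auto simp: ln_div)
  then have 1: "x * (ln x - ln a) \<ge> x - a" using a by (simp add: algebra_simps)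
  have "ln (x / a) \<le> x / a - 1" using a by (intro ln_le_minus_one) auto
  then have "a * (ln x - ln a) \<le> a * (x / a - 1)" using a by (intro mult_left_mono) (auto simp: ln_div)
  then have 2: "a * (ln x - ln a) \<le> x - a" using a by (simp add: algebra_simps)
  have la: "0 \<le> ln a" "ln a \<le> ln x" using a by auto
  have 3: "(x - a) * ln x \<le> 1 * ln x" using a la by (intro mult_right_mono) auto
  have 4: "(x - a) * ln a \<ge> 0" using a la by simp
  show ?thesis using b 1 2 3 4 la by (auto simp: abs_le_iff algebra_simps)
qed

lemma sum_inverse_bound:
  assumes "x \<ge> 1"
  shows "\<bar>(\<Sum>n\<in>nats_le x. 1 / real n) - ln x - euler_mascheroni\<bar> \<le> 2 / x"
proof -
  define N where "N = nat \<lfloor>x\<rfloor>"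
  have N: "real N \<le> x" "x < real N + 1" "N \<ge> 1"
    using assms by (auto simp: N_def le_nat_floor)
  define a where "a = real N"
  have a: "a \<ge> 1" "a \<le> x" "x < a + 1" using N by (auto simp: a_def)
  have h: "(\<Sum>n\<in>nats_le x. 1 / real n) = harm N"
    by (simp add: nats_le_conv N_def harm_def inverse_eq_divide)
  have up: "euler_mascheroni \<le> harm N - ln (a + 1) + 1 / (2 * a)"
    using euler_mascheroni_upper[of "N - 1"] N(3) by (simp add: a_def of_nat_diff add.commute)
  have lo: "harm N - ln (a + 1) + 1 / (2 * (a + 1)) \<le> euler_mascheroni"
    using euler_mascheroni_lower[of "N - 1"] N(3) by (simp add: a_def of_nat_diff add.commute)
  have d: "ln (a + 1) - ln a \<le> 1 / a"
    using a ln_diff_le_inverse[of a] by (simp add: field_simps)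
  have l: "ln a \<le> ln x" "ln x \<le> ln (a + 1)" using a by auto
  have ax: "1 / a \<le> 2 / x" using a by (simp add: field_simps)
  have 5: "1 / (2 * a) \<le> 1 / a" "0 \<le> 1 / (2 * (a + 1))" using a by (auto simp: field_simps)
  show ?thesis unfolding h using up lo d l ax 5 unfolding abs_le_iff by linarith
qed

section \<open>Chebyshev's upper bound and Mertens' first theorem\<close>

lemma floor_half_bounds:
  fixes y :: real
  assumes "0 \<le> y"
  shows "0 \<le> real (card (nats_le y)) - 2 * real (card (nats_le (y / 2)))"
    "1 \<le> y \<Longrightarrow> y < 2 \<Longrightarrow> 1 \<le> real (card (nats_le y)) - 2 * real (card (nats_le (y / 2)))"
proof -
  have "2 * \<lfloor>y / 2\<rfloor> \<le> \<lfloor>y\<rfloor>" by linarith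
  moreover have "\<lfloor>y\<rfloor> \<ge> 0" "\<lfloor>y/2\<rfloor> \<ge> 0" using assms by auto
  ultimately have "2 * nat \<lfloor>y / 2\<rfloor> \<le> nat \<lfloor>y\<rfloor>" by linarith
  then have "real (2 * nat \<lfloor>y / 2\<rfloor>) \<le> real (nat \<lfloor>y\<rfloor>)" by (simp only: of_nat_le_iff)
  then show "0 \<le> real (card (nats_le y)) - 2 * real (card (nats_le (y / 2)))"
    by (simp add: nats_le_conv)
  assume "1 \<le> y" "y < 2"
  then have "\<lfloor>y\<rfloor> = 1" "\<lfloor>y / 2\<rfloor> = 0" by linarith+
  then show "1 \<le> real (card (nats_le y)) - 2 * real (card (nats_le (y / 2)))"
    by (simp add: nats_le_conv)
qed

lemma ln_le_two_sqrt: "ln x \<le> 2 * sqrt x" if "x > 0" for x :: real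
proof -
  have "ln (sqrt x) \<le> sqrt x - 1" using that by (intro ln_le_minus_one) auto
  then show ?thesis using that by (simp add: ln_sqrt)
qed

lemma ln_le_self: "ln x \<le> x" if "x > 0" for x :: real
  using ln_le_minus_one[OF that] by simp

text \<open>Chebyshev's argument: in \<open>log_fact x - 2 * log_fact (x / 2)\<close> each
  \<open>mangoldt d\<close> has weight floor(x/d) - 2 floor(x/(2d)), which is never negative and is
  1 for x/2 < d <= x, while Stirling makes the whole x ln 2 + O(ln x).\<close>

lemma psi_diff_half_le:
  assumes "x \<ge> 1"
  shows "psi x - psi (x / 2) \<le> 5 * x"
proof -
  have sub: "nats_le (x / 2) \<subseteq> nats_le x" using assms by (intro nats_le_mono) auto
  have h: "log_fact (x / 2) = (\<Sum>d\<in>nats_le x. mangoldt d * real (card (nats_le (x / real d / 2))))"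
  proof -
    have "log_fact (x / 2) = (\<Sum>d\<in>nats_le (x / 2). mangoldt d * real (card (nats_le (x / 2 / real d))))"
      by (rule log_fact_eq_sum_mangoldt)
    also have "\<dots> = (\<Sum>d\<in>nats_le x. mangoldt d * real (card (nats_le (x / 2 / real d))))"
    proof (rule sum.mono_neutral_left[OF _ sub], goal_cases)
      case 2
      show ?case
      proof
        fix d assume d: "d \<in> nats_le x - nats_le (x / 2)"
        then have "x / 2 / real d < 1" by (auto simp: nats_le_def field_simps)
        then show "mangoldt d * real (card (nats_le (x / 2 / real d))) = 0" by simp
      qed
    qed auto
    finally show ?thesis by (simp add: mult.commute)
  qed
  have "psi x - psi (x / 2) = (\<Sum>d\<in>nats_le x - nats_le (x / 2). mangoldt d)"
    unfolding psi_def by (rule sum_diff[symmetric]) (use sub in auto)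
  also have "\<dots> \<le> (\<Sum>d\<in>nats_le x - nats_le (x / 2).
      mangoldt d * (real (card (nats_le (x / real d))) - 2 * real (card (nats_le (x / real d / 2)))))"
  proof (rule sum_mono)
    fix d assume d: "d \<in> nats_le x - nats_le (x / 2)"
    then have "1 \<le> x / real d" "x / real d < 2" by (auto simp: nats_le_def field_simps)
    then show "mangoldt d \<le> mangoldt d * (real (card (nats_le (x / real d))) - 2 * real (card (nats_le (x / real d / 2))))"
      using floor_half_bounds(2)[of "x / real d"] mangoldt_nonneg[of d]
      by (simp add: mult_le_cancel_left1)
  qed
  also have "\<dots> \<le> (\<Sum>d\<in>nats_le x.
      mangoldt d * (real (card (nats_le (x / real d))) - 2 * real (card (nats_le (x / real d / 2)))))"
    by (intro sum_mono2 mult_nonneg_nonneg mangoldt_nonneg floor_half_bounds(1)) (use assms in auto)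
  also have "\<dots> = log_fact x - 2 * log_fact (x / 2)"
    unfolding h log_fact_eq_sum_mangoldt[of x]
    by (simp add: right_diff_distrib sum_subtractf sum_distrib_left mult_ac)
  also have "\<dots> \<le> 5 * x"
  proof (cases "x \<ge> 2")
    case True
    have "\<bar>log_fact x - (x * ln x - x)\<bar> \<le> ln x + 1" by (rule log_fact_bound) fact
    moreover have "\<bar>log_fact (x/2) - (x/2 * ln (x/2) - x/2)\<bar> \<le> ln (x/2) + 1"
      by (rule log_fact_bound) (use True in auto)
    moreover have "ln (x/2) = ln x - ln 2" using assms by (simp add: ln_div)
    moreover have "x / 2 * ln (x/2) = (x * ln x) / 2 - (x * ln 2) / 2"
      using assms by (simp add: ln_div algebra_simps)
    moreover have "ln 2 \<le> (1::real)" "0 \<le> ln (2::real)" using ln_2_less_1 by auto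
    moreover have "ln x \<le> x - 1" using assms by (intro ln_le_minus_one) auto
    moreover have "x * ln 2 \<le> x * 1" using assms ln_2_less_1 by (intro mult_left_mono) auto
    ultimately show ?thesis by linarith
  next
    \<comment> \<open>For x < 2 the sum \<open>log_fact (x / 2)\<close> is empty and
      \<open>log_fact_bound\<close> does not apply to it.\<close>
    case False
    have "\<bar>log_fact x - (x * ln x - x)\<bar> \<le> ln x + 1" by (rule log_fact_bound) fact
    moreover have "log_fact (x / 2) = 0" using False by (simp add: log_fact_def)
    moreover have "ln x \<le> x - 1" using assms by (intro ln_le_minus_one) auto
    moreover have "x * ln x \<le> x * (x - 1)" using \<open>ln x \<le> x - 1\<close> assms by (intro mult_left_mono) auto
    moreover have "x * (x - 1) \<le> x * 1" using False assms by (intro mult_left_mono) auto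
    ultimately show ?thesis using assms by linarith
  qed
  finally show ?thesis .
qed

text \<open>Repeated halving sums 5x + 5x/2 + ... to 10x; the induction is on n with x < 2^n and
  ends at x < 1, where \<open>psi\<close> vanishes.\<close>

lemma psi_le: "psi x \<le> 10 * x" if "0 \<le> x"
proof -
  have "psi x \<le> 10 * x" if "0 \<le> x" "x < 2 ^ n" for n and x :: real
    using that
  proof (induction n arbitrary: x)
    case (Suc n)
    show ?case
    proof (cases "x < 1")
      case False
      have "psi (x / 2) \<le> 10 * (x / 2)" by (rule Suc.IH) (use Suc.prems in auto)
      then show ?thesis using psi_diff_half_le[of x] False by simp
    qed (use Suc.prems in auto)
  qed auto
  moreover obtain n where "x < 2 ^ n" using real_arch_pow[of 2 x] by auto
  ultimately show ?thesis using that by blast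
qed

text \<open>Dropping the floors in Legendre's formula costs at most \<open>psi x\<close>, hence at
  most 10 x, and Stirling evaluates \<open>log_fact x\<close>.\<close>

lemma mertens_first:
  assumes "x \<ge> 1"
  shows "\<bar>(\<Sum>d\<in>nats_le x. mangoldt d / real d) - ln x\<bar> \<le> 12"
proof -
  define M where "M = (\<Sum>d\<in>nats_le x. mangoldt d / real d :: real)"
  have "log_fact x \<le> (\<Sum>d\<in>nats_le x. mangoldt d * (x / real d))"
    unfolding log_fact_eq_sum_mangoldt
    by (intro sum_mono mult_left_mono card_nats_le_le mangoldt_nonneg) (use assms in auto)
  also have "\<dots> = x * M" by (simp add: M_def sum_distrib_left mult_ac)
  finally have 1: "log_fact x \<le> x * M" .
  have "x * M - psi x = (\<Sum>d\<in>nats_le x. mangoldt d * (x / real d - 1))"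
    by (simp add: M_def psi_def sum_distrib_left sum_subtractf right_diff_distrib mult_ac)
  also have "\<dots> \<le> log_fact x"
    unfolding log_fact_eq_sum_mangoldt
    by (intro sum_mono mult_left_mono card_nats_le_ge mangoldt_nonneg)
  finally have 2: "x * M \<le> log_fact x + 10 * x" using psi_le[of x] assms by simp
  have "\<bar>log_fact x - (x * ln x - x)\<bar> \<le> ln x + 1" by (rule log_fact_bound) fact
  moreover have "ln x \<le> x - 1" using assms by (intro ln_le_minus_one) auto
  ultimately have "x * (M - ln x) \<le> x * 12" "x * (ln x - M) \<le> x * 12"
    using 1 2 by (simp_all add: algebra_simps abs_le_iff)
  then show ?thesis using assms unfolding M_def[symmetric] by (simp add: abs_le_iff)
qed

section \<open>Moebius inversion with a logarithmic weight\<close>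

definition moebius :: "nat \<Rightarrow> real" where
  "moebius n = (if squarefree n then (- 1) ^ card (prime_factors n) else 0)"

lemma abs_moebius_le: "\<bar>moebius n\<bar> \<le> 1"
  by (simp add: moebius_def power_abs)

lemma moebius_1 [simp]: "moebius (Suc 0) = 1"
  by (simp add: moebius_def)

lemma moebius_prime_times:
  assumes p: "prime p" "\<not> p dvd d"
  shows "moebius (p * d) = - moebius d"
proof (cases "squarefree d")
  case True
  then have d: "d \<noteq> 0" by (cases "d = 0") auto
  have "coprime p d" using p by (simp add: prime_imp_coprime)
  then have "squarefree (p * d)"
    using True p by (subst squarefree_mult_coprime) (auto simp: squarefree_prime)
  moreover have "prime_factors (p * d) = insert p (prime_factors d)"
    using p d by (subst prime_factors_product) (auto simp: prime_prime_factors)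
  moreover have "p \<notin> prime_factors d" using p by (auto simp: in_prime_factors_iff)
  ultimately show ?thesis using True by (simp add: moebius_def)
next
  case False
  then have "\<not> squarefree (p * d)"
    by (metis dvd_triv_right squarefree_mono)
  then show ?thesis using False by (simp add: moebius_def)
qed

text \<open>For a prime p dividing n, the squarefree divisors d prime to p cancel against p d; the
  other divisors contribute 0.\<close>

lemma sum_moebius_divisors:
  assumes "n > 0"
  shows "(\<Sum>d | d dvd n. moebius d) = (if n = 1 then 1 else 0)"
proof (cases "n = 1")
  case False
  then obtain p where p: "prime p" "p dvd n" using prime_factor_nat by blast
  let ?A = "{d. d dvd n \<and> squarefree d \<and> \<not> p dvd d}" and ?B = "{d. d dvd n \<and> squarefree d \<and> p dvd d}"
  have fin: "finite {d. d dvd n}" using assms by auto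
  have "(\<Sum>d | d dvd n. moebius d) = (\<Sum>d\<in>?A \<union> ?B. moebius d)"
    using fin by (intro sum.mono_neutral_right) (auto simp: moebius_def)
  also have "\<dots> = (\<Sum>d\<in>?A. moebius d) + (\<Sum>d\<in>?B. moebius d)"
    using fin by (intro sum.union_disjoint) auto
  also have "(\<Sum>d\<in>?B. moebius d) = (\<Sum>d\<in>?A. moebius (p * d))"
  proof (rule sum.reindex_bij_witness[of _ "\<lambda>d. p * d" "\<lambda>d. d div p"], goal_cases)
    case (2 d)
    then obtain e where e: "d = p * e" by auto
    have "p > 0" using p prime_gt_0_nat by blast
    moreover have "\<not> p dvd e"
    proof
      assume "p dvd e"
      then have "p ^ 2 dvd d" using e by (simp add: power2_eq_square)
      then show False using 2 p by (auto simp: squarefree_def)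
    qed
    moreover have "e dvd n" using 2 e by (auto intro: dvd_mult_right)
    moreover have "squarefree e" using 2 e by (auto elim: squarefree_mono[rotated])
    ultimately show ?case using e by simp
  next
    case (4 d)
    then have "coprime p d" using p by (auto simp: prime_imp_coprime)
    then have "p * d dvd n" "squarefree (p * d)"
      using 4 p by (auto intro!: divides_mult simp: squarefree_mult_coprime squarefree_prime)
    then show ?case by simp
  qed (use p prime_gt_0_nat in auto)
  also have "\<dots> = - (\<Sum>d\<in>?A. moebius d)"
    unfolding sum_negf[symmetric] using p by (intro sum.cong) (auto simp: moebius_prime_times)
  finally show ?thesis using False by simp
qed auto

lemma sum_divisors_swap:
  fixes g :: "nat \<Rightarrow> nat \<Rightarrow> 'a :: comm_monoid_add"
  assumes "n > 0"
  shows "(\<Sum>d | d dvd n. \<Sum>e | e dvd n div d. g d e) = (\<Sum>e | e dvd n. \<Sum>d | d dvd n div e. g d e)"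
proof -
  have fin: "finite {d. d dvd n}" using assms by auto
  have eq: "{e. e dvd n div d} = {e \<in> {e. e dvd n}. d * e dvd n}" if "d dvd n" for d
  proof -
    have "d > 0" using that assms by (auto intro: gcd_nat.neutr_eq_iff dvd_pos_nat)
    then show ?thesis using that
      by (auto simp: dvd_div_iff_mult mult.commute intro: dvd_mult_right dvd_mult_left)
  qed
  have "(\<Sum>d | d dvd n. \<Sum>e | e dvd n div d. g d e) = (\<Sum>d\<in>{d. d dvd n}. \<Sum>e | e \<in> {e. e dvd n} \<and> d * e dvd n. g d e)"
    using eq by (intro sum.cong) auto
  also have "\<dots> = (\<Sum>e\<in>{d. d dvd n}. \<Sum>d | d \<in> {e. e dvd n} \<and> d * e dvd n. g d e)"
    by (rule sum.swap_restrict) (use fin in auto)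
  also have "\<dots> = (\<Sum>e | e dvd n. \<Sum>d | d dvd n div e. g d e)"
    using eq by (intro sum.cong) (auto simp: mult.commute)
  finally show ?thesis .
qed

text \<open>Moebius inversion of the divisor sum ln n of \<open>mangoldt\<close>, after writing ln d
  = ln n - ln(n/d): the part with ln n survives only for n = 1, where ln n = 0.\<close>

lemma sum_moebius_ln_divisors:
  assumes n: "n > 0"
  shows "(\<Sum>d | d dvd n. moebius d * ln (real d)) = - mangoldt n"
proof -
  have fin: "finite {d. d dvd n}" using assms by auto
  have pos: "0 < d" "0 < n div d" if "d dvd n" for d
    using that n by (auto elim!: dvdE)
  have "(\<Sum>d | d dvd n. moebius d * ln (real (n div d)))
      = (\<Sum>d | d dvd n. \<Sum>e | e dvd n div d. moebius d * mangoldt e)"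
    by (intro sum.cong refl) (use pos mangoldt_sum[where ?'a = real] in \<open>force simp: sum_distrib_left[symmetric]\<close>)
  also have "\<dots> = (\<Sum>e | e dvd n. \<Sum>d | d dvd n div e. moebius d * mangoldt e)"
    by (rule sum_divisors_swap[OF n])
  also have "\<dots> = (\<Sum>e | e dvd n. if e = n then mangoldt e else 0)"
  proof (intro sum.cong refl, goal_cases)
    case (1 e)
    then have "n div e = 1 \<longleftrightarrow> e = n" using n by (auto elim!: dvdE)
    then show ?case
      using 1 pos[of e] sum_moebius_divisors[of "n div e"] by (simp add: sum_distrib_right[symmetric])
  qed
  also have "\<dots> = mangoldt n" using fin by (subst sum.delta) auto
  finally have 1: "(\<Sum>d | d dvd n. moebius d * ln (real (n div d))) = mangoldt n" .
  have "(\<Sum>d | d dvd n. moebius d * ln (real (n div d)))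
      = (\<Sum>d | d dvd n. moebius d * ln (real n) - moebius d * ln (real d))"
  proof (intro sum.cong refl, goal_cases)
    case (1 d)
    then have "ln (real (n div d)) = ln (real n) - ln (real d)"
      using pos[of d] n by (simp add: real_of_nat_div ln_div)
    then show ?case by (simp add: right_diff_distrib)
  qed
  also have "\<dots> = ln (real n) * (\<Sum>d | d dvd n. moebius d) - (\<Sum>d | d dvd n. moebius d * ln (real d))"
    by (simp add: sum_subtractf sum_distrib_left mult.commute)
  also have "ln (real n) * (\<Sum>d | d dvd n. moebius d) = 0"
    using n by (simp add: sum_moebius_divisors)
  finally show ?thesis using 1 by simp
qed

text \<open>Collect k = d m. The weight of \<open>F (x / real k)\<close> is the sum of mu(d) ln(x/d)
  over d | k, which is \<open>mangoldt k\<close>, plus ln x if k = 1. Bounds for the plain averages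
  of F thus become a relation between F and its \<open>mangoldt\<close> average.\<close>

lemma tatuzawa_iseki:
  fixes F :: "real \<Rightarrow> real"
  assumes x: "x \<ge> 1"
  shows "(\<Sum>d\<in>nats_le x. moebius d * ln (x / real d) * (\<Sum>m\<in>nats_le (x / real d). F (x / real d / real m)))
    = F x * ln x + (\<Sum>k\<in>nats_le x. mangoldt k * F (x / real k))"
proof -
  have "(\<Sum>d\<in>nats_le x. moebius d * ln (x / real d) * (\<Sum>m\<in>nats_le (x / real d). F (x / real d / real m)))
    = (\<Sum>d\<in>nats_le x. \<Sum>m\<in>nats_le (x / real d). moebius d * ln (x / real d) * F (x / real (d * m)))"
    by (simp add: sum_distrib_left)
  also have "\<dots> = (\<Sum>k\<in>nats_le x. \<Sum>d | d dvd k. moebius d * ln (x / real d) * F (x / real k))"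
    by (rule sum_divisors_nats_le')
  also have "\<dots> = (\<Sum>k\<in>nats_le x. (if k = 1 then ln x * F x else 0) + mangoldt k * F (x / real k))"
  proof (intro sum.cong refl)
    fix k assume k: "k \<in> nats_le x"
    then have k0: "k > 0" by (rule nats_leD)
    have "(\<Sum>d | d dvd k. moebius d * ln (x / real d)) = (\<Sum>d | d dvd k. moebius d * ln x - moebius d * ln (real d))"
      using x k0 by (intro sum.cong) (auto simp: ln_div right_diff_distrib dest: dvd_pos_nat)
    also have "\<dots> = ln x * (\<Sum>d | d dvd k. moebius d) + mangoldt k"
      using sum_moebius_ln_divisors[OF k0] by (simp add: sum_subtractf sum_distrib_left mult.commute)
    also have "\<dots> = (if k = 1 then ln x else 0) + mangoldt k"
      using sum_moebius_divisors[OF k0] by simp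
    finally show "(\<Sum>d | d dvd k. moebius d * ln (x / real d) * F (x / real k))
        = (if k = 1 then ln x * F x else 0) + mangoldt k * F (x / real k)"
      by (simp add: sum_distrib_right[symmetric] distrib_right)
  qed
  also have "\<dots> = F x * ln x + (\<Sum>k\<in>nats_le x. mangoldt k * F (x / real k))"
  proof -
    have "1 \<in> nats_le x" using x by (simp add: nats_le_def)
    then show ?thesis by (simp add: sum.distrib sum.delta)
  qed
  finally show ?thesis .
qed

section \<open>Selberg's formula\<close>

definition psi_err :: "real \<Rightarrow> real" where "psi_err x = psi x - x"

lemma sum_one_over_sqrt_le: "(\<Sum>n=1..N. 1 / sqrt (real n)) \<le> 2 * sqrt (real N)"
proof (induction N)
  case (Suc N)
  have "1 / sqrt (real (Suc N)) \<le> 2 * (sqrt (real (Suc N)) - sqrt (real N))"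
  proof -
    define a b where "a = sqrt (real N)" and "b = sqrt (real (Suc N))"
    have ab: "0 \<le> a" "a \<le> b" "0 < b" "b\<^sup>2 - a\<^sup>2 = 1" by (auto simp: a_def b_def)
    have "1 = (b - a) * (b + a)" using ab by (simp add: algebra_simps power2_eq_square)
    also have "\<dots> \<le> (b - a) * (2 * b)" using ab by (intro mult_left_mono) auto
    finally show ?thesis using ab unfolding a_def[symmetric] b_def[symmetric]
      by (simp add: field_simps)
  qed
  then show ?case using Suc by simp
qed auto

lemma sum_sqrt_div_le:
  assumes "x \<ge> 1"
  shows "(\<Sum>d\<in>nats_le x. sqrt (x / real d)) \<le> 2 * x"
proof -
  have "(\<Sum>d\<in>nats_le x. sqrt (x / real d)) = sqrt x * (\<Sum>d=1..nat \<lfloor>x\<rfloor>. 1 / sqrt (real d))"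
    by (simp add: nats_le_conv sum_distrib_left real_sqrt_divide)
  also have "\<dots> \<le> sqrt x * (2 * sqrt (real (nat \<lfloor>x\<rfloor>)))"
    using assms by (intro mult_left_mono sum_one_over_sqrt_le) auto
  also have "\<dots> \<le> sqrt x * (2 * sqrt x)" using assms by (intro mult_left_mono) auto
  also have "\<dots> = 2 * x" using assms by (simp add: mult.left_commute)
  finally show ?thesis .
qed

text \<open>Logarithms are traded for a square root because sqrt(x/d) summed over d <= x is only
  O(x). The constant is 16 + 12, from ln y <= 4 y^(1/4) and ln y <= 2 y^(1/2).\<close>

lemma ln_times_ln_plus_le: "ln y * (ln y + 6) \<le> 28 * sqrt y" if "y \<ge> 1" for y :: real
proof -
  have "ln y = 2 * ln (sqrt y)" using that by (simp add: ln_sqrt)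
  also have "\<dots> \<le> 2 * (2 * sqrt (sqrt y))" using that by (intro mult_left_mono ln_le_two_sqrt) auto
  finally have "ln y * ln y \<le> (4 * sqrt (sqrt y)) * (4 * sqrt (sqrt y))"
    using that by (intro mult_mono) auto
  also have "\<dots> = 16 * sqrt y" using that by simp
  finally show ?thesis using ln_le_two_sqrt[of y] that by (simp add: algebra_simps)
qed

lemma ln_le_sum_inverse: "ln y \<le> (\<Sum>n\<in>nats_le y. 1 / real n)" if "y \<ge> 1"
proof -
  have "ln y \<le> ln (real (nat \<lfloor>y\<rfloor>) + 1)" using that by (subst ln_le_cancel_iff) (auto, linarith)
  also have "\<dots> \<le> harm (nat \<lfloor>y\<rfloor>)" by (rule ln_le_harm)
  finally show ?thesis by (simp add: nats_le_conv harm_def inverse_eq_divide)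
qed

lemma sum_inverse_squares_le: "(\<Sum>n=1..N. 1 / (real n)\<^sup>2) \<le> 2"
proof -
  \<comment> \<open>The subtracted term is what makes the induction close.\<close>
  have "(\<Sum>n=1..Suc N. 1 / (real n)\<^sup>2) \<le> 2 - 1 / real (Suc N)" for N
  proof (induction N)
    case (Suc N)
    have "1 / (real (Suc (Suc N)))\<^sup>2 \<le> 1 / real (Suc N) - 1 / real (Suc (Suc N))"
    proof -
      define t where "t = real (Suc N)"
      have t: "t > 0" "real (Suc (Suc N)) = t + 1" by (auto simp: t_def)
      have "1 / (t + 1)\<^sup>2 \<le> 1 / (t * (t + 1))"
        using t by (intro divide_left_mono) (auto simp: power2_eq_square)
      also have "\<dots> = 1 / t - 1 / (t + 1)" using t by (simp add: field_simps)
      finally show ?thesis unfolding t t_def[symmetric] .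
    qed
    then show ?case using Suc by simp
  qed auto
  from this[of "N - 1"] show ?thesis by (cases N) (auto intro: order_trans)
qed

lemma euler_mascheroni_le: "euler_mascheroni \<le> (2::real)"
proof -
  have "euler_mascheroni \<le> 3 / 2 - ln (2::real)" using euler_mascheroni_upper[of 0] by (simp add: harm_def)
  moreover have "0 < ln (2::real)" by simp
  ultimately show ?thesis by linarith
qed

text \<open>The sum of psi(y/m) is \<open>log_fact y\<close> = y ln y - y + O(ln y), and the sum of
  y/m is y ln y + euler_mascheroni y + O(1). Their difference is -(euler_mascheroni + 1) y + O(ln
  y), which the added constant, taken floor(y) times, cancels.\<close>

lemma selberg_error_bound:
  assumes "y \<ge> 1"
  shows "\<bar>\<Sum>m\<in>nats_le y. psi_err (y / real m) + (euler_mascheroni + 1)\<bar> \<le> ln y + 6"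
proof -
  let ?H = "\<Sum>m\<in>nats_le y. 1 / real m" and ?g = "euler_mascheroni :: real"
  have eq: "(\<Sum>m\<in>nats_le y. psi_err (y / real m) + (?g + 1))
      = log_fact y - y * ?H + (?g + 1) * real (card (nats_le y))"
    by (simp add: psi_err_def log_fact_eq_sum_psi sum.distrib sum_subtractf sum_distrib_left)
  have g: "0 < ?g" "?g \<le> 2" by (rule euler_mascheroni_pos euler_mascheroni_le)+
  have "\<bar>y * (?H - ln y - ?g)\<bar> \<le> y * (2 / y)"
    unfolding abs_mult using assms sum_inverse_bound[OF assms] by (intro mult_mono) auto
  then have h: "\<bar>y * ?H - y * ln y - y * ?g\<bar> \<le> 2" using assms by (simp add: algebra_simps)
  have "(?g + 1) * (y - real (card (nats_le y))) \<le> (?g + 1) * 1"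
    using g card_nats_le_ge[of y] by (intro mult_left_mono) auto
  moreover have "0 \<le> (?g + 1) * (y - real (card (nats_le y)))"
    using g card_nats_le_le[of y] assms by (intro mult_nonneg_nonneg) auto
  ultimately have "(?g + 1) * y - (?g + 1) \<le> (?g + 1) * real (card (nats_le y))"
      "(?g + 1) * real (card (nats_le y)) \<le> (?g + 1) * y"
    by (simp_all add: right_diff_distrib)
  moreover have "(?g + 1) * y = y * ?g + y" by (simp add: algebra_simps)
  ultimately show ?thesis unfolding eq using log_fact_bound[OF assms] h g by linarith
qed

text \<open>Selberg's symmetry formula for psi(x) - x: \<open>tatuzawa_iseki\<close> applied to
  \<open>psi_err\<close> plus the constant of \<open>selberg_error_bound\<close>. The value 89 is 56
  from the error sum plus 3 (1 + 10) for removing that constant again.\<close>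

lemma selberg_psi_err:
  assumes x: "x \<ge> 1"
  shows "\<bar>psi_err x * ln x + (\<Sum>k\<in>nats_le x. mangoldt k * psi_err (x / real k))\<bar> \<le> 89 * x"
proof -
  let ?c = "euler_mascheroni + 1 :: real"
  let ?S = "\<Sum>d\<in>nats_le x. moebius d * ln (x / real d) * (\<Sum>m\<in>nats_le (x / real d). psi_err (x / real d / real m) + ?c)"
  have "\<bar>?S\<bar> \<le> (\<Sum>d\<in>nats_le x. 28 * sqrt (x / real d))"
  proof (rule order_trans[OF sum_abs], rule sum_mono)
    fix d assume d: "d \<in> nats_le x"
    let ?y = "x / real d"
    have y: "?y \<ge> 1" using d by (rule nats_leD)
    have "\<bar>moebius d * ln ?y * (\<Sum>m\<in>nats_le ?y. psi_err (?y / real m) + ?c)\<bar> \<le> (1 * ln ?y) * (ln ?y + 6)"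
      unfolding abs_mult using y abs_moebius_le[of d] selberg_error_bound[OF y] by (intro mult_mono) auto
    also have "\<dots> \<le> 28 * sqrt ?y" using ln_times_ln_plus_le[OF y] by simp
    finally show "\<bar>moebius d * ln ?y * (\<Sum>m\<in>nats_le ?y. psi_err (?y / real m) + ?c)\<bar> \<le> 28 * sqrt ?y" .
  qed
  also have "\<dots> \<le> 56 * x" using sum_sqrt_div_le[OF x] by (simp add: sum_distrib_left[symmetric])
  finally have 1: "\<bar>?S\<bar> \<le> 56 * x" .
  have 2: "?S = (psi_err x + ?c) * ln x + (\<Sum>k\<in>nats_le x. mangoldt k * (psi_err (x / real k) + ?c))"
    by (rule tatuzawa_iseki[OF x])
  have 3: "\<dots> = psi_err x * ln x + (\<Sum>k\<in>nats_le x. mangoldt k * psi_err (x / real k)) + ?c * (ln x + psi x)"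
    by (simp add: psi_def algebra_simps sum.distrib sum_distrib_left)
  have c: "0 \<le> ?c" "?c \<le> 3" using euler_mascheroni_pos euler_mascheroni_le by (auto simp: less_imp_le)
  have "ln x \<le> x" using x by (intro ln_le_self) auto
  then have "?c * (ln x + psi x) \<le> 3 * (x + 10 * x)"
    using x c psi_le[of x] psi_nonneg[of x] by (intro mult_mono add_mono) auto
  moreover have "0 \<le> ?c * (ln x + psi x)" using x c psi_nonneg[of x] by (intro mult_nonneg_nonneg) auto
  moreover have "\<bar>a\<bar> \<le> 89 * x" if "\<bar>a + c\<bar> \<le> 56 * x" "c \<le> 3 * (x + 10 * x)" "0 \<le> c" for a c :: real
    using that x unfolding abs_le_iff by simp
  ultimately show ?thesis using 1 unfolding 2 3 by blast
qed

text \<open>Selberg's function Lambda_2, for n >= 1 the Dirichlet convolution of mu with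
  ln^2.\<close>

definition mangoldt2 :: "nat \<Rightarrow> real" where
  "mangoldt2 n = mangoldt n * ln (real n) + (\<Sum>d | d dvd n. mangoldt d * mangoldt (n div d))"

lemma mangoldt2_nonneg: "0 \<le> mangoldt2 n"
proof (cases "n = 0")
  case False
  then show ?thesis unfolding mangoldt2_def
    by (intro add_nonneg_nonneg mult_nonneg_nonneg sum_nonneg mangoldt_nonneg) auto
qed (auto simp: mangoldt2_def intro!: sum_nonneg mult_nonneg_nonneg mangoldt_nonneg)

lemma sum_mangoldt2:
  "(\<Sum>n\<in>nats_le x. mangoldt2 n * g n) = (\<Sum>k\<in>nats_le x. mangoldt k * ln (real k) * g k)
    + (\<Sum>k\<in>nats_le x. mangoldt k * (\<Sum>m\<in>nats_le (x / real k). mangoldt m * g (k * m)))"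
proof -
  have "(\<Sum>n\<in>nats_le x. mangoldt2 n * g n) = (\<Sum>k\<in>nats_le x. mangoldt k * ln (real k) * g k)
      + (\<Sum>n\<in>nats_le x. \<Sum>d | d dvd n. mangoldt d * mangoldt (n div d) * g (d * (n div d)))"
    by (auto simp: mangoldt2_def distrib_right sum.distrib sum_distrib_right intro!: sum.cong)
  also have "(\<Sum>n\<in>nats_le x. \<Sum>d | d dvd n. mangoldt d * mangoldt (n div d) * g (d * (n div d)))
      = (\<Sum>k\<in>nats_le x. \<Sum>m\<in>nats_le (x / real k). mangoldt k * mangoldt m * g (k * m))"
    by (rule sum_divisors_nats_le[of "\<lambda>d m. mangoldt d * mangoldt m * g (d * m)"])
  finally show ?thesis by (simp add: sum_distrib_left mult.assoc)
qed

text \<open>Selberg's formula is used twice: multiply it by ln x, split ln x = ln k + ln(x/k) inside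
  the sum, and apply it again at x/k. The two sums left over have opposite signs, but in absolute
  value they combine to one \<open>mangoldt2\<close> average.\<close>

lemma psi_err_ln_squared_le:
  assumes x: "x \<ge> 1"
  shows "\<bar>psi_err x\<bar> * (ln x)\<^sup>2 \<le> (\<Sum>n\<in>nats_le x. mangoldt2 n * \<bar>psi_err (x / real n)\<bar>) + 89 * x * (2 * ln x + 12)"
proof -
  let ?A = "\<lambda>y. psi_err y * ln y + (\<Sum>k\<in>nats_le y. mangoldt k * psi_err (y / real k))"
  let ?L = "\<Sum>k\<in>nats_le x. mangoldt k * ln (real k) * psi_err (x / real k)"
  let ?D = "\<Sum>k\<in>nats_le x. mangoldt k * (\<Sum>m\<in>nats_le (x / real k). mangoldt m * psi_err (x / real (k * m)))"
  have ke: "mangoldt k * psi_err (x / real k) * ln x = mangoldt k * ln (real k) * psi_err (x / real k)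
      + mangoldt k * ?A (x / real k)
      - mangoldt k * (\<Sum>m\<in>nats_le (x / real k). mangoldt m * psi_err (x / real (k * m)))"
    if "k \<in> nats_le x" for k
  proof -
    have "ln x = ln (real k) + ln (x / real k)" using nats_leD(1)[OF that] x by (simp add: ln_div)
    then show ?thesis by (simp add: algebra_simps)
  qed
  have "psi_err x * (ln x)\<^sup>2 = ?A x * ln x - (\<Sum>k\<in>nats_le x. mangoldt k * psi_err (x / real k) * ln x)"
    by (simp add: power2_eq_square algebra_simps sum_distrib_left)
  also have "(\<Sum>k\<in>nats_le x. mangoldt k * psi_err (x / real k) * ln x)
      = ?L + (\<Sum>k\<in>nats_le x. mangoldt k * ?A (x / real k)) - ?D"
    by (subst sum.cong[OF refl ke]) (auto simp: sum.distrib sum_subtractf)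
  finally have eq: "psi_err x * (ln x)\<^sup>2
      = ?A x * ln x - (?L + (\<Sum>k\<in>nats_le x. mangoldt k * ?A (x / real k)) - ?D)" .
  have "\<bar>?A x * ln x\<bar> \<le> 89 * x * ln x"
    unfolding abs_mult using x selberg_psi_err[OF x] by (intro mult_mono) auto
  moreover have "\<bar>\<Sum>k\<in>nats_le x. mangoldt k * ?A (x / real k)\<bar> \<le> 89 * x * (ln x + 12)"
  proof -
    have "\<bar>\<Sum>k\<in>nats_le x. mangoldt k * ?A (x / real k)\<bar> \<le> (\<Sum>k\<in>nats_le x. mangoldt k * (89 * (x / real k)))"
      by (rule order_trans[OF sum_abs], rule sum_mono)
        (auto simp only: abs_mult abs_mangoldt intro!: mult_left_mono selberg_psi_err mangoldt_nonneg dest: nats_leD)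
    also have "\<dots> = 89 * x * (\<Sum>k\<in>nats_le x. mangoldt k / real k)"
      by (simp add: sum_distrib_left mult_ac)
    also have "\<dots> \<le> 89 * x * (ln x + 12)"
      using mertens_first[OF x] x by (intro mult_left_mono) auto
    finally show ?thesis .
  qed
  moreover have "\<bar>?L\<bar> + \<bar>?D\<bar> \<le> (\<Sum>n\<in>nats_le x. mangoldt2 n * \<bar>psi_err (x / real n)\<bar>)"
    unfolding sum_mangoldt2
  proof (rule add_mono)
    show "\<bar>?L\<bar> \<le> (\<Sum>k\<in>nats_le x. mangoldt k * ln (real k) * \<bar>psi_err (x / real k)\<bar>)"
      by (rule order_trans[OF sum_abs], rule sum_mono) (auto simp: abs_mult dest: nats_leD)
    show "\<bar>?D\<bar> \<le> (\<Sum>k\<in>nats_le x. mangoldt k * (\<Sum>m\<in>nats_le (x / real k). mangoldt m * \<bar>psi_err (x / real (k * m))\<bar>))"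
    proof (rule order_trans[OF sum_abs], rule sum_mono)
      fix k
      have "\<bar>\<Sum>m\<in>nats_le (x / real k). mangoldt m * psi_err (x / real (k * m))\<bar>
        \<le> (\<Sum>m\<in>nats_le (x / real k). mangoldt m * \<bar>psi_err (x / real (k * m))\<bar>)"
        by (rule order_trans[OF sum_abs], rule sum_mono) (simp add: abs_mult)
      then show "\<bar>mangoldt k * (\<Sum>m\<in>nats_le (x / real k). mangoldt m * psi_err (x / real (k * m)))\<bar>
        \<le> mangoldt k * (\<Sum>m\<in>nats_le (x / real k). mangoldt m * \<bar>psi_err (x / real (k * m))\<bar>)"
        unfolding abs_mult abs_mangoldt by (intro mult_left_mono mangoldt_nonneg)
    qed
  qed
  moreover have "\<bar>psi_err x\<bar> * (ln x)\<^sup>2 = \<bar>psi_err x * (ln x)\<^sup>2\<bar>" by (simp add: abs_mult)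
  moreover have "89 * x * (2 * ln x + 12) = 89 * x * ln x + 89 * x * (ln x + 12)" by (simp add: algebra_simps)
  ultimately show ?thesis unfolding eq by linarith
qed

text \<open>Mertens' theorem at x and at each x/k. The mass (ln x)^2 equals the factor on the left
  of \<open>psi_err_ln_squared_le\<close>, so that inequality by itself only reproduces a bound D y
  for \<open>psi_err\<close>; any improvement must come from places where \<open>psi_err\<close> is
  smaller.\<close>

lemma sum_mangoldt2_over_bound:
  assumes x: "x \<ge> 1"
  shows "\<bar>(\<Sum>n\<in>nats_le x. mangoldt2 n / real n) - (ln x)\<^sup>2\<bar> \<le> 24 * ln x + 144"
proof -
  let ?M = "\<lambda>y. \<Sum>d\<in>nats_le y. mangoldt d / real d :: real"
  have "(\<Sum>n\<in>nats_le x. mangoldt2 n / real n) = (\<Sum>n\<in>nats_le x. mangoldt2 n * (1 / real n))" by simp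
  also have "\<dots> = (\<Sum>k\<in>nats_le x. mangoldt k / real k * ln (real k))
      + (\<Sum>k\<in>nats_le x. mangoldt k / real k * ?M (x / real k))"
    unfolding sum_mangoldt2 by (simp add: sum_distrib_left mult_ac)
  also have "\<dots> = (\<Sum>k\<in>nats_le x. mangoldt k / real k * ln x
      + mangoldt k / real k * (?M (x / real k) - ln (x / real k)))"
    unfolding sum.distrib[symmetric]
  proof (intro sum.cong refl)
    fix k assume k: "k \<in> nats_le x"
    have "ln x = ln (real k) + ln (x / real k)" using nats_leD(1)[OF k] x by (simp add: ln_div)
    then show "mangoldt k / real k * ln (real k) + mangoldt k / real k * ?M (x / real k)
      = mangoldt k / real k * ln x + mangoldt k / real k * (?M (x / real k) - ln (x / real k))"
      by (simp add: algebra_simps)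
  qed
  also have "\<dots> = ?M x * ln x + (\<Sum>k\<in>nats_le x. mangoldt k / real k * (?M (x / real k) - ln (x / real k)))"
    by (simp add: sum.distrib sum_distrib_right)
  finally have eq: "(\<Sum>n\<in>nats_le x. mangoldt2 n / real n) - (ln x)\<^sup>2 =
      (?M x - ln x) * ln x + (\<Sum>k\<in>nats_le x. mangoldt k / real k * (?M (x / real k) - ln (x / real k)))"
    by (simp add: power2_eq_square algebra_simps)
  have "\<bar>(?M x - ln x) * ln x\<bar> \<le> 12 * ln x"
    unfolding abs_mult using x mertens_first[OF x] by (intro mult_mono) auto
  moreover have "\<bar>\<Sum>k\<in>nats_le x. mangoldt k / real k * (?M (x / real k) - ln (x / real k))\<bar>
      \<le> (\<Sum>k\<in>nats_le x. mangoldt k / real k * 12)"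
  proof (rule order_trans[OF sum_abs], rule sum_mono)
    fix k assume k: "k \<in> nats_le x"
    show "\<bar>mangoldt k / real k * (?M (x / real k) - ln (x / real k))\<bar> \<le> mangoldt k / real k * 12"
      unfolding abs_mult[of "mangoldt k / real k"] using mertens_first[of "x / real k"] nats_leD(3)[OF k]
      by (intro mult_mono) (auto simp: mangoldt_nonneg)
  qed
  moreover have "(\<Sum>k\<in>nats_le x. mangoldt k / real k * 12) = ?M x * 12"
    by (simp only: sum_distrib_right)
  moreover note mertens_first[OF x]
  ultimately show ?thesis unfolding eq by linarith
qed

text \<open>Selberg's formula in its usual shape. The constant is 89 + 12 + 20:
  \<open>selberg_psi_err\<close>, Mertens' theorem, and the passage from \<open>psi x * ln x\<close>
  to the sum of \<open>mangoldt k * ln (real k)\<close>.\<close>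

lemma sum_mangoldt2_bound:
  assumes x: "x \<ge> 1"
  shows "\<bar>(\<Sum>n\<in>nats_le x. mangoldt2 n) - 2 * x * ln x\<bar> \<le> 121 * x"
proof -
  let ?M = "\<lambda>y. \<Sum>d\<in>nats_le y. mangoldt d / real d :: real"
  have eq: "(\<Sum>n\<in>nats_le x. mangoldt2 n) = (\<Sum>k\<in>nats_le x. mangoldt k * ln (real k))
      + (\<Sum>k\<in>nats_le x. mangoldt k * psi (x / real k))"
    using sum_mangoldt2[of "\<lambda>_. 1" x] by (simp add: psi_def)
  have "psi_err x * ln x + (\<Sum>k\<in>nats_le x. mangoldt k * psi_err (x / real k))
      = psi x * ln x - x * ln x + (\<Sum>k\<in>nats_le x. mangoldt k * psi (x / real k)) - x * ?M x"
    by (simp add: psi_err_def algebra_simps sum_subtractf sum_distrib_left)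
  with selberg_psi_err[OF x] have 1: "\<bar>psi x * ln x - x * ln x + (\<Sum>k\<in>nats_le x. mangoldt k * psi (x / real k)) - x * ?M x\<bar> \<le> 89 * x"
    by simp
  have "\<bar>x * (?M x - ln x)\<bar> \<le> x * 12"
    unfolding abs_mult using x mertens_first[OF x] by (intro mult_mono) auto
  then have 2: "\<bar>x * ?M x - x * ln x\<bar> \<le> 12 * x" by (simp add: algebra_simps)
  have 3: "psi x * ln x - (\<Sum>k\<in>nats_le x. mangoldt k * ln (real k)) = (\<Sum>k\<in>nats_le x. mangoldt k * ln (x / real k))"
    unfolding psi_def sum_distrib_right sum_subtractf[symmetric]
    using x by (intro sum.cong refl) (auto simp: ln_div right_diff_distrib dest: nats_leD)
  \<comment> \<open>Bounding ln(x/k) by a harmonic sum and swapping leaves psi(x/j)/j <= 10 x / j^2,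
    which is summable over j.\<close>
  have "(\<Sum>k\<in>nats_le x. mangoldt k * ln (x / real k)) \<le> (\<Sum>k\<in>nats_le x. \<Sum>j\<in>nats_le (x / real k). mangoldt k * (1 / real j))"
    unfolding sum_distrib_left[symmetric]
    by (intro sum_mono mult_left_mono ln_le_sum_inverse mangoldt_nonneg) (auto dest: nats_leD)
  also have "\<dots> = (\<Sum>j\<in>nats_le x. psi (x / real j) * (1 / real j))"
    by (subst sum_swap_nats_le) (simp add: psi_def sum_divide_distrib)
  also have "\<dots> \<le> (\<Sum>j\<in>nats_le x. 10 * (x / real j) * (1 / real j))"
    using x by (intro sum_mono mult_right_mono psi_le) auto
  also have "\<dots> = 10 * x * (\<Sum>j=1..nat \<lfloor>x\<rfloor>. 1 / (real j)\<^sup>2)"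
    by (simp add: nats_le_conv sum_distrib_left power2_eq_square)
  also have "\<dots> \<le> 10 * x * 2" using x by (intro mult_left_mono sum_inverse_squares_le) auto
  finally have 4: "(\<Sum>k\<in>nats_le x. mangoldt k * ln (x / real k)) \<le> 20 * x" by simp
  have 5: "0 \<le> (\<Sum>k\<in>nats_le x. mangoldt k * ln (x / real k))"
    by (intro sum_nonneg mult_nonneg_nonneg mangoldt_nonneg ln_ge_zero) (auto dest: nats_leD)
  have 6: "2 * x * ln x = x * ln x + x * ln x" by simp
  show ?thesis unfolding eq using 1 2 3 4 5 6 by linarith
qed

section \<open>The prime number theorem\<close>

lemma abs_psi_err_le: "\<bar>psi_err x\<bar> \<le> 10 * x" if "0 \<le> x"
  using psi_le[OF that] psi_nonneg[of x] that by (auto simp: psi_err_def abs_le_iff)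

lemma psi_of_nat_Suc: "psi (real (Suc n)) = psi (real n) + mangoldt (Suc n)"
  unfolding psi_def nats_le_of_nat by simp

text \<open>Summation by parts with 1/(n (n + 1)) = 1/n - 1/(n + 1).\<close>

lemma sum_psi_telescope:
  "(\<Sum>n=1..N. psi (real n) / (real n * (real n + 1)))
    = (\<Sum>d=1..N. mangoldt d / real d) - psi (real N) / (real N + 1)"
proof (induction N)
  case (Suc N)
  define a where "a = real N + 1"
  have a: "a > 0" by (simp add: a_def)
  have "psi (real (Suc N)) / (real (Suc N) * (real (Suc N) + 1))
      = mangoldt (Suc N) / real (Suc N) - psi (real (Suc N)) / (real (Suc N) + 1) + psi (real N) / (real N + 1)"
  proof -
    have e: "real (Suc N) = a" "real N + 1 = a" by (simp_all add: a_def)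
    have "p / (a * (a + 1)) = p / a - p / (a + 1)" for p
      using a by (simp add: divide_simps) (simp add: algebra_simps)
    then show ?thesis unfolding psi_of_nat_Suc unfolding e by (simp add: add_divide_distrib)
  qed
  then show ?case using Suc by simp
qed simp

text \<open>The discrete form of the boundedness of the integral of (psi(t) - t)/t^2:
  \<open>psi\<close> and the identity each contribute ln N + O(1), the former by Mertens'
  theorem.\<close>

lemma sum_psi_err_bounded:
  "\<bar>\<Sum>n=1..N. psi_err (real n) / (real n * (real n + 1))\<bar> \<le> 30"
proof (cases "N = 0")
  case False
  have eq: "(\<Sum>n=1..N. psi_err (real n) / (real n * (real n + 1)))
      = (\<Sum>n=1..N. psi (real n) / (real n * (real n + 1))) - (\<Sum>n=1..N. 1 / (real n + 1))"
    unfolding psi_err_def diff_divide_distrib sum_subtractf by (intro arg_cong2[of _ _ _ _ "(-)"] sum.cong refl) auto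
  have N: "real N \<ge> 1" using False by simp
  have "\<bar>(\<Sum>d=1..N. mangoldt d / real d) - ln (real N)\<bar> \<le> 12"
    using mertens_first[OF N] by simp
  moreover have "0 \<le> psi (real N) / (real N + 1)" using psi_nonneg by simp
  moreover have "psi (real N) / (real N + 1) \<le> 10"
    using psi_le[of "real N"] by (simp add: field_simps)
  moreover have "(\<Sum>n=1..N. 1 / (real n + 1)) \<le> (\<Sum>n=1..N. 1 / real n)"
    by (intro sum_mono) (auto simp: field_simps)
  moreover have "(\<Sum>n=1..N. 1 / real n) = (\<Sum>n=1..N. 1 / (real n + 1)) + 1 - 1 / (real N + 1)"
    by (induction N) simp_all
  moreover have "0 \<le> 1 / (real N + 1)" by simp
  moreover have "\<bar>(\<Sum>n=1..N. 1 / real n) - ln (real N) - euler_mascheroni\<bar> \<le> 2 / real N"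
    using sum_inverse_bound[OF N] by simp
  moreover have "2 / real N \<le> 2" using N by (simp add: field_simps)
  moreover note euler_mascheroni_le euler_mascheroni_pos
  ultimately show ?thesis unfolding eq sum_psi_telescope by linarith
qed simp

lemma ln_le_sum_inverse_Suc:
  assumes "A \<le> B" shows "ln (real B + 2) - ln (real A + 1) \<le> (\<Sum>n=A..B. 1 / (real n + 1))"
  using assms
proof (induction B rule: dec_induct)
  case base
  then show ?case using ln_diff_le_inverse[of "real A + 1"] by (simp add: add.commute)
next
  case (step B)
  then show ?case using ln_diff_le_inverse[of "real B + 2"] by (simp add: algebra_simps)
qed

text \<open>If \<open>psi_err\<close> stayed away from 0 on a long interval it would keep its sign there (it changes by at
  least \<open>-1\<close> and at most \<open>ln (n + 1)\<close> per step), which contradicts \<open>sum_psi_err_bounded\<close>.\<close>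

lemma exists_small_psi_err:
  assumes \<delta>: "\<delta> > 0"
  shows "\<exists>W\<ge>2. \<exists>w0\<ge>1. \<forall>w\<ge>w0. \<exists>n. w \<le> real n \<and> real n \<le> W * w \<and> \<bar>psi_err (real n)\<bar> \<le> \<delta> * real n"
proof -
  \<comment> \<open>Makes the harmonic sum over the interval, times \<open>\<delta>\<close>, at
    least 61, against the bound 60 = 30 + 30 for a difference of two partial sums. The factor 3
    absorbs \<open>real A + 1\<close>, which is at most 3 w.\<close>
  define W where "W = 3 * exp (61 / \<delta>)"
  have "exp (61 / \<delta>) \<ge> 1" using \<delta> by simp
  then have W: "W \<ge> 3" by (simp add: W_def)
  have "((\<lambda>n. ln (real n + 1) / (2 * real n + 1)) \<longlongrightarrow> 0) sequentially" by real_asymp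
  then have "eventually (\<lambda>n. ln (real n + 1) / (2 * real n + 1) < \<delta>) sequentially"
    using \<delta> by (rule order_tendstoD)
  then obtain n1 where n1: "\<And>n. n \<ge> n1 \<Longrightarrow> ln (real n + 1) / (2 * real n + 1) < \<delta>"
    by (auto simp: eventually_sequentially)
  \<comment> \<open>From 1/\<delta> on, \<delta> n >= 1, so a decrease by at most 1 keeps a positive
    value positive. From n1 on, an increase by at most ln(n + 1) is less than \<delta> (2n + 1) and
    cannot jump from below -\<delta> n to above \<delta> (n + 1).\<close>
  define w0 where "w0 = max 1 (max (real n1) (1 / \<delta>))"
  have "\<exists>n. w \<le> real n \<and> real n \<le> W * w \<and> \<bar>psi_err (real n)\<bar> \<le> \<delta> * real n" if w: "w \<ge> w0" for w
  proof (rule ccontr)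
    assume "\<not> ?thesis"
    then have big: "\<bar>psi_err (real n)\<bar> > \<delta> * real n" if "w \<le> real n" "real n \<le> W * w" for n
      using that by force
    have w1: "w \<ge> 1" "w \<ge> real n1" "w \<ge> 1 / \<delta>" using w by (auto simp: w0_def)
    define A where "A = nat \<lceil>w\<rceil>"
    define B where "B = nat \<lfloor>W * w\<rfloor>"
    have A: "w \<le> real A" "real A < w + 1" using w1 ceiling_correct[of w] by (auto simp: A_def)
    have "W * w \<ge> 3 * w" using W w1 by simp
    have B: "real B \<le> W * w" "W * w < real B + 1" using W w1 by (auto simp: B_def) 
    have AB: "A \<le> B"
    proof -
      have "real A < real B + 1" using A B \<open>W * w \<ge> 3 * w\<close> w1 by linarith
      then show ?thesis by linarith
    qed
    have rng: "w \<le> real n" "real n \<le> W * w" if "A \<le> n" "n \<le> B" for n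
      using A B that by (meson of_nat_le_iff order_trans)+
    have step: "psi_err (real (Suc n)) = psi_err (real n) + mangoldt (Suc n) - 1" for n
      by (simp only: psi_err_def psi_of_nat_Suc)
    have up: "psi_err (real (Suc n)) > 0" if n: "A \<le> n" "Suc n \<le> B" "psi_err (real n) > 0" for n
    proof -
      have "\<delta> * real n < psi_err (real n)" using big[of n] rng[of n] n by auto
      moreover have "1 \<le> \<delta> * real n"
        using rng[of n] n w1 \<delta> by (auto simp: field_simps intro: order_trans)
      moreover have "psi_err (real (Suc n)) \<ge> psi_err (real n) - 1"
        unfolding step using mangoldt_nonneg[of "Suc n"] by linarith
      ultimately show ?thesis by linarith
    qed
    have down: "psi_err (real (Suc n)) \<le> 0" if n: "A \<le> n" "Suc n \<le> B" "psi_err (real n) \<le> 0" for n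
    proof (rule ccontr)
      assume "\<not> ?thesis"
      then have "\<delta> * real (Suc n) < psi_err (real (Suc n))" using big[of "Suc n"] rng[of "Suc n"] n by auto
      moreover have "\<delta> * real n < - psi_err (real n)" using big[of n] rng[of n] n by auto
      moreover have "mangoldt (Suc n) \<le> ln (real (Suc n))" by (rule mangoldt_le) simp
      moreover have "ln (real n + 1) < \<delta> * (2 * real n + 1)"
        using n1[of n] rng(1)[of n] n w1 by (auto simp: field_simps)
      ultimately show False unfolding step by (simp add: algebra_simps)
    qed
    have const: "(\<forall>n\<in>{A..B}. psi_err (real n) > 0) \<or> (\<forall>n\<in>{A..B}. psi_err (real n) \<le> 0)"
    proof (cases "psi_err (real A) > 0")
      case True
      have "psi_err (real n) > 0" if "A \<le> n" "n \<le> B" for n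
        using that by (induction n rule: dec_induct) (use True up in auto)
      then show ?thesis by auto
    next
      case False
      have "psi_err (real n) \<le> 0" if "A \<le> n" "n \<le> B" for n
        using that by (induction n rule: dec_induct) (use False down in auto)
      then show ?thesis by auto
    qed
    let ?f = "\<lambda>n. psi_err (real n) / (real n * (real n + 1))"
    have Apos: "A > 0" using A w1 by linarith
    have "(\<Sum>n=1..B. ?f n) = (\<Sum>n=1..A-1. ?f n) + (\<Sum>n=A..B. ?f n)"
    proof -
      have "{1..B} = {1..A-1} \<union> {A..B}" using AB Apos by auto
      then show ?thesis using Apos by (simp only:) (rule sum.union_disjoint, auto)
    qed
    then have "\<bar>\<Sum>n=A..B. ?f n\<bar> \<le> 60"
      using sum_psi_err_bounded[of B] sum_psi_err_bounded[of "A-1"] by linarith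
    moreover have "\<bar>\<Sum>n=A..B. ?f n\<bar> = (\<Sum>n=A..B. \<bar>?f n\<bar>)"
      using const
    proof
      assume *: "\<forall>n\<in>{A..B}. psi_err (real n) > 0"
      have "(\<Sum>n=A..B. ?f n) = (\<Sum>n=A..B. \<bar>?f n\<bar>)" by (intro sum.cong refl) (simp add: abs_mult abs_of_pos[OF *[rule_format]])
      then show ?thesis by (simp only:) (rule abs_of_nonneg, rule sum_nonneg, simp)
    next
      assume *: "\<forall>n\<in>{A..B}. psi_err (real n) \<le> 0"
      have "(\<Sum>n=A..B. ?f n) = - (\<Sum>n=A..B. \<bar>?f n\<bar>)"
        unfolding sum_negf[symmetric] using * by (intro sum.cong) (auto simp: abs_div abs_mult)
      then show ?thesis by (simp only: abs_minus_cancel) (rule abs_of_nonneg, rule sum_nonneg, simp)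
    qed
    moreover have "(\<Sum>n=A..B. \<delta> * (1 / (real n + 1))) \<le> (\<Sum>n=A..B. \<bar>?f n\<bar>)"
    proof (rule sum_mono)
      fix n assume n: "n \<in> {A..B}"
      then have "n > 0" using Apos by auto
      have "\<delta> * real n \<le> \<bar>psi_err (real n)\<bar>" using big[of n] rng[of n] n by auto
      then have "\<delta> * real n / (real n * (real n + 1)) \<le> \<bar>psi_err (real n)\<bar> / (real n * (real n + 1))"
        by (intro divide_right_mono) auto
      then show "\<delta> * (1 / (real n + 1)) \<le> \<bar>?f n\<bar>" using \<open>n > 0\<close> by (simp add: abs_div abs_mult)
    qed
    moreover have "\<delta> * (ln (real B + 2) - ln (real A + 1)) \<le> (\<Sum>n=A..B. \<delta> * (1 / (real n + 1)))"
      unfolding sum_distrib_left[symmetric] using \<delta> AB by (intro mult_left_mono ln_le_sum_inverse_Suc) auto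
    moreover have "61 / \<delta> \<le> ln (real B + 2) - ln (real A + 1)"
    proof -
      have "exp (61 / \<delta>) * (real A + 1) \<le> exp (61 / \<delta>) * (3 * w)"
        using A w1 by (intro mult_left_mono) auto
      also have "\<dots> = W * w" by (simp add: W_def)
      also have "\<dots> \<le> real B + 2" using B by simp
      finally have "ln (exp (61 / \<delta>) * (real A + 1)) \<le> ln (real B + 2)"
        by (subst ln_le_cancel_iff) (auto intro!: mult_pos_pos)
      then show ?thesis by (simp add: ln_mult)
    qed
    ultimately have "\<delta> * (61 / \<delta>) \<le> 60"
      using \<delta> by (smt (verit, best) mult_left_mono)
    then show False using \<delta> by simp
  qed
  moreover have "w0 \<ge> 1" by (simp add: w0_def)
  ultimately show ?thesis using W by (intro exI[of _ W] conjI exI[of _ w0]) auto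
qed

text \<open>Selberg's formula at both ends, divided by ln y, since \<open>mangoldt n * ln y\<close>
  is at most \<open>mangoldt2 n\<close> for n > y. The factor 2 is twice the true density, which is
  harmless: only a bound proportional to the length is wanted.\<close>

lemma psi_short_interval:
  assumes "1 < y" "y \<le> y'" "y' \<le> 2 * y"
  shows "psi y' - psi y \<le> 2 * (y' - y) + 400 * y / ln y"
proof -
  have sub: "nats_le y \<subseteq> nats_le y'" using assms by (intro nats_le_mono) auto
  have ly: "0 < ln y" using assms by simp
  have "psi y' - psi y = (\<Sum>n\<in>nats_le y' - nats_le y. mangoldt n)"
    unfolding psi_def by (rule sum_diff[symmetric]) (use sub in auto)
  then have "(psi y' - psi y) * ln y = (\<Sum>n\<in>nats_le y' - nats_le y. mangoldt n * ln y)"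
    by (simp only: sum_distrib_right)
  also have "\<dots> \<le> (\<Sum>n\<in>nats_le y' - nats_le y. mangoldt2 n)"
  proof (rule sum_mono)
    fix n assume n: "n \<in> nats_le y' - nats_le y"
    then have "y < real n" by (auto simp: nats_le_def)
    then have "ln y \<le> ln (real n)" using assms by simp
    then have "mangoldt n * ln y \<le> mangoldt n * ln (real n)" by (intro mult_left_mono mangoldt_nonneg)
    also have "\<dots> \<le> mangoldt2 n"
      unfolding mangoldt2_def by (simp add: sum_nonneg mangoldt_nonneg)
    finally show "mangoldt n * ln y \<le> mangoldt2 n" .
  qed
  also have "\<dots> = (\<Sum>n\<in>nats_le y'. mangoldt2 n) - (\<Sum>n\<in>nats_le y. mangoldt2 n)"
    using sum_diff[OF _ sub, of mangoldt2] by simp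
  also have "\<dots> \<le> 2 * y' * ln y' - 2 * y * ln y + 121 * y' + 121 * y"
    using sum_mangoldt2_bound[of y'] sum_mangoldt2_bound[of y] assms by (simp add: abs_le_iff)
  also have "\<dots> \<le> (2 * (y' - y)) * ln y + 400 * y"
  proof -
    have "ln y' \<le> ln (2 * y)" using assms by simp
    also have "\<dots> \<le> ln y + 1" using assms ln_2_less_1 by (simp add: ln_mult)
    finally have "2 * y' * ln y' \<le> 2 * y' * (ln y + 1)" using assms by (intro mult_left_mono) auto
    then show ?thesis using assms by (simp add: algebra_simps)
  qed
  finally show ?thesis using ly by (simp add: field_simps)
qed

text \<open>On [z, (1 + c) z] with z large, \<open>psi_err\<close> falls by at most c z and rises by
  at most 2 c z, so smallness at one integer spreads to an interval of fixed ratio. The choice c =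
  \<kappa>/4 leaves room for the initial error c z.\<close>

lemma exists_small_psi_err_interval:
  assumes \<kappa>: "0 < \<kappa>" "\<kappa> \<le> 1"
  shows "\<exists>c W w0. 0 < c \<and> c \<le> 1 \<and> 2 \<le> W \<and> 1 \<le> w0 \<and> (\<forall>w\<ge>w0. \<exists>y0\<ge>w. (1 + c) * y0 \<le> W * w \<and>
    (\<forall>y. y0 \<le> y \<longrightarrow> y \<le> (1 + c) * y0 \<longrightarrow> \<bar>psi_err y\<bar> \<le> \<kappa> * y))"
proof -
  define c where "c = \<kappa> / 4"
  have c: "0 < c" "c \<le> 1" using \<kappa> by (auto simp: c_def)
  obtain W w0 where W: "W \<ge> 2" "w0 \<ge> 1" and
    *: "\<And>w. w \<ge> w0 \<Longrightarrow> \<exists>n. w \<le> real n \<and> real n \<le> W * w \<and> \<bar>psi_err (real n)\<bar> \<le> c * real n"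
    using exists_small_psi_err[OF c(1)] by blast
  \<comment> \<open>The exponential makes the error 400 z / ln z of
    \<open>psi_short_interval\<close> at most c z.\<close>
  define w1 where "w1 = max w0 (exp (400 / c))"
  have "\<exists>y0\<ge>w. (1 + c) * y0 \<le> (2 * W) * w \<and>
    (\<forall>y. y0 \<le> y \<longrightarrow> y \<le> (1 + c) * y0 \<longrightarrow> \<bar>psi_err y\<bar> \<le> \<kappa> * y)" if w: "w \<ge> w1" for w
  proof -
    obtain n where n: "w \<le> real n" "real n \<le> W * w" "\<bar>psi_err (real n)\<bar> \<le> c * real n"
      using *[of w] w by (auto simp: w1_def)
    define z where "z = real n"
    note n = n[folded z_def]
    have "(1 + c) * z \<le> 2 * z" using c n w W by (intro mult_right_mono) (auto simp: w1_def)
    also have "\<dots> \<le> 2 * W * w" using n by simp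
    finally have 1: "(1 + c) * z \<le> (2 * W) * w" .
    have zexp: "exp (400 / c) \<le> z" using n w by (auto simp: w1_def)
    moreover have "1 < exp (400 / c)" using c by simp
    ultimately have z1: "1 < z" by linarith
    have "400 / c \<le> ln z" using zexp z1 by (simp add: ln_ge_iff)
    moreover have "0 < ln z" using z1 by simp
    ultimately have lnz: "400 * z / ln z \<le> c * z" using c z1 by (simp add: field_simps)
    have "\<bar>psi_err y\<bar> \<le> \<kappa> * y" if y: "z \<le> y" "y \<le> (1 + c) * z" for y
    proof -
      have y2: "y \<le> 2 * z" using y \<open>(1 + c) * z \<le> 2 * z\<close> by linarith
      have "psi y - psi z \<le> 2 * (y - z) + 400 * z / ln z" by (rule psi_short_interval) (use z1 y y2 in auto)
      then have u: "psi y - psi z \<le> 2 * (y - z) + c * z" using lnz by linarith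
      have l: "psi z \<le> psi y" by (rule psi_mono) fact
      have d: "y - z \<le> c * z" using y by (simp add: algebra_simps)
      have "\<bar>psi_err y\<bar> \<le> 4 * (c * z)" using n(3) u l d y z1 c unfolding psi_err_def abs_le_iff by auto
      also have "\<dots> = \<kappa> * z" by (simp add: c_def)
      also have "\<dots> \<le> \<kappa> * y" using \<kappa> y by simp
      finally show ?thesis .
    qed
    then show ?thesis using 1 n(1) by blast
  qed
  moreover have "1 \<le> w1" using W by (simp add: w1_def)
  moreover have "2 \<le> 2 * W" using W by simp
  ultimately show ?thesis using c by blast
qed

text \<open>Difference of the main terms 2 x ln x at b and at a = b/(1 + c), with 1/n >= 1/b on the
  interval. Since b <= 2a, the gain 2 (b - a) is at least b c; the number 250 covers the error 121
  at each end.\<close>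

lemma sum_mangoldt2_interval_ge:
  assumes c: "0 < c" "c \<le> 1" and b: "2 \<le> b"
  shows "c * ln b - 250 \<le> (\<Sum>n\<in>nats_le b - nats_le (b / (1 + c)). mangoldt2 n / real n)"
proof -
  define a where "a = b / (1 + c)"
  have ab: "1 \<le> a" "a \<le> b" "(1 + c) * a = b" using c b by (auto simp: a_def field_simps)
  have sub: "nats_le a \<subseteq> nats_le b" using ab by (intro nats_le_mono)
  have "2 * b * ln b - 2 * a * ln a - 121 * b - 121 * a \<le> (\<Sum>n\<in>nats_le b. mangoldt2 n) - (\<Sum>n\<in>nats_le a. mangoldt2 n)"
    using sum_mangoldt2_bound[of a] sum_mangoldt2_bound[of b] ab by (simp add: abs_le_iff)
  also have "\<dots> = (\<Sum>n\<in>nats_le b - nats_le a. mangoldt2 n)"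
    using sum_diff[OF _ sub, of mangoldt2] by simp
  also have "\<dots> \<le> (\<Sum>n\<in>nats_le b - nats_le a. b * (mangoldt2 n / real n))"
  proof (rule sum_mono)
    fix n assume "n \<in> nats_le b - nats_le a"
    then have n: "0 < n" "real n \<le> b" by (auto dest: nats_leD)
    then have "real n * mangoldt2 n \<le> b * mangoldt2 n" by (intro mult_right_mono mangoldt2_nonneg)
    then show "mangoldt2 n \<le> b * (mangoldt2 n / real n)" using n by (simp add: field_simps)
  qed
  finally have 1: "2 * b * ln b - 2 * a * ln a - 121 * b - 121 * a \<le> b * (\<Sum>n\<in>nats_le b - nats_le a. mangoldt2 n / real n)"
    by (simp only: sum_distrib_left)
  have "2 * a * ln a \<le> 2 * a * ln b" using ab by (intro mult_left_mono) auto
  moreover have "b * c * ln b \<le> 2 * (b - a) * ln b"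
  proof -
    have "b * c \<le> 2 * (b - a)"
    proof -
      have "b = a + c * a" using ab(3) by (simp add: algebra_simps)
      then have "2 * (b - a) = 2 * a * c" by simp
      moreover have "b \<le> 2 * a"
      proof -
        have "c * a \<le> 1 * a" using ab c by (intro mult_right_mono) auto
        then show ?thesis using ab(3) by (simp add: algebra_simps)
      qed
      ultimately show ?thesis using c by simp
    qed
    then show ?thesis using ab by (intro mult_right_mono) auto
  qed
  ultimately have "b * (c * ln b - 250) \<le> 2 * b * ln b - 2 * a * ln a - 121 * b - 121 * a"
  proof -
    have "b * (c * ln b - 250) = b * c * ln b - 250 * b" "2 * (b - a) * ln b = 2 * b * ln b - 2 * a * ln b"
      by (simp_all add: algebra_simps)
    then show ?thesis
      using \<open>2 * a * ln a \<le> 2 * a * ln b\<close> \<open>b * c * ln b \<le> 2 * (b - a) * ln b\<close> ab by linarith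
  qed
  with 1 have "b * (c * ln b - 250) \<le> b * (\<Sum>n\<in>nats_le b - nats_le a. mangoldt2 n / real n)" by linarith
  then show ?thesis using b unfolding a_def by simp
qed

text \<open>The intervals where \<open>psi_err\<close> is small carry a positive proportion of the mass of
  \<open>mangoldt2 n / n\<close>, so \<open>psi_err_ln_squared_le\<close> improves any bound \<open>\<bar>psi_err y\<bar> \<le> D * y\<close> by an amount
  \<open>\<eta>\<close> that does not depend on \<open>D\<close>.\<close>

lemma psi_err_contraction:
  assumes \<kappa>: "0 < \<kappa>" "\<kappa> \<le> 1"
  shows "\<exists>\<eta>>0. \<forall>D y1. 2 * \<kappa> \<le> D \<longrightarrow> D \<le> 10 \<longrightarrow> (\<forall>y\<ge>y1. \<bar>psi_err y\<bar> \<le> D * y) \<longrightarrow>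
    (\<exists>y2. \<forall>y\<ge>y2. \<bar>psi_err y\<bar> \<le> (D - \<eta>) * y)"
proof -
  obtain c W w0 where c: "0 < c" "c \<le> 1" and W: "2 \<le> W" and w0: "1 \<le> w0" and
    good: "\<And>w. w \<ge> w0 \<Longrightarrow> \<exists>y0\<ge>w. (1 + c) * y0 \<le> W * w \<and>
      (\<forall>y. y0 \<le> y \<longrightarrow> y \<le> (1 + c) * y0 \<longrightarrow> \<bar>psi_err y\<bar> \<le> \<kappa> * y)"
    using exists_small_psi_err_interval[OF \<kappa>] by blast
  have lW: "ln W > 0" using W by simp
  \<comment> \<open>Half of the coefficient that appears below: about ln x / (2 ln W) windows, each
    of mass about c ln x / 2 and each saving \<kappa>, gain \<kappa> c (ln x)^2 / (4 ln W).\<close>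
  define \<eta> where "\<eta> = \<kappa> * c / (8 * ln W)"
  have \<eta>: "\<eta> > 0" using \<kappa> c lW by (simp add: \<eta>_def)
  have "\<exists>y2. \<forall>y\<ge>y2. \<bar>psi_err y\<bar> \<le> (D - \<eta>) * y"
    if D: "2 * \<kappa> \<le> D" "D \<le> 10" and y1: "\<forall>y\<ge>y1. \<bar>psi_err y\<bar> \<le> D * y" for D y1
  proof -
    define Y where "Y = max w0 y1"
    have Y: "1 \<le> Y" using w0 by (simp add: Y_def)
    obtain i0 where i0: "Y < W ^ i0" using real_arch_pow[of W Y] W by auto
    have "\<exists>y0\<ge>W ^ i. (1 + c) * y0 \<le> W * W ^ i \<and>
      (\<forall>y. y0 \<le> y \<longrightarrow> y \<le> (1 + c) * y0 \<longrightarrow> \<bar>psi_err y\<bar> \<le> \<kappa> * y)" if "i \<ge> i0" for i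
    proof (rule good)
      have "W ^ i0 \<le> W ^ i" using that W by (intro power_increasing) auto
      then show "w0 \<le> W ^ i" using i0 by (simp add: Y_def)
    qed
    then obtain yy where yy: "\<And>i. i \<ge> i0 \<Longrightarrow> W ^ i \<le> yy i" "\<And>i. i \<ge> i0 \<Longrightarrow> (1 + c) * yy i \<le> W * W ^ i"
      "\<And>i y. i \<ge> i0 \<Longrightarrow> yy i \<le> y \<Longrightarrow> y \<le> (1 + c) * yy i \<Longrightarrow> \<bar>psi_err y\<bar> \<le> \<kappa> * y"
      by metis
    \<comment> \<open>One good window is used in each block from W^i to W^(i+1) with i0 <= i < K.
      Stopping at sqrt x keeps \<open>x / yy i\<close> above sqrt x, so the mass of each window
      involves a logarithm of at least ln x / 2.\<close>
    have main: "\<bar>psi_err x\<bar> * (ln x)\<^sup>2 \<le> x * (D * (ln x)\<^sup>2 - \<kappa> * (real K - real i0) * (c * ln x / 2 - 250)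
        + (24 * D + 20 * ln Y + 658) * ln x + 144 * D + 5000)"
      if x: "x \<ge> 4" "x \<ge> Y" and K: "K \<ge> i0" "W ^ K \<le> sqrt x" for x and K :: nat
    proof -
      let ?Z = "\<Sum>n\<in>nats_le x. mangoldt2 n * \<bar>psi_err (x / real n)\<bar>"
      \<comment> \<open>Three zones for n: in G the point x/n lies in a good window and the bound
        \<kappa> holds; in T it is below Y and only the Chebyshev bound 10 is available; elsewhere D
        holds. T has mass O(ln x), negligible against (ln x)^2.\<close>
      define I where "I i = nats_le (x / yy i) - nats_le (x / yy i / (1 + c))" for i
      define G where "G = (\<Union>i\<in>{i0..<K}. I i)"
      define T where "T = nats_le x - nats_le (x / Y)"
      have yypos: "yy i \<ge> 1" if "i \<ge> i0" for i
        using yy(1)[OF that] W one_le_power[of W i] by linarith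
      have Iiff: "n \<in> I i \<longleftrightarrow> 0 < n \<and> yy i \<le> x / real n \<and> x / real n < (1 + c) * yy i" if "i \<ge> i0" for i n
      proof -
        have p: "0 < yy i" "0 < (1 + c) * yy i" using yypos[OF that] c by auto
        have e: "x / yy i / (1 + c) = x / ((1 + c) * yy i)" by (simp add: mult.commute)
        then have "n \<in> I i \<longleftrightarrow> 0 < n \<and> real n \<le> x / yy i \<and> \<not> real n \<le> x / ((1 + c) * yy i)"
          unfolding I_def nats_le_def e by auto
        also have "\<dots> \<longleftrightarrow> 0 < n \<and> yy i \<le> x / real n \<and> x / real n < (1 + c) * yy i"
        proof (cases "n = 0")
          case False
          then have "real n \<le> x / q \<longleftrightarrow> q \<le> x / real n" if "0 < q" for q
            using that by (simp add: field_simps)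
          from this[OF p(1)] this[OF p(2)] show ?thesis by auto
        qed simp
        finally show ?thesis .
      qed
      have Isub: "I i \<subseteq> nats_le x" if "i \<ge> i0" for i
      proof -
        have "x / yy i \<le> x" using yypos[OF that] x by (simp add: field_simps)
        then show ?thesis unfolding I_def using nats_le_mono by blast
      qed
      have disj: "I i \<inter> I j = {}" if "i0 \<le> i" "i < j" for i j
      proof -
        have "(1 + c) * yy i \<le> W ^ Suc i" using yy(2)[of i] that by simp
        also have "\<dots> \<le> W ^ j" using that W by (intro power_increasing) auto
        also have "\<dots> \<le> yy j" using yy(1)[of j] that by simp
        finally show ?thesis using that by (auto simp: Iiff)
      qed
      have finG: "G \<subseteq> nats_le x" unfolding G_def using Isub by (intro UN_least) simp
      have Gsum: "(real K - real i0) * (c * ln x / 2 - 250) \<le> (\<Sum>n\<in>G. mangoldt2 n / real n)"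
      proof -
        have "(\<Sum>n\<in>G. mangoldt2 n / real n) = (\<Sum>i\<in>{i0..<K}. \<Sum>n\<in>I i. mangoldt2 n / real n)"
          unfolding G_def
        proof (rule sum.UNION_disjoint)
          show "\<forall>i\<in>{i0..<K}. \<forall>j\<in>{i0..<K}. i \<noteq> j \<longrightarrow> I i \<inter> I j = {}"
            using disj by (metis Int_commute atLeastLessThan_iff linorder_neqE_nat)
        qed (auto simp: I_def)
        also have "\<dots> \<ge> (\<Sum>i\<in>{i0..<K}. c * ln x / 2 - 250)"
        proof (rule sum_mono)
          fix i assume i: "i \<in> {i0..<K}"
          have "yy i \<le> (1 + c) * yy i" using c yypos[of i] i by simp
          also have "\<dots> \<le> W ^ Suc i" using yy(2)[of i] i by simp
          also have "\<dots> \<le> W ^ K" using i W by (intro power_increasing) auto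
          also have "\<dots> \<le> sqrt x" by (rule K)
          finally have "yy i \<le> sqrt x" .
          then have "sqrt x * yy i \<le> sqrt x * sqrt x" using x by (intro mult_left_mono) auto
          then have s: "sqrt x \<le> x / yy i" using x yypos[of i] i by (simp add: field_simps)
          have "sqrt 4 \<le> sqrt x" using x by (intro real_sqrt_le_mono)
          then have s2: "2 \<le> sqrt x" by simp
          have "c * (ln x / 2) \<le> c * ln (x / yy i)"
          proof (rule mult_left_mono)
            have "ln x / 2 = ln (sqrt x)" using x by (simp add: ln_sqrt)
            also have "\<dots> \<le> ln (x / yy i)" using s s2 x by (subst ln_le_cancel_iff) auto
            finally show "ln x / 2 \<le> ln (x / yy i)" .
          qed (use c in auto)
          moreover have "c * ln (x / yy i) - 250 \<le> (\<Sum>n\<in>I i. mangoldt2 n / real n)"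
            unfolding I_def using c s s2 by (intro sum_mangoldt2_interval_ge) auto
          ultimately show "c * ln x / 2 - 250 \<le> (\<Sum>n\<in>I i. mangoldt2 n / real n)" by simp
        qed
        finally show ?thesis using K by (simp add: of_nat_diff)
      qed
      have Tsum: "(\<Sum>n\<in>T. mangoldt2 n / real n) \<le> (48 + 2 * ln Y) * ln x + 288"
      proof -
        have xY: "1 \<le> x / Y" using x Y by simp
        have "(\<Sum>n\<in>T. mangoldt2 n / real n) = (\<Sum>n\<in>nats_le x. mangoldt2 n / real n) - (\<Sum>n\<in>nats_le (x / Y). mangoldt2 n / real n)"
          unfolding T_def by (rule sum_diff) (use x Y in \<open>auto intro!: nats_le_mono simp: field_simps\<close>)
        also have "\<dots> \<le> (ln x)\<^sup>2 + 24 * ln x + 144 - ((ln (x / Y))\<^sup>2 - 24 * ln (x / Y) - 144)"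
          using sum_mangoldt2_over_bound[of x] sum_mangoldt2_over_bound[OF xY] x unfolding abs_le_iff by linarith
        also have "ln (x / Y) = ln x - ln Y" using x Y by (simp add: ln_div)
        also have "(ln x)\<^sup>2 + 24 * ln x + 144 - ((ln x - ln Y)\<^sup>2 - 24 * (ln x - ln Y) - 144)
            = (48 + 2 * ln Y) * ln x + 288 - (ln Y)\<^sup>2 - 24 * ln Y"
          by (simp add: power2_eq_square algebra_simps)
        also have "\<dots> \<le> (48 + 2 * ln Y) * ln x + 288"
        proof -
          have "0 \<le> (ln Y)\<^sup>2" "0 \<le> ln Y" using Y by auto
          then show ?thesis by linarith
        qed
        finally show ?thesis .
      qed
      have "?Z
          \<le> (\<Sum>n\<in>nats_le x. x * (D * (mangoldt2 n / real n) - \<kappa> * (if n \<in> G then mangoldt2 n / real n else 0)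
               + 10 * (if n \<in> T then mangoldt2 n / real n else 0)))"
      proof (rule sum_mono)
        fix n assume n: "n \<in> nats_le x"
        have n0: "0 < n" using n by (rule nats_leD)
        let ?y = "x / real n"
        let ?w = "D - \<kappa> * (if n \<in> G then 1 else 0) + 10 * (if n \<in> T then 1 else 0)"
        have y0: "0 \<le> ?y" using x by simp
        have "\<bar>psi_err ?y\<bar> \<le> ?y * ?w"
        proof (cases "n \<in> G")
          case True
          then obtain i where i: "i0 \<le> i" "n \<in> I i" by (auto simp: G_def)
          then have "\<bar>psi_err ?y\<bar> \<le> \<kappa> * ?y" using yy(3)[of i ?y] by (auto simp: Iiff)
          also have "\<dots> = ?y * \<kappa>" by simp
          \<comment> \<open>Here the hypothesis 2 \<kappa> <= D enters: \<kappa> is at most D -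
            \<kappa>.\<close>
          also have "\<dots> \<le> ?y * ?w"
            using y0 True D by (intro mult_left_mono) auto
          finally show ?thesis .
        next
          case False
          show ?thesis
          proof (cases "n \<in> T")
            case True
            have "\<bar>psi_err ?y\<bar> \<le> ?y * 10" using abs_psi_err_le[OF y0] by (simp only: mult.commute)
            also have "\<dots> \<le> ?y * ?w"
              using y0 True False D \<kappa> by (intro mult_left_mono) auto
            finally show ?thesis .
          next
            case F: False
            then have "n \<in> nats_le (x / Y)" using n by (auto simp: T_def)
            then have "Y \<le> ?y" using n0 Y by (auto simp: nats_le_def field_simps)
            then have "\<bar>psi_err ?y\<bar> \<le> D * ?y" using y1 by (auto simp: Y_def)
            then have "\<bar>psi_err ?y\<bar> \<le> ?y * D" by (simp only: mult.commute)
            then show ?thesis using False F by simp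
          qed
        qed
        then have "mangoldt2 n * \<bar>psi_err ?y\<bar> \<le> mangoldt2 n * (?y * ?w)"
          by (intro mult_left_mono mangoldt2_nonneg)
        also have "\<dots> = x * (D * (mangoldt2 n / real n) - \<kappa> * (if n \<in> G then mangoldt2 n / real n else 0)
               + 10 * (if n \<in> T then mangoldt2 n / real n else 0))"
          using n0 by (auto simp: field_simps)
        finally show "mangoldt2 n * \<bar>psi_err (x / real n)\<bar> \<le> \<dots>" .
      qed
      also have "\<dots> = x * (D * (\<Sum>n\<in>nats_le x. mangoldt2 n / real n) - \<kappa> * (\<Sum>n\<in>G. mangoldt2 n / real n)
          + 10 * (\<Sum>n\<in>T. mangoldt2 n / real n))"
      proof -
        have "nats_le x \<inter> G = G" "nats_le x \<inter> T = T" using finG by (auto simp: T_def)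
        then have "(\<Sum>n\<in>nats_le x. if n \<in> G then mangoldt2 n / real n else 0) = (\<Sum>n\<in>G. mangoldt2 n / real n)"
          "(\<Sum>n\<in>nats_le x. if n \<in> T then mangoldt2 n / real n else 0) = (\<Sum>n\<in>T. mangoldt2 n / real n)"
          by (simp_all flip: sum.inter_restrict)
        then show ?thesis
          by (simp only: sum_distrib_left[symmetric] sum.distrib sum_subtractf)
      qed
      also have "\<dots> \<le> x * (D * ((ln x)\<^sup>2 + 24 * ln x + 144) - \<kappa> * ((real K - real i0) * (c * ln x / 2 - 250))
          + 10 * ((48 + 2 * ln Y) * ln x + 288))"
      proof (intro mult_left_mono add_mono diff_mono)
        show "(\<Sum>n\<in>nats_le x. mangoldt2 n / real n) \<le> (ln x)\<^sup>2 + 24 * ln x + 144"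
          using sum_mangoldt2_over_bound[of x] x unfolding abs_le_iff by linarith
      qed (use Gsum Tsum x D \<kappa> in auto)
      finally have 1: "?Z \<le> \<dots>" .
      have 2: "\<bar>psi_err x\<bar> * (ln x)\<^sup>2 \<le> ?Z + 89 * x * (2 * ln x + 12)"
        using psi_err_ln_squared_le x by simp
      \<comment> \<open>The coefficient 658 is 480 + 178, and 5000 exceeds 2880 + 1068.\<close>
      have 3: "x * (D * ((ln x)\<^sup>2 + 24 * ln x + 144) - \<kappa> * (r * z) + 10 * ((48 + 2 * ln Y) * ln x + 288))
          + 89 * x * (2 * ln x + 12)
          \<le> x * (D * (ln x)\<^sup>2 - \<kappa> * r * z + (24 * D + 20 * ln Y + 658) * ln x + 144 * D + 5000)" for r z
        using x by (simp add: algebra_simps)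
      show ?thesis
        by (rule order_trans[OF 2 order_trans[OF add_right_mono[OF 1] 3]])
    qed
    define A where "A t = (24 * D + 20 * ln Y + 658) * t + 144 * D + 5000" for t
    define J where "J t = t / (2 * ln W) - 1 - real i0" for t :: real
    have "eventually (\<lambda>x. J (ln x) \<ge> 0) at_top"
      unfolding J_def using lW by real_asymp
    moreover have "eventually (\<lambda>x::real. c * ln x / 2 - 250 \<ge> 0) at_top"
      using c by real_asymp
    moreover have "eventually (\<lambda>x. \<kappa> * J (ln x) * (c * ln x / 2 - 250) - A (ln x) \<ge> \<eta> * (ln x)\<^sup>2) at_top"
    proof -
      have "((\<lambda>t. (\<kappa> * J t * (c * t / 2 - 250) - A t) / t\<^sup>2) \<longlongrightarrow> \<kappa> * inverse (ln W) * c / 4) at_top"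
        unfolding J_def A_def using lW by real_asymp
      moreover have "\<eta> < \<kappa> * inverse (ln W) * c / 4" using \<kappa> c lW by (simp add: \<eta>_def field_simps)
      ultimately have "eventually (\<lambda>t. \<eta> < (\<kappa> * J t * (c * t / 2 - 250) - A t) / t\<^sup>2) at_top"
        by (rule order_tendstoD)
      then have "eventually (\<lambda>t. \<kappa> * J t * (c * t / 2 - 250) - A t \<ge> \<eta> * t\<^sup>2) at_top"
        using eventually_gt_at_top[of 0] by eventually_elim (simp add: field_simps)
      then show ?thesis by (rule eventually_compose_filterlim[OF _ ln_at_top])
    qed
    moreover have "eventually (\<lambda>x. x \<ge> max 4 Y) at_top" by (rule eventually_ge_at_top)
    ultimately have "eventually (\<lambda>x. \<bar>psi_err x\<bar> \<le> (D - \<eta>) * x) at_top"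
    proof eventually_elim
      case (elim x)
      define K where "K = nat \<lfloor>ln x / (2 * ln W)\<rfloor>"
      have x: "x \<ge> 4" "x \<ge> Y" using elim by auto
      have q: "0 \<le> ln x / (2 * ln W)" using x lW by simp
      have K1: "real K \<le> ln x / (2 * ln W)" "ln x / (2 * ln W) < real K + 1"
        using q by (auto simp: K_def)
      have KJ: "J (ln x) \<le> real K - real i0" using K1 by (simp add: J_def)
      then have Ki: "K \<ge> i0" using elim(1) by linarith
      have "real K * ln W \<le> ln x / 2" using K1 lW by (simp add: field_simps)
      then have "exp (real K * ln W) \<le> exp (ln x / 2)" by simp
      also have "exp (real K * ln W) = W ^ K" using W by (simp add: exp_of_nat_mult)
      also have "exp (ln x / 2) = sqrt x" 
      proof -
        have "ln x / 2 = ln (sqrt x)" using x by (simp add: ln_sqrt)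
        then show ?thesis using x by simp
      qed
      finally have KW: "W ^ K \<le> sqrt x" .
      have "\<kappa> * J (ln x) * (c * ln x / 2 - 250) \<le> \<kappa> * (real K - real i0) * (c * ln x / 2 - 250)"
        using KJ elim(2) \<kappa> by (intro mult_right_mono mult_left_mono) auto
      with elim(3) have "\<eta> * (ln x)\<^sup>2 \<le> \<kappa> * (real K - real i0) * (c * ln x / 2 - 250) - A (ln x)" by linarith
      then have "D * (ln x)\<^sup>2 - \<kappa> * (real K - real i0) * (c * ln x / 2 - 250) + A (ln x) \<le> (D - \<eta>) * (ln x)\<^sup>2"
        by (simp add: algebra_simps)
      then have "x * (D * (ln x)\<^sup>2 - \<kappa> * (real K - real i0) * (c * ln x / 2 - 250) + A (ln x)) \<le> x * ((D - \<eta>) * (ln x)\<^sup>2)"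
        using x by (intro mult_left_mono) auto
      moreover have "\<bar>psi_err x\<bar> * (ln x)\<^sup>2 \<le> x * (D * (ln x)\<^sup>2 - \<kappa> * (real K - real i0) * (c * ln x / 2 - 250) + A (ln x))"
        using main[OF x Ki KW] by (simp add: A_def add.assoc)
      ultimately have "\<bar>psi_err x\<bar> * (ln x)\<^sup>2 \<le> ((D - \<eta>) * x) * (ln x)\<^sup>2" by (simp add: mult_ac)
      moreover have "(ln x)\<^sup>2 > 0" using x by simp
      ultimately show ?case by (simp only: mult_le_cancel_right_pos)
    qed
    then show ?thesis by (auto simp: eventually_at_top_linorder)
  qed
  then show ?thesis using \<eta> by blast
qed

text \<open>The infimum of the admissible slopes D is 0. Otherwise \<kappa> is chosen from the
  infimum alone, so one contraction lowers every admissible D by the same \<eta>, and a D close to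
  the infimum ends up below it.\<close>

theorem prime_number_theorem_psi:
  assumes "\<epsilon> > 0"
  shows "\<exists>y0. \<forall>y\<ge>y0. \<bar>psi y - y\<bar> \<le> \<epsilon> * y"
proof -
  define S where "S = {D. 0 \<le> D \<and> D \<le> 10 \<and> (\<exists>y1. \<forall>y\<ge>y1. \<bar>psi_err y\<bar> \<le> D * y)}"
  have S10: "10 \<in> S" unfolding S_def using abs_psi_err_le by (auto intro!: exI[of _ 0])
  have bdd: "bdd_below S" by (auto simp: S_def intro: bdd_belowI[of _ 0])
  have Inf0: "Inf S \<ge> 0"
  proof (rule cInf_greatest)
    show "S \<noteq> {}" using S10 by blast
  qed (simp add: S_def)
  have "Inf S = 0"
  proof (rule ccontr)
    assume "Inf S \<noteq> 0"
    with Inf0 have pos: "Inf S > 0" by simp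
    define \<kappa> where "\<kappa> = min 1 (Inf S / 2)"
    have \<kappa>: "0 < \<kappa>" "\<kappa> \<le> 1" "2 * \<kappa> \<le> Inf S" using pos by (auto simp: \<kappa>_def)
    obtain \<eta> where \<eta>: "\<eta> > 0" and
      contr: "\<And>D y1. 2 * \<kappa> \<le> D \<Longrightarrow> D \<le> 10 \<Longrightarrow> (\<forall>y\<ge>y1. \<bar>psi_err y\<bar> \<le> D * y) \<Longrightarrow>
        \<exists>y2. \<forall>y\<ge>y2. \<bar>psi_err y\<bar> \<le> (D - \<eta>) * y"
      using psi_err_contraction[OF \<kappa>(1,2)] by blast
    have "\<exists>D\<in>S. D < Inf S + \<eta>"
      using cInf_lessD[of S "Inf S + \<eta>"] S10 \<eta> by auto
    then obtain D where D: "D \<in> S" "D < Inf S + \<eta>" by blast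
    have "Inf S \<le> D" by (rule cInf_lower[OF D(1) bdd])
    then have "2 * \<kappa> \<le> D" using \<kappa> by linarith
    moreover obtain y1 where "D \<le> 10" "\<forall>y\<ge>y1. \<bar>psi_err y\<bar> \<le> D * y" using D(1) by (auto simp: S_def)
    ultimately obtain y2 where y2: "\<forall>y\<ge>y2. \<bar>psi_err y\<bar> \<le> (D - \<eta>) * y"
      using contr by blast
    \<comment> \<open>Membership in S requires a nonnegative slope; D - \<eta> is one because it
      bounds an absolute value at a positive point.\<close>
    have "0 \<le> (D - \<eta>) * max 1 y2" using y2 by (meson abs_ge_zero max.cobounded2 order_trans)
    then have "0 \<le> D - \<eta>" by (simp add: zero_le_mult_iff)
    then have "D - \<eta> \<in> S" using D y2 \<eta> by (auto simp: S_def)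
    then have "Inf S \<le> D - \<eta>" by (rule cInf_lower[OF _ bdd])
    then show False using D by simp
  qed
  then obtain D where D: "D \<in> S" "D < \<epsilon>"
    using cInf_lessD[of S \<epsilon>] S10 assms by (metis empty_iff)
  then obtain y1 where y1: "\<forall>y\<ge>y1. \<bar>psi_err y\<bar> \<le> D * y" by (auto simp: S_def)
  have "\<bar>psi y - y\<bar> \<le> \<epsilon> * y" if "y \<ge> max 0 y1" for y
  proof -
    have "\<bar>psi_err y\<bar> \<le> D * y" using y1 that by auto
    also have "\<dots> \<le> \<epsilon> * y" using D that by (intro mult_right_mono) auto
    finally show ?thesis by (simp add: psi_err_def)
  qed
  then show ?thesis by blast
qed

section \<open>Weyl's theorem for polynomials\<close>

text \<open>The uniformity in the starting point m is what later permits windows beginning at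
  Omega(n).\<close>

definition uniform_mean_zero :: "(nat \<Rightarrow> complex) \<Rightarrow> bool" where
  "uniform_mean_zero f \<longleftrightarrow> (\<forall>\<epsilon>>0. \<exists>N0. \<forall>N\<ge>N0. \<forall>m. norm (\<Sum>n<N. f (m + n)) \<le> \<epsilon> * real N)"

lemma sum_shift_diff_le:
  fixes f :: "nat \<Rightarrow> complex"
  assumes "\<And>n. norm (f n) \<le> 1"
  shows "norm ((\<Sum>n<N. f (m + n + h)) - (\<Sum>n<N. f (m + n))) \<le> 2 * real h"
proof (induction h)
  case (Suc h)
  have "(\<Sum>n<N. f (m + n + Suc h)) - (\<Sum>n<N. f (m + n + h)) = f (m + N + h) - f (m + h)"
    using sum_lessThan_telescope[of "\<lambda>n. f (m + n + h)" N] by (simp add: sum_subtractf)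
  moreover have "norm (f (m + N + h) - f (m + h)) \<le> 1 + 1"
    by (intro order_trans[OF norm_triangle_ineq4] add_mono assms)
  ultimately have "norm ((\<Sum>n<N. f (m + n + Suc h)) - (\<Sum>n<N. f (m + n + h))) \<le> 2" by simp
  with Suc show ?case
    using norm_triangle_ineq[of "(\<Sum>n<N. f (m + n + Suc h)) - (\<Sum>n<N. f (m + n + h))"
      "(\<Sum>n<N. f (m + n + h)) - (\<Sum>n<N. f (m + n))"] by simp
qed simp

lemma norm_sum_squared_le:
  fixes z :: "'a \<Rightarrow> complex"
  shows "(norm (\<Sum>n\<in>A. z n))\<^sup>2 \<le> real (card A) * (\<Sum>n\<in>A. (norm (z n))\<^sup>2)"
proof -
  have "(norm (\<Sum>n\<in>A. z n))\<^sup>2 \<le> (\<Sum>n\<in>A. 1 * norm (z n))\<^sup>2"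
    by (intro power_mono) (auto intro: norm_sum)
  also have "\<dots> \<le> (\<Sum>n\<in>A. 1\<^sup>2) * (\<Sum>n\<in>A. (norm (z n))\<^sup>2)"
    by (rule Cauchy_Schwarz_ineq_sum)
  finally show ?thesis by simp
qed

lemma norm_sum_squared_expand:
  fixes z :: "'a \<Rightarrow> complex"
  shows "of_real ((norm (\<Sum>h\<in>H. z h))\<^sup>2) = (\<Sum>h\<in>H. \<Sum>h'\<in>H. z h * cnj (z h'))"
  unfolding complex_norm_square by (simp add: sum_product)

text \<open>The double sum is real and nonnegative; the norm around it lets the correlations be
  bounded term by term with \<open>sum_norm_le\<close>.\<close>

lemma sum_norm_sum_squared:
  fixes z :: "'a \<Rightarrow> 'b \<Rightarrow> complex"
  shows "(\<Sum>n\<in>A. (norm (\<Sum>h\<in>H. z n h))\<^sup>2) = norm (\<Sum>h\<in>H. \<Sum>h'\<in>H. \<Sum>n\<in>A. z n h * cnj (z n h'))"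
proof -
  define T where "T = (\<Sum>n\<in>A. (norm (\<Sum>h\<in>H. z n h))\<^sup>2)"
  have "of_real T = (\<Sum>h\<in>H. \<Sum>h'\<in>H. \<Sum>n\<in>A. z n h * cnj (z n h'))"
    unfolding T_def of_real_sum norm_sum_squared_expand
    by (rule trans[OF sum.swap], rule sum.cong[OF refl], rule sum.swap)
  then have "norm (complex_of_real T) = norm (\<Sum>h\<in>H. \<Sum>h'\<in>H. \<Sum>n\<in>A. z n h * cnj (z n h'))"
    by (rule arg_cong)
  moreover have "0 \<le> T" unfolding T_def by (intro sum_nonneg) simp
  ultimately show ?thesis unfolding T_def[symmetric] by (simp only: norm_of_real abs_of_nonneg)
qed

text \<open>Replace the sum by its average over H shifts and apply Cauchy--Schwarz. In the expanded
  square only the H diagonal pairs out of H^2 fail to be small. Every estimate is uniform in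
  m.\<close>

lemma van_der_Corput:
  fixes f :: "nat \<Rightarrow> complex"
  assumes f: "\<And>n. norm (f n) \<le> 1"
    and corr: "\<And>h. h > 0 \<Longrightarrow> uniform_mean_zero (\<lambda>n. f (n + h) * cnj (f n))"
  shows "uniform_mean_zero f"
  unfolding uniform_mean_zero_def
proof (intro allI impI)
  fix \<epsilon> :: real assume \<epsilon>: "\<epsilon> > 0"
  \<comment> \<open>Chosen so that the final bound 2 \<delta> H^2 N^2 is the square of \<epsilon> H
    N / 2.\<close>
  define \<delta> where "\<delta> = (\<epsilon> / 2)\<^sup>2 / 2"
  have \<delta>: "\<delta> > 0" using \<epsilon> by (simp add: \<delta>_def)
  obtain H :: nat where H: "H > 0" "1 / real H < \<delta>" using reals_Archimedean[OF \<delta>]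
    by (metis inverse_eq_divide zero_less_Suc)
  have "\<exists>N0. \<forall>N\<ge>N0. \<forall>m. norm (\<Sum>n<N. f (m + n + h) * cnj (f (m + n))) \<le> (\<delta> / 2) * real N"
    if "h \<in> {1..H}" for h
  proof -
    have "uniform_mean_zero (\<lambda>n. f (n + h) * cnj (f n))" using corr that by simp
    then show ?thesis using \<delta> unfolding uniform_mean_zero_def by (meson half_gt_zero)
  qed
  then obtain M where M: "\<And>h N m. h \<in> {1..H} \<Longrightarrow> N \<ge> M h \<Longrightarrow> norm (\<Sum>n<N. f (m + n + h) * cnj (f (m + n))) \<le> (\<delta> / 2) * real N"
    by metis
  \<comment> \<open>The two quotients absorb boundary terms: 2 H <= \<epsilon> N / 2 for shifting f
    itself, and 2 h' <= \<delta> N / 2 for moving a correlation sum by h'.\<close>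
  define N0 where "N0 = Max (insert (nat \<lceil>max (4 * real H / \<epsilon>) (4 * real H / \<delta>)\<rceil>) (M ` {1..H}))"
  show "\<exists>N0. \<forall>N\<ge>N0. \<forall>m. norm (\<Sum>n<N. f (m + n)) \<le> \<epsilon> * real N"
  proof (intro exI[of _ N0] allI impI)
    fix N m assume N: "N \<ge> N0"
    have "nat \<lceil>max (4 * real H / \<epsilon>) (4 * real H / \<delta>)\<rceil> \<le> N0" unfolding N0_def by (rule Max_ge) auto
    then have "max (4 * real H / \<epsilon>) (4 * real H / \<delta>) \<le> real N" using N by linarith
    then have N1: "4 * real H \<le> \<epsilon> * real N" "4 * real H \<le> \<delta> * real N"
      using \<epsilon> \<delta> by (auto simp: field_simps)
    have NM: "N \<ge> M h" if "h \<in> {1..H}" for h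
    proof -
      have "M h \<le> N0" unfolding N0_def using that by (intro Max_ge) auto
      then show ?thesis using N by simp
    qed
    have pair: "norm (\<Sum>n<N. f (m + n + h) * cnj (f (m + n + h'))) \<le> \<delta> * real N"
      if "h < H" "h' < h" for h h'
    proof -
      let ?g = "\<lambda>n. f (n + (h - h')) * cnj (f n)"
      have "norm (?g n) \<le> 1" for n using f[of n] f[of "n + (h - h')"]
        by (simp add: norm_mult mult_le_one)
      then have "norm ((\<Sum>n<N. ?g (m + n + h')) - (\<Sum>n<N. ?g (m + n))) \<le> 2 * real h'"
        by (rule sum_shift_diff_le)
      moreover have "(\<Sum>n<N. ?g (m + n + h')) = (\<Sum>n<N. f (m + n + h) * cnj (f (m + n + h')))"
        using that by (simp add: add.assoc)
      moreover have "norm (\<Sum>n<N. ?g (m + n)) \<le> (\<delta> / 2) * real N"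
        using that by (intro M NM) auto
      moreover have "2 * real h' \<le> (\<delta> / 2) * real N" using N1(2) that by simp
      ultimately show ?thesis
        using norm_triangle_ineq[of "(\<Sum>n<N. ?g (m + n + h')) - (\<Sum>n<N. ?g (m + n))" "\<Sum>n<N. ?g (m + n)"] by simp
    qed
    have pair': "norm (\<Sum>n<N. f (m + n + h) * cnj (f (m + n + h'))) \<le> \<delta> * real N"
      if "h < H" "h' < H" "h \<noteq> h'" for h h'
    proof (cases "h' < h")
      case False
      have "norm (\<Sum>n<N. f (m + n + h) * cnj (f (m + n + h'))) = norm (cnj (\<Sum>n<N. f (m + n + h') * cnj (f (m + n + h))))"
        by (simp add: mult.commute)
      also have "\<dots> = norm (\<Sum>n<N. f (m + n + h') * cnj (f (m + n + h)))" by (rule complex_mod_cnj)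
      also have "\<dots> \<le> \<delta> * real N" using False that by (intro pair) auto
      finally show ?thesis .
    qed (use that pair in auto)
    define V where "V = (\<Sum>n<N. \<Sum>h<H. f (m + n + h))"
    have "norm (of_nat H * (\<Sum>n<N. f (m + n)) - V) \<le> (\<Sum>h<H. 2 * real H)"
    proof -
      have "V - of_nat H * (\<Sum>n<N. f (m + n)) = (\<Sum>h<H. (\<Sum>n<N. f (m + n + h)) - (\<Sum>n<N. f (m + n)))"
        unfolding V_def by (subst sum.swap) (simp add: sum_subtractf)
      moreover have "norm \<dots> \<le> (\<Sum>h<H. 2 * real H)"
        by (intro sum_norm_le order_trans[OF sum_shift_diff_le[OF f]]) auto
      ultimately show ?thesis by (simp add: norm_minus_commute)
    qed
    then have V1: "real H * norm (\<Sum>n<N. f (m + n)) \<le> norm V + 2 * real H * real H"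
      using norm_triangle_ineq[of "of_nat H * (\<Sum>n<N. f (m + n)) - V" V] by (simp add: norm_mult)
    have "(norm V)\<^sup>2 \<le> real N * (\<Sum>n<N. (norm (\<Sum>h<H. f (m + n + h)))\<^sup>2)"
      unfolding V_def using norm_sum_squared_le[of "\<lambda>n. \<Sum>h<H. f (m + n + h)" "{..<N}"] by simp
    also have "(\<Sum>n<N. (norm (\<Sum>h<H. f (m + n + h)))\<^sup>2) \<le> (\<Sum>h<H. \<Sum>h'<H. \<delta> * real N + (if h = h' then real N else 0))"
    proof -
      have "(\<Sum>n<N. (norm (\<Sum>h<H. f (m + n + h)))\<^sup>2)
          = norm (\<Sum>h<H. \<Sum>h'<H. \<Sum>n<N. f (m + n + h) * cnj (f (m + n + h')))"
        by (rule sum_norm_sum_squared)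
      also have "\<dots> \<le> (\<Sum>h<H. \<Sum>h'<H. \<delta> * real N + (if h = h' then real N else 0))"
      proof (intro sum_norm_le)
        fix h h' assume h: "h \<in> {..<H}" "h' \<in> {..<H}"
        show "norm (\<Sum>n<N. f (m + n + h) * cnj (f (m + n + h'))) \<le> \<delta> * real N + (if h = h' then real N else 0)"
        proof (cases "h = h'")
          case True
          have "norm (\<Sum>n<N. f (m + n + h) * cnj (f (m + n + h'))) \<le> (\<Sum>n<N. 1)"
            by (intro sum_norm_le) (auto simp: norm_mult intro!: mult_le_one f)
          then show ?thesis using True \<delta> by (simp add: add_increasing)
        qed (use h pair' in auto)
      qed
      finally show ?thesis .
    qed
    also have "\<dots> = real H * real H * \<delta> * real N + real H * real N"
      by (simp add: sum.distrib algebra_simps)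
    also have "\<dots> \<le> 2 * real H * real H * \<delta> * real N"
    proof -
      have "1 \<le> \<delta> * real H" using H by (simp add: field_simps)
      then have "1 * (real H * real N) \<le> (\<delta> * real H) * (real H * real N)" by (intro mult_right_mono) auto
      then show ?thesis by (simp add: algebra_simps)
    qed
    finally have "(norm V)\<^sup>2 \<le> real N * (2 * real H * real H * \<delta> * real N)" by (simp add: mult_left_mono)
    also have "\<dots> = (\<epsilon> / 2 * real H * real N)\<^sup>2" by (simp add: \<delta>_def power2_eq_square)
    finally have "norm V \<le> \<epsilon> / 2 * real H * real N"
      by (rule power2_le_imp_le) (use \<epsilon> in auto)
    with V1 have "real H * norm (\<Sum>n<N. f (m + n)) \<le> real H * (\<epsilon> / 2 * real N + 2 * real H)"
      by (simp add: algebra_simps)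
    then have "norm (\<Sum>n<N. f (m + n)) \<le> \<epsilon> / 2 * real N + 2 * real H" using H by simp
    then show "norm (\<Sum>n<N. f (m + n)) \<le> \<epsilon> * real N" using N1(1) by simp
  qed
qed

section \<open>Polynomial phases with an irrational coefficient\<close>

definition circle_exp :: "real \<Rightarrow> complex" where
  "circle_exp x = cis (2 * pi * x)"

lemma norm_circle_exp [simp]: "norm (circle_exp x) = 1"
  by (simp add: circle_exp_def)

lemma circle_exp_0 [simp]: "circle_exp 0 = 1"
  by (simp add: circle_exp_def)

lemma circle_exp_add: "circle_exp (x + y) = circle_exp x * circle_exp y"
  by (simp add: circle_exp_def cis_mult distrib_left)

lemma circle_exp_diff: "circle_exp (x - y) = circle_exp x * cnj (circle_exp y)"
  by (simp add: circle_exp_def cis_mult cis_cnj right_diff_distrib)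

lemma circle_exp_eq_1_iff: "circle_exp x = 1 \<longleftrightarrow> x \<in> \<int>"
proof
  assume "circle_exp x = 1"
  then have "cos (2 * pi * x) = 1" by (simp add: circle_exp_def complex_eq_iff)
  then obtain n :: int where "2 * pi * x = of_int n * 2 * pi"
    using cos_one_2pi_int[of "2 * pi * x"] by blast
  then have "x = of_int n" by simp
  then show "x \<in> \<int>" by simp
next
  assume "x \<in> \<int>"
  then obtain n where "x = of_int n" by (auto elim: Ints_cases)
  then show "circle_exp x = 1" by (simp add: circle_exp_def complex_eq_iff cos_int_2pin sin_int_2pin)
qed

lemma circle_exp_cong: "x - y \<in> \<int> \<Longrightarrow> circle_exp x = circle_exp y"
  using circle_exp_add[of "x - y" y] circle_exp_eq_1_iff[of "x - y"] by simp

lemma Rats_common_denominator: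
  assumes "finite A" "\<And>x. x \<in> A \<Longrightarrow> x \<in> (\<rat> :: real set)"
  shows "\<exists>D::nat. D > 0 \<and> (\<forall>x\<in>A. x * real D \<in> \<int>)"
  using assms
proof (induction rule: finite_induct)
  case (insert x A)
  then obtain D where D: "D > 0" "\<forall>y\<in>A. y * real D \<in> \<int>" by auto
  have "x \<in> \<rat>" using insert by auto
  then obtain m n where mn: "n > 0" "x = of_int m / of_int n" by (rule Rats_cases') auto
  have "y * real (D * nat n) \<in> \<int>" if "y \<in> insert x A" for y
  proof (cases "y = x")
    case True
    have "y * real (D * nat n) = of_int (m * int D)" using mn True by simp
    then show ?thesis by (simp only: Ints_of_int)
  next
    case False
    then have "y * real D \<in> \<int>" using D that by auto
    then have "y * real D * of_int n \<in> \<int>" by (rule Ints_mult) simp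
    then show ?thesis using mn by (simp add: mult_ac)
  qed
  then show ?case using D mn by (intro exI[of _ "D * nat n"]) auto
qed (auto intro: exI[of _ 1])

text \<open>Let D be a common denominator of the coefficients above the linear one. As D divides (n
  + D)^i - n^i, the step from n to n + D multiplies the phase by a constant w, and w is not 1
  because \<open>coeff p 1\<close> is irrational. Then w - 1 times the sum is a boundary term
  bounded by 2 D.\<close>

lemma uniform_mean_zero_almost_linear:
  fixes p :: "real poly"
  assumes c: "coeff p 1 \<notin> \<rat>" and r: "\<And>i. i > 1 \<Longrightarrow> coeff p i \<in> \<rat>"
  shows "uniform_mean_zero (\<lambda>n. circle_exp (poly p (real n)))"
proof -
  have "\<exists>D::nat. D > 0 \<and> (\<forall>x\<in>coeff p ` {2..degree p}. x * real D \<in> \<int>)"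
    by (rule Rats_common_denominator) (use r in auto)
  then obtain D where D: "D > 0" "\<forall>x\<in>coeff p ` {2..degree p}. x * real D \<in> \<int>" by blast
  define w where "w = circle_exp (coeff p 1 * real D)"
  have w: "w \<noteq> 1"
  proof
    assume "w = 1"
    then have "coeff p 1 * real D \<in> \<int>" by (simp add: w_def circle_exp_eq_1_iff)
    then have "coeff p 1 * real D / real D \<in> \<rat>" by (intro Rats_divide) (auto simp: Ints_subset_Rats[THEN subsetD])
    then show False using c D by simp
  qed
  define f where "f n = circle_exp (poly p (real n))" for n
  have nf: "norm (f n) \<le> 1" for n by (simp add: f_def)
  have per: "f (n + D) = w * f n" for n
  proof -
    have "poly p (real (n + D)) - poly p (real n) - coeff p 1 * real D
        = (\<Sum>i\<in>{2..degree p}. coeff p i * (real (n + D) ^ i - real n ^ i))"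
    proof -
      have *: "poly p x = coeff p 0 + coeff p 1 * x + (\<Sum>i\<in>{2..degree p}. coeff p i * x ^ i)" for x
      proof -
        have "poly p x = (\<Sum>i\<le>degree p + 1. coeff p i * x ^ i)"
          unfolding poly_altdef by (rule sum.mono_neutral_left) (auto simp: coeff_eq_0)
        also have "{..degree p + 1} = {0,1} \<union> {2..degree p + 1}" by auto
        also have "(\<Sum>i\<in>\<dots>. coeff p i * x ^ i) = coeff p 0 + coeff p 1 * x + (\<Sum>i\<in>{2..degree p + 1}. coeff p i * x ^ i)"
          by (subst sum.union_disjoint) auto
        also have "(\<Sum>i\<in>{2..degree p + 1}. coeff p i * x ^ i) = (\<Sum>i\<in>{2..degree p}. coeff p i * x ^ i)"
          by (rule sum.mono_neutral_right) (auto simp: coeff_eq_0)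
        finally show ?thesis .
      qed
      show ?thesis unfolding * by (simp add: algebra_simps sum_subtractf)
    qed
    also have "\<dots> \<in> \<int>"
    proof (rule Ints_sum)
      fix i assume i: "i \<in> {2..degree p}"
      have "int D dvd int (n + D) ^ i - int n ^ i"
        using power_diff_sumr2[of "int (n + D)" i "int n"] by simp
      then obtain k where "int (n + D) ^ i - int n ^ i = int D * k" by (elim dvdE)
      then have "of_int (int (n + D) ^ i - int n ^ i) = (of_int (int D * k) :: real)" by (simp only:)
      then have "real (n + D) ^ i - real n ^ i = real D * of_int k" by simp
      then have "coeff p i * (real (n + D) ^ i - real n ^ i) = coeff p i * real D * of_int k" by simp
      also have "\<dots> \<in> \<int>" by (rule Ints_mult[of "coeff p i * real D"]) (use D i in auto)
      finally show "coeff p i * (real (n + D) ^ i - real n ^ i) \<in> \<int>" .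
    qed
    finally have "circle_exp (poly p (real (n + D))) = circle_exp (coeff p 1 * real D + poly p (real n))"
      by (intro circle_exp_cong) (simp add: algebra_simps)
    then show ?thesis by (simp add: f_def w_def circle_exp_add)
  qed
  have bound: "norm (\<Sum>n<N. f (m + n)) \<le> 2 * real D / norm (w - 1)" for N m
  proof -
    have "(w - 1) * (\<Sum>n<N. f (m + n)) = (\<Sum>n<N. f (m + n + D)) - (\<Sum>n<N. f (m + n))"
      by (simp add: per left_diff_distrib sum_distrib_left sum_subtractf)
    then have "norm (w - 1) * norm (\<Sum>n<N. f (m + n)) \<le> 2 * real D"
      using sum_shift_diff_le[of f m D N, OF nf] by (simp only: norm_mult[symmetric])
    then show ?thesis using w by (simp add: field_simps)
  qed
  show ?thesis
    unfolding uniform_mean_zero_def f_def[symmetric]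
  proof (intro allI impI)
    fix \<epsilon> :: real assume \<epsilon>: "\<epsilon> > 0"
    define N0 where "N0 = nat \<lceil>2 * real D / norm (w - 1) / \<epsilon>\<rceil>"
    have "norm (\<Sum>n<N. f (m + n)) \<le> \<epsilon> * real N" if "N \<ge> N0" for N m
    proof -
      have "2 * real D / norm (w - 1) / \<epsilon> \<le> real N" using that unfolding N0_def by linarith
      then have "2 * real D / norm (w - 1) \<le> \<epsilon> * real N"
        using \<epsilon> by (simp only: pos_divide_le_eq mult.commute)
      then show ?thesis using bound[of m N] by linarith
    qed
    then show "\<exists>N0. \<forall>N\<ge>N0. \<forall>m. norm (\<Sum>n<N. f (m + n)) \<le> \<epsilon> * real N" by blast
  qed
qed

text \<open>The i-th coefficient of p(x + h) - p(x) is (i + 1) h \<open>coeff p (Suc i)\<close> plus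
  a rational number built from the higher coefficients: differencing lowers the last irrational
  index by one.\<close>

lemma coeff_pcompose_shift_diff:
  fixes p :: "real poly"
  assumes "coeff p (Suc i) \<notin> \<rat>" "i > 0" "\<And>j. j > Suc i \<Longrightarrow> coeff p j \<in> \<rat>" "h > (0::nat)"
  defines "q \<equiv> pcompose p [:real h, 1:] - p"
  shows "coeff q i \<notin> \<rat>" "\<And>j. j > i \<Longrightarrow> coeff q j \<in> \<rat>"
proof -
  have q: "coeff q j = (\<Sum>k\<in>{Suc j..degree p}. coeff p k * real (k choose j) * real h ^ (k - j))" for j
  proof -
    have "coeff (pcompose p [:real h, 1:]) j = (\<Sum>k\<le>degree p. coeff p k * coeff ([:real h, 1:] ^ k) j)"
      by (simp add: pcompose_altdef poly_altdef coeff_sum degree_map_poly coeff_map_poly)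
    also have "\<dots> = (\<Sum>k\<le>degree p. coeff p k * (real (k choose j) * real h ^ (k - j)))"
    proof (intro sum.cong refl)
      fix k
      have "coeff ([:real h, 1:] ^ k) j = real (k choose j) * real h ^ (k - j)"
        by (cases "j \<le> k") (auto simp: coeff_linear_poly_power coeff_eq_0 degree_linear_power)
      then show "coeff p k * coeff ([:real h, 1:] ^ k) j = coeff p k * (real (k choose j) * real h ^ (k - j))"
        by simp
    qed
    also have "\<dots> = (\<Sum>k\<in>{j..max j (degree p)}. coeff p k * (real (k choose j) * real h ^ (k - j)))"
      by (rule sum.mono_neutral_cong) (auto simp: coeff_eq_0)
    also have "{j..max j (degree p)} = insert j {Suc j..degree p}" by auto
    finally show ?thesis by (simp add: q_def mult.assoc)
  qed
  show "coeff q j \<in> \<rat>" if "j > i" for j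
    unfolding q using that assms(3) by (intro Rats_sum Rats_mult Rats_power) auto
  have deg: "Suc i \<le> degree p" using assms(1) by (intro le_degree) auto
  have s: "coeff q i = coeff p (Suc i) * (real (Suc i) * real h)
      + (\<Sum>k\<in>{Suc (Suc i)..degree p}. coeff p k * real (k choose i) * real h ^ (k - i))"
    unfolding q using deg by (subst sum.atLeast_Suc_atMost) auto
  have rest: "(\<Sum>k\<in>{Suc (Suc i)..degree p}. coeff p k * real (k choose i) * real h ^ (k - i)) \<in> \<rat>"
    using assms(3) by (intro Rats_sum Rats_mult Rats_power) auto
  show "coeff q i \<notin> \<rat>"
  proof
    assume "coeff q i \<in> \<rat>"
    from Rats_diff[OF this rest] have "coeff p (Suc i) * (real (Suc i) * real h) \<in> \<rat>"
      unfolding s by (simp only: add_diff_cancel_right')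
    then have "coeff p (Suc i) * (real (Suc i) * real h) / (real (Suc i) * real h) \<in> \<rat>"
      by (intro Rats_divide) auto
    then show False using assms(1,4) by simp
  qed
qed

text \<open>Induction on the largest index with an irrational coefficient rather than on the degree:
  rational coefficients above it never have to be removed, since
  \<open>uniform_mean_zero_almost_linear\<close> admits them at the end.\<close>

lemma uniform_mean_zero_poly_aux:
  fixes p :: "real poly"
  assumes "coeff p i \<notin> \<rat>" "i > 0" "\<And>j. j > i \<Longrightarrow> coeff p j \<in> \<rat>"
  shows "uniform_mean_zero (\<lambda>n. circle_exp (poly p (real n)))"
  using assms
proof (induction i arbitrary: p)
  case (Suc i)
  show ?case
  proof (cases "i = 0")
    case True
    then show ?thesis using Suc.prems by (intro uniform_mean_zero_almost_linear) auto
  next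
    case False
    show ?thesis
    proof (rule van_der_Corput)
      fix h :: nat assume h: "h > 0"
      let ?q = "pcompose p [:real h, 1:] - p"
      have "uniform_mean_zero (\<lambda>n. circle_exp (poly ?q (real n)))"
        using coeff_pcompose_shift_diff[of p i h] Suc.prems False h by (intro Suc.IH) auto
      then show "uniform_mean_zero (\<lambda>n. circle_exp (poly p (real (n + h))) * cnj (circle_exp (poly p (real n))))"
        by (simp add: poly_pcompose circle_exp_diff add.commute)
    qed simp
  qed
qed simp

lemma uniform_mean_zero_poly:
  fixes p :: "real poly"
  assumes "\<exists>i\<in>{1..degree p}. coeff p i \<notin> \<rat>"
  shows "uniform_mean_zero (\<lambda>n. circle_exp (poly p (real n)))"
proof -
  define I where "I = {i\<in>{1..degree p}. coeff p i \<notin> \<rat>}"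
  have fin: "finite I" by (simp add: I_def)
  define m where "m = Max I"
  have "m \<in> I" using assms unfolding m_def by (intro Max_in[OF fin]) (auto simp: I_def)
  then have m: "m > 0" "coeff p m \<notin> \<rat>" by (auto simp: I_def)
  have "coeff p j \<in> \<rat>" if "j > m" for j
  proof (rule ccontr)
    assume *: "coeff p j \<notin> \<rat>"
    then have "coeff p j \<noteq> 0" by auto
    then have "j \<le> degree p" by (rule le_degree)
    then have "j \<in> I" using * that m by (simp add: I_def)
    then have "j \<le> m" unfolding m_def by (rule Max_ge[OF fin])
    then show False using that by simp
  qed
  with m show ?thesis by (intro uniform_mean_zero_poly_aux)
qed

section \<open>Means of functions of the number of prime factors\<close>

text \<open>The powers p^k with k >= 2 contribute at most 2 ln p / p^2 for each p, and ln p <= 2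
  sqrt p dominates this by the convergent series of 4 p^(-3/2).\<close>

lemma sum_nonprime_mangoldt_le:
  obtains C where "0 < C" "\<And>x. (\<Sum>d\<in>{d\<in>nats_le x. \<not> prime d}. mangoldt d / real d) \<le> C"
proof -
  have summ: "summable (\<lambda>n. 4 * real n powr (-(3/2)))"
    by (intro summable_mult) (simp add: summable_real_powr_iff)
  define C where "C = (\<Sum>n. 4 * real n powr (-(3/2))) + 1"
  have C: "C > 0" unfolding C_def using suminf_nonneg[OF summ] by simp
  have "(\<Sum>d\<in>{d\<in>nats_le x. \<not> prime d}. mangoldt d / real d) \<le> C" for x
  proof -
    define N where "N = nat \<lfloor>x\<rfloor>"
    define P where "P = {p\<in>{1..N}. prime p}"
    let ?f = "\<lambda>(p, k). p ^ k :: nat"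
    let ?g = "\<lambda>d. mangoldt d / real d :: real"
    have g0: "0 \<le> ?g d" for d using mangoldt_nonneg[of d] by simp
    have "(\<Sum>d\<in>{d\<in>nats_le x. \<not> prime d}. ?g d) = (\<Sum>d\<in>{d\<in>nats_le x. \<not> prime d \<and> primepow d}. ?g d)"
      by (rule sum.mono_neutral_right) (auto simp: mangoldt_def)
    also have "\<dots> \<le> (\<Sum>d\<in>?f ` (P \<times> {2..N}). ?g d)"
    proof (rule sum_mono2)
      show "{d\<in>nats_le x. \<not> prime d \<and> primepow d} \<subseteq> ?f ` (P \<times> {2..N})"
      proof
        fix d assume "d \<in> {d\<in>nats_le x. \<not> prime d \<and> primepow d}"
        then have d: "d \<le> N" "\<not> prime d" "primepow d" by (auto simp: nats_le_conv N_def)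
        then obtain p k where pk: "prime p" "k > 0" "d = p ^ k" by (auto simp: primepow_def)
        have "k \<noteq> 1" using d pk by auto
        then have k2: "k \<ge> 2" using pk by simp
        have p2: "p \<ge> 2" using pk prime_ge_2_nat by blast
        have "k < 2 ^ k" by (rule less_exp)
        also have "\<dots> \<le> p ^ k" using p2 by (intro power_mono) auto
        finally have "k \<le> N" using d pk by simp
        moreover have "p \<le> N"
          using d pk p2 self_le_power[of p k] by simp
        ultimately show "d \<in> ?f ` (P \<times> {2..N})"
          using pk k2 p2 by (intro image_eqI[of _ _ "(p, k)"]) (auto simp: P_def)
      qed
    qed (use g0 in \<open>auto simp: P_def\<close>)
    also have "\<dots> \<le> (\<Sum>pk\<in>P \<times> {2..N}. ?g (?f pk))"
      using sum_image_le[of "P \<times> {2..N}" ?g ?f] g0 by (simp add: P_def o_def)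
    also have "\<dots> = (\<Sum>p\<in>P. \<Sum>k=2..N. ?g (p ^ k))"
      by (simp add: sum.cartesian_product case_prod_unfold)
    also have "\<dots> \<le> (\<Sum>p\<in>P. 4 * real p powr (-(3/2)))"
    proof (rule sum_mono)
      fix p assume "p \<in> P"
      then have p: "prime p" "p \<ge> 2" using prime_ge_2_nat by (auto simp: P_def)
      define r where "r = 1 / real p"
      have r: "0 < r" "r \<le> 1/2" using p by (auto simp: r_def field_simps)
      have "(\<Sum>k=2..N. ?g (p ^ k)) = ln (real p) * (\<Sum>k=2..N. r ^ k)"
        unfolding sum_distrib_left using p by (intro sum.cong refl) (auto simp: r_def power_one_over)
      also have "(\<Sum>k=2..N. r ^ k) \<le> 2 * r ^ 2"
      proof -
        \<comment> \<open>The extra last term makes the geometric bound inductive, as 2 r <= 1. For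
          N = 0 the sum is empty and the strengthened bound can fail, hence the second
          disjunct.\<close>
        have "(\<Sum>k=2..Suc N. r ^ k) + r ^ Suc N \<le> 2 * r ^ 2 \<or> N = 0" for N
        proof (induction N)
          case (Suc N)
          show ?case
          proof (cases "N = 0")
            case True
            then show ?thesis by (simp add: numeral_2_eq_2)
          next
            case False
            have "2 * r ^ Suc (Suc N) \<le> r ^ Suc N"
              using r by (simp add: mult_left_le_one_le)
            then show ?thesis using Suc False by simp
          qed
        qed simp
        from this[of "N - 1"] show ?thesis using r
          by (cases "N \<le> 1") (auto intro: order_trans[rotated] simp: Suc_diff_le)
      qed
      finally have "(\<Sum>k=2..N. ?g (p ^ k)) \<le> ln (real p) * (2 * r ^ 2)"
        using p by (simp add: mult_left_mono)
      also have "\<dots> \<le> (2 * sqrt (real p)) * (2 * r ^ 2)"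
        using p by (intro mult_right_mono ln_le_two_sqrt) auto
      also have "\<dots> = 4 * real p powr (-(3/2))"
      proof -
        have "real p powr (-(3/2)) = real p powr (1/2) * real p powr (-2)" by (simp add: powr_add[symmetric])
        also have "\<dots> = sqrt (real p) * r ^ 2"
          using p by (simp add: powr_half_sqrt powr_minus powr_numeral r_def power_one_over inverse_eq_divide)
        finally show ?thesis by simp
      qed
      finally show "(\<Sum>k=2..N. ?g (p ^ k)) \<le> 4 * real p powr (-(3/2))" .
    qed
    also have "\<dots> \<le> (\<Sum>n. 4 * real n powr (-(3/2)))"
      by (rule sum_le_suminf[OF summ]) (auto simp: P_def)
    finally show ?thesis by (simp add: C_def)
  qed
  with C show ?thesis using that by blast
qed

lemma big_Omega_mult: "0 < m \<Longrightarrow> 0 < n \<Longrightarrow> big_Omega (m * n) = big_Omega m + big_Omega n"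
  by (simp add: big_Omega_def prime_factorization_mult)

lemma big_Omega_prime: "prime p \<Longrightarrow> big_Omega p = 1"
  by (simp add: big_Omega_def prime_factorization_prime)

lemma sum_inverse_diff_le:
  assumes "1 \<le> y" "y \<le> x"
  shows "(\<Sum>n\<in>nats_le x - nats_le y. 1 / real n) \<le> ln x - ln y + 4"
proof -
  have "(\<Sum>n\<in>nats_le x - nats_le y. 1 / real n) = (\<Sum>n\<in>nats_le x. 1 / real n) - (\<Sum>n\<in>nats_le y. 1 / real n)"
    using assms by (intro sum_diff nats_le_mono) auto
  moreover have "2 / x \<le> 2" "2 / y \<le> 2" using assms by (auto simp: field_simps)
  ultimately show ?thesis using sum_inverse_bound[of x] sum_inverse_bound[of y] assms by linarith
qed

text \<open>Write \<open>ln n\<close> as the sum of \<open>mangoldt d\<close> over the divisors \<open>d\<close> of \<open>n\<close>, where only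
  primes \<open>d\<close> matter; then the prime number theorem replaces \<open>psi (N / m)\<close> by \<open>N / m\<close>.\<close>

lemma natural_mean_big_Omega:
  assumes \<epsilon>: "\<epsilon> > 0"
  shows "\<exists>K. \<forall>(a :: nat \<Rightarrow> complex) N. (\<forall>k. norm (a k) \<le> 1) \<longrightarrow> 0 < N \<longrightarrow>
    norm (of_real (ln (real N)) * (\<Sum>n=1..N. a (big_Omega n))
      - of_nat N * (\<Sum>m=1..N. a (big_Omega m + 1) / of_nat m)) \<le> real N * (\<epsilon> * ln (real N) + K)"
proof -
  obtain C where C: "0 < C" "\<And>x. (\<Sum>d\<in>{d\<in>nats_le x. \<not> prime d}. mangoldt d / real d) \<le> C"
    by (rule sum_nonprime_mangoldt_le) blast
  obtain Y0 where Y0: "\<And>y. y \<ge> Y0 \<Longrightarrow> \<bar>psi y - y\<bar> \<le> \<epsilon> * y"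
    using prime_number_theorem_psi[OF \<epsilon>] by blast
  define Y where "Y = max 1 Y0"
  have Y: "1 \<le> Y" by (simp add: Y_def)
  have "norm (of_real (ln (real N)) * (\<Sum>n=1..N. a (big_Omega n))
      - of_nat N * (\<Sum>m=1..N. a (big_Omega m + 1) / of_nat m))
      \<le> real N * (\<epsilon> * ln (real N) + (1 + 2 * C + 4 * \<epsilon> + 10 * (ln Y + 4)))"
    if a: "\<forall>k. norm (a k) \<le> 1" and N: "0 < N" for a :: "nat \<Rightarrow> complex" and N
  proof -
    define x where "x = real N"
    have x: "1 \<le> x" using N by (simp add: x_def)
    have U: "{1..N} = nats_le x" by (simp add: x_def)
    define \<Lambda> :: "nat \<Rightarrow> complex" where "\<Lambda> d = of_real (mangoldt d)" for d
    have nL: "norm (\<Lambda> d) = mangoldt d" for d unfolding \<Lambda>_def norm_of_real by simp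
    \<comment> \<open>The chain A, B, D, E: the weight ln x becomes ln n; in its expansion by
      \<open>mangoldt d\<close> every d is treated as if Omega(d) = 1, which is right for primes and
      costs O(x) for higher powers; finally psi(x/m) becomes x/m.\<close>
    define A where "A = (\<Sum>n\<in>nats_le x. of_real (ln x) * a (big_Omega n))"
    define B where "B = (\<Sum>n\<in>nats_le x. of_real (ln (real n)) * a (big_Omega n))"
    define D where "D = (\<Sum>m\<in>nats_le x. of_real (psi (x / real m)) * a (big_Omega m + 1))"
    define E where "E = (\<Sum>m\<in>nats_le x. of_real (x / real m) * a (big_Omega m + 1))"
    have "norm (A - B) \<le> (\<Sum>n\<in>nats_le x. (ln x - ln (real n)) * 1)"
      unfolding A_def B_def sum_subtractf[symmetric]
    proof (rule sum_norm_le)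
      fix n assume n: "n \<in> nats_le x"
      then have "0 \<le> ln x - ln (real n)" using x nats_leD(1,2)[OF n] by simp
      then show "norm (of_real (ln x) * a (big_Omega n) - of_real (ln (real n)) * a (big_Omega n)) \<le> (ln x - ln (real n)) * 1"
        using a by (simp only: left_diff_distrib[symmetric] of_real_diff[symmetric] norm_mult norm_of_real abs_of_nonneg)
          (intro mult_left_mono, auto)
    qed
    also have "\<dots> = x * ln x - log_fact x"
      by (simp add: sum_subtractf log_fact_def) (simp add: x_def)
    also have "\<dots> \<le> x"
      using log_fact_bounds_nat(1)[of "N - 1"] N unfolding log_fact_def U[symmetric] x_def by simp
    finally have AB: "norm (A - B) \<le> x" .
    have "B = (\<Sum>n\<in>nats_le x. \<Sum>d | d dvd n. \<Lambda> d * a (big_Omega d + big_Omega (n div d)))"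
      unfolding B_def
    proof (intro sum.cong refl)
      fix n assume n: "n \<in> nats_le x"
      then have n0: "n \<noteq> 0" by (auto dest: nats_leD)
      have "of_real (ln (real n)) * a (big_Omega n) = (\<Sum>d | d dvd n. \<Lambda> d) * a (big_Omega n)"
        using mangoldt_sum[OF n0, where ?'a = real] unfolding \<Lambda>_def of_real_sum[symmetric] by simp
      also have "\<dots> = (\<Sum>d | d dvd n. \<Lambda> d * a (big_Omega d + big_Omega (n div d)))"
        unfolding sum_distrib_right
      proof (intro sum.cong refl)
        fix d assume "d \<in> {d. d dvd n}"
        then obtain e where "n = d * e" by auto
        then show "\<Lambda> d * a (big_Omega n) = \<Lambda> d * a (big_Omega d + big_Omega (n div d))"
          using n0 by (simp add: big_Omega_mult)
      qed
      finally show "of_real (ln (real n)) * a (big_Omega n) = (\<Sum>d | d dvd n. \<Lambda> d * a (big_Omega d + big_Omega (n div d)))" .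
    qed
    also have "\<dots> = (\<Sum>d\<in>nats_le x. \<Sum>m\<in>nats_le (x / real d). \<Lambda> d * a (big_Omega d + big_Omega m))"
      by (rule sum_divisors_nats_le)
    finally have Beq: "B = \<dots>" .
    have Deq: "D = (\<Sum>d\<in>nats_le x. \<Sum>m\<in>nats_le (x / real d). \<Lambda> d * a (big_Omega m + 1))"
      unfolding D_def psi_def \<Lambda>_def of_real_sum by (subst sum_swap_nats_le) (simp only: sum_distrib_right)
    have "norm (B - D) \<le> (\<Sum>d\<in>nats_le x. if prime d then 0 else 2 * x * (mangoldt d / real d))"
      unfolding Beq Deq sum_subtractf[symmetric]
    proof (rule sum_norm_le)
      fix d assume d: "d \<in> nats_le x"
      show "norm (\<Sum>m\<in>nats_le (x / real d). \<Lambda> d * a (big_Omega d + big_Omega m) - \<Lambda> d * a (big_Omega m + 1))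
        \<le> (if prime d then 0 else 2 * x * (mangoldt d / real d))"
      proof (cases "prime d")
        case False
        have "norm (\<Sum>m\<in>nats_le (x / real d). \<Lambda> d * a (big_Omega d + big_Omega m) - \<Lambda> d * a (big_Omega m + 1))
          \<le> (\<Sum>m\<in>nats_le (x / real d). mangoldt d * 2)"
        proof (rule sum_norm_le)
          fix m
          have "norm (a (big_Omega d + big_Omega m) - a (big_Omega m + 1)) \<le> 1 + 1"
            using a by (intro order_trans[OF norm_triangle_ineq4] add_mono) auto
          then show "norm (\<Lambda> d * a (big_Omega d + big_Omega m) - \<Lambda> d * a (big_Omega m + 1)) \<le> mangoldt d * 2"
            unfolding right_diff_distrib[symmetric] norm_mult nL using mangoldt_nonneg[of d]
            by (intro mult_left_mono) auto
        qed
        also have "\<dots> \<le> (x / real d) * (mangoldt d * 2)"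
          unfolding sum_constant using x mangoldt_nonneg[of d] by (intro mult_right_mono card_nats_le_le) auto
        finally show ?thesis using False by (simp add: mult_ac)
      qed (simp add: big_Omega_prime add.commute)
    qed
    also have "\<dots> = 2 * x * (\<Sum>d\<in>{d\<in>nats_le x. \<not> prime d}. mangoldt d / real d)"
      unfolding sum_distrib_left by (subst sum.inter_filter) (auto intro!: sum.cong)
    also have "\<dots> \<le> 2 * x * C" using x C by (intro mult_left_mono) auto
    finally have BD: "norm (B - D) \<le> 2 * x * C" .
    \<comment> \<open>Where x/m < Y only the Chebyshev bound 10 x/m is available; these m have
      harmonic mass at most ln Y + 4, independent of N.\<close>
    have "norm (D - E) \<le> (\<Sum>m\<in>nats_le x. x * (\<epsilon> * (1 / real m) + 10 * (if m \<in> nats_le x - nats_le (x / Y) then 1 / real m else 0)))"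
      unfolding D_def E_def sum_subtractf[symmetric]
    proof (rule sum_norm_le)
      fix m assume m: "m \<in> nats_le x"
      let ?y = "x / real m"
      have y: "1 \<le> ?y" using m by (rule nats_leD)
      have m0: "0 < m" using m by (rule nats_leD)
      have "norm (of_real (psi ?y) * a (big_Omega m + 1) - of_real ?y * a (big_Omega m + 1)) \<le> \<bar>psi ?y - ?y\<bar> * 1"
        unfolding left_diff_distrib[symmetric] of_real_diff[symmetric] norm_mult norm_of_real
        using a by (intro mult_left_mono) auto
      also have "\<dots> \<le> x * (\<epsilon> * (1 / real m) + 10 * (if m \<in> nats_le x - nats_le (x / Y) then 1 / real m else 0))"
      proof (cases "m \<in> nats_le (x / Y)")
        case True
        then have "Y \<le> ?y" using m0 Y by (auto simp: nats_le_def field_simps)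
        then show ?thesis using Y0[of ?y] True by (simp add: Y_def mult_ac)
      next
        case False
        have "\<bar>psi ?y - ?y\<bar> \<le> 10 * ?y" using abs_psi_err_le[of ?y] y by (simp add: psi_err_def)
        then show ?thesis using False m \<epsilon> x by (simp add: distrib_left mult_ac add_increasing)
      qed
      finally show "norm (of_real (psi ?y) * a (big_Omega m + 1) - of_real ?y * a (big_Omega m + 1)) \<le> \<dots>" .
    qed
    also have "\<dots> = x * (\<epsilon> * (\<Sum>m\<in>nats_le x. 1 / real m) + 10 * (\<Sum>m\<in>nats_le x - nats_le (x / Y). 1 / real m))"
    proof -
      have "nats_le x \<inter> (nats_le x - nats_le (x / Y)) = nats_le x - nats_le (x / Y)" by auto
      then have "(\<Sum>m\<in>nats_le x - nats_le (x / Y). 1 / real m) = (\<Sum>m\<in>nats_le x. if m \<in> nats_le x - nats_le (x / Y) then 1 / real m else 0)"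
        using sum.inter_restrict[of "nats_le x" "\<lambda>m. 1 / real m" "nats_le x - nats_le (x / Y)"] by simp
      then show ?thesis by (simp only: sum_distrib_left[symmetric] sum.distrib)
    qed
    also have "\<dots> \<le> x * (\<epsilon> * (ln x + 4) + 10 * (ln Y + 4))"
    proof (intro mult_left_mono add_mono)
      have "2 / x \<le> 2" using x by (simp add: field_simps)
      then show "(\<Sum>m\<in>nats_le x. 1 / real m) \<le> ln x + 4"
        using sum_inverse_bound[OF x] euler_mascheroni_le by linarith
      show "(\<Sum>m\<in>nats_le x - nats_le (x / Y). 1 / real m) \<le> ln Y + 4"
      proof (cases "x / Y \<ge> 1")
        case True
        have "x / Y \<le> x" using x Y by (simp add: field_simps)
        with sum_inverse_diff_le[OF True this] show ?thesis using x Y by (simp add: ln_div)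
      next
        case False
        then have "ln x \<le> ln Y" using x Y by (simp add: field_simps)
        moreover have "2 / x \<le> 2" using x by (simp add: field_simps)
        ultimately show ?thesis
          using sum_inverse_bound[OF x] euler_mascheroni_le False by simp
      qed
    qed (use x \<epsilon> in auto)
    finally have DE: "norm (D - E) \<le> x * (\<epsilon> * (ln x + 4) + 10 * (ln Y + 4))" .
    have "norm (A - E) \<le> norm (A - B) + (norm (B - D) + norm (D - E))"
      using norm_triangle_ineq[of "A - B" "B - E"] norm_triangle_ineq[of "B - D" "D - E"] by simp
    also have "\<dots> \<le> x + (2 * x * C + x * (\<epsilon> * (ln x + 4) + 10 * (ln Y + 4)))"
      by (intro add_mono AB BD DE)
    also have "\<dots> = x * (\<epsilon> * ln x + (1 + 2 * C + 4 * \<epsilon> + 10 * (ln Y + 4)))" by (simp add: algebra_simps)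
    finally have "norm (A - E) \<le> \<dots>" .
    moreover have "A = of_real (ln (real N)) * (\<Sum>n=1..N. a (big_Omega n))"
      unfolding A_def U by (simp add: sum_distrib_left x_def)
    moreover have "E = of_nat N * (\<Sum>m=1..N. a (big_Omega m + 1) / of_nat m)"
      unfolding E_def U by (simp add: sum_distrib_left x_def)
    ultimately show ?thesis unfolding x_def by simp
  qed
  then show ?thesis by blast
qed

text \<open>Division by zero makes the value at 0 equal to 0, so
  \<open>Omega_mean a (N div p)\<close> stays bounded also for N < p.\<close>

definition Omega_mean :: "(nat \<Rightarrow> complex) \<Rightarrow> nat \<Rightarrow> complex" where
  "Omega_mean a N = (\<Sum>n=1..N. a (big_Omega n)) / of_nat N"

lemma Omega_mean_log_mean:
  assumes a: "\<And>k. norm (a k) \<le> 1"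
  shows "(\<lambda>N. Omega_mean a N - (\<Sum>m=1..N. a (big_Omega m + 1) / of_nat m) / of_real (ln (real N)))
    \<longlonglongrightarrow> 0"
proof (rule tendstoI)
  fix e :: real assume e: "e > 0"
  let ?L = "\<lambda>N. \<Sum>m=1..N. a (big_Omega m + 1) / of_nat m"
  obtain K where "\<forall>(a :: nat \<Rightarrow> complex) N. (\<forall>k. norm (a k) \<le> 1) \<longrightarrow> 0 < N \<longrightarrow>
    norm (of_real (ln (real N)) * (\<Sum>n=1..N. a (big_Omega n))
      - of_nat N * (\<Sum>m=1..N. a (big_Omega m + 1) / of_nat m)) \<le> real N * (e / 2 * ln (real N) + K)"
    using natural_mean_big_Omega[OF half_gt_zero[OF e]] by (rule exE)
  note K = this[rule_format, OF a]
  have "((\<lambda>N. K / ln (real N)) \<longlongrightarrow> 0) sequentially" by real_asymp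
  then have "eventually (\<lambda>N. K / ln (real N) < e / 2) sequentially"
    using e by (intro order_tendstoD) auto
  moreover have "eventually (\<lambda>N::nat. N \<ge> 2) sequentially" by (rule eventually_ge_at_top)
  ultimately show "eventually (\<lambda>N. dist (Omega_mean a N - ?L N / of_real (ln (real N))) 0 < e) sequentially"
  proof eventually_elim
    case (elim N)
    have l: "ln (real N) > 0" and N: "real N > 0" using elim by auto
    have "Omega_mean a N - ?L N / of_real (ln (real N))
      = (of_real (ln (real N)) * (\<Sum>n=1..N. a (big_Omega n)) - of_nat N * ?L N) / of_real (real N * ln (real N))"
      using l N by (simp add: Omega_mean_def field_simps)
    then have "norm (Omega_mean a N - ?L N / of_real (ln (real N)))
      = norm (of_real (ln (real N)) * (\<Sum>n=1..N. a (big_Omega n)) - of_nat N * ?L N) / (real N * ln (real N))"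
      using l N by (simp only: norm_divide norm_of_real) simp
    also have "\<dots> \<le> (real N * (e / 2 * ln (real N) + K)) / (real N * ln (real N))"
      using K[of N] elim l N by (intro divide_right_mono) auto
    also have "\<dots> = e / 2 + K / ln (real N)" using l N by (simp add: field_simps)
    also have "\<dots> < e" using elim(1) by linarith
    finally show ?case by (simp add: dist_norm)
  qed
qed

lemma harm_le_ln_plus: "harm n \<le> ln (real n) + 1" if "n > 0"
  using euler_mascheroni_sequence_decreasing[of 1 n] that by (simp add: harm_expand)

text \<open>Passing from N to N div p removes terms of total harmonic mass O(ln(2p) + 1) and changes
  the normalisation by a relative amount of order ln(2p) / ln N.\<close>

lemma log_mean_slowly_varying:
  assumes a: "\<And>k. norm (a k) \<le> (1::real)" and p: "p > 0"
  defines "L \<equiv> \<lambda>N. (\<Sum>m=1..N. a (big_Omega m + 1) / of_nat m) / of_real (ln (real N)) :: complex"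
  shows "(\<lambda>N. L (N div p) - L N) \<longlonglongrightarrow> 0"
proof (rule Lim_null_comparison)
  let ?S = "\<lambda>N. \<Sum>m=1..N. a (big_Omega m + 1) / of_nat m"
  let ?c = "ln (2 * real p)"
  show "((\<lambda>N. (3 * ?c + 4) / ln (real N)) \<longlongrightarrow> 0) sequentially" by real_asymp
  have "eventually (\<lambda>N. N \<ge> 3 * p) sequentially" by (rule eventually_ge_at_top)
  then show "eventually (\<lambda>N. norm (L (N div p) - L N) \<le> (3 * ?c + 4) / ln (real N)) sequentially"
  proof eventually_elim
    case (elim N)
    define M where "M = N div p"
    \<comment> \<open>The value 3 gives ln M >= 1, as exp 1 <= 3, so that ln M + 1 <= 2 ln M
      below.\<close>
    have M3: "M \<ge> 3" unfolding M_def using elim p by (simp add: less_eq_div_iff_mult_less_eq)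
    have MN: "M \<le> N" unfolding M_def by simp
    have "N < p * (M + 1)" unfolding M_def using p
      by (metis Suc_eq_plus1 dividend_less_times_div mult.commute mult_Suc_right add.commute)
    also have "\<dots> \<le> p * (2 * M)" using M3 by (intro mult_left_mono) auto
    finally have "real N \<le> real (p * (2 * M))" by linarith
    then have "ln (real N) \<le> ln (2 * real p * real M)" using M3 MN p by (subst ln_le_cancel_iff) auto
    also have "\<dots> = ?c + ln (real M)" using p M3 by (simp add: ln_mult)
    finally have d: "ln (real N) - ln (real M) \<le> ?c" by simp
    have lM: "1 \<le> ln (real M)"
    proof -
      have "exp 1 \<le> (3::real)" by (rule exp_le)
      then show ?thesis using M3 by (subst ln_ge_iff) auto
    qed
    have lMN: "ln (real M) \<le> ln (real N)" using MN M3 by simp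
    have nS: "norm (?S M) \<le> ln (real M) + 1"
    proof -
      have "norm (?S M) \<le> (\<Sum>m=1..M. inverse (real m))"
        by (rule sum_norm_le) (simp only: norm_divide norm_of_nat inverse_eq_divide, intro divide_right_mono a, simp)
      also have "\<dots> = harm M" by (simp add: harm_def)
      finally show ?thesis using harm_le_ln_plus[of M] M3 by linarith
    qed
    have nD: "norm (?S M - ?S N) \<le> ?c + 4"
    proof -
      have "{1..N} = {1..M} \<union> {M<..N}" using MN by auto
      then have "?S N = ?S M + (\<Sum>m\<in>{M<..N}. a (big_Omega m + 1) / of_nat m)"
        by (simp only:) (rule sum.union_disjoint, auto)
      then have "norm (?S M - ?S N) = norm (\<Sum>m\<in>{M<..N}. a (big_Omega m + 1) / of_nat m)"
        by (simp add: norm_minus_commute)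
      also have "\<dots> \<le> (\<Sum>m\<in>{M<..N}. 1 / real m)"
        by (rule sum_norm_le) (simp only: norm_divide norm_of_nat, intro divide_right_mono a, simp)
      also have "{M<..N} = nats_le (real N) - nats_le (real M)" by auto
      also have "(\<Sum>m\<in>\<dots>. 1 / real m) \<le> ln (real N) - ln (real M) + 4"
        by (rule sum_inverse_diff_le) (use M3 MN in auto)
      finally show ?thesis using d by linarith
    qed
    have "L M - L N = (?S M - ?S N) / of_real (ln (real N)) + ?S M * of_real (1 / ln (real M) - 1 / ln (real N))"
      unfolding L_def using lM lMN by (simp add: field_simps)
    also have "norm \<dots> \<le> (?c + 4) / ln (real N) + (ln (real M) + 1) * (1 / ln (real M) - 1 / ln (real N))"
    proof (intro order_trans[OF norm_triangle_ineq] add_mono)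
      show "norm ((?S M - ?S N) / of_real (ln (real N))) \<le> (?c + 4) / ln (real N)"
        unfolding norm_divide norm_of_real using nD lM lMN by (simp add: divide_right_mono)
      have "0 \<le> 1 / ln (real M) - 1 / ln (real N)" using lM lMN by (simp add: field_simps)
      then show "norm (?S M * of_real (1 / ln (real M) - 1 / ln (real N))) \<le> (ln (real M) + 1) * (1 / ln (real M) - 1 / ln (real N))"
        unfolding norm_mult norm_of_real using nS by (simp only: abs_of_nonneg mult_right_mono)
    qed
    also have "(ln (real M) + 1) * (1 / ln (real M) - 1 / ln (real N)) \<le> (2 * ?c) / ln (real N)"
    proof -
      have "(ln (real M) + 1) * (1 / ln (real M) - 1 / ln (real N)) \<le> (2 * ln (real M)) * (1 / ln (real M) - 1 / ln (real N))"
        using lM lMN by (intro mult_right_mono) (auto simp: field_simps)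
      also have "\<dots> = 2 * (ln (real N) - ln (real M)) / ln (real N)" using lM lMN by (simp add: field_simps)
      also have "\<dots> \<le> (2 * ?c) / ln (real N)" using d lM lMN by (intro divide_right_mono) auto
      finally show ?thesis .
    qed
    finally show ?case unfolding M_def by (simp add: add_divide_distrib)
  qed
qed

lemma Omega_mean_slowly_varying:
  assumes a: "\<And>k. norm (a k) \<le> 1" and p: "p > 0"
  shows "(\<lambda>N. Omega_mean a (N div p) - Omega_mean a N) \<longlonglongrightarrow> 0"
proof -
  let ?L = "\<lambda>N. (\<Sum>m=1..N. a (big_Omega m + 1) / of_nat m) / of_real (ln (real N))"
  have 1: "(\<lambda>N. Omega_mean a N - ?L N) \<longlonglongrightarrow> 0" using a by (rule Omega_mean_log_mean)
  have "filterlim (\<lambda>N. N div p) at_top sequentially"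
    unfolding filterlim_at_top
  proof
    fix Z :: nat
    show "eventually (\<lambda>N. Z \<le> N div p) sequentially"
      using eventually_ge_at_top[of "Z * p"]
      by eventually_elim (use p in \<open>simp add: less_eq_div_iff_mult_less_eq\<close>)
  qed
  from filterlim_compose[OF 1 this]
  have 2: "(\<lambda>N. Omega_mean a (N div p) - ?L (N div p)) \<longlonglongrightarrow> 0" .
  have 3: "(\<lambda>N. ?L (N div p) - ?L N) \<longlonglongrightarrow> 0" using a p by (rule log_mean_slowly_varying)
  have "(\<lambda>N. (Omega_mean a (N div p) - ?L (N div p)) + (?L (N div p) - ?L N) - (Omega_mean a N - ?L N)) \<longlonglongrightarrow> 0 + 0 - 0"
    by (intro tendsto_add tendsto_diff 1 2 3)
  then show ?thesis by simp
qed

text \<open>If the sum of 1/p converged, its tail beyond some M would be below 1/2, and the sum of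
  ln p / p up to N would be at most ln N / 2 + O(1), contrary to Mertens' theorem.\<close>

lemma sum_inverse_primes_unbounded:
  "\<exists>P. finite P \<and> (\<forall>p\<in>P. prime (p::nat)) \<and> B \<le> (\<Sum>p\<in>P. 1 / real p)"
proof (rule ccontr)
  assume no: "\<not> ?thesis"
  have B: "(\<Sum>p\<in>P. 1 / real p) \<le> B" if "finite P" "\<And>p. p \<in> P \<Longrightarrow> prime p" for P :: "nat set"
  proof (rule ccontr)
    assume "\<not> ?thesis"
    then have "B \<le> (\<Sum>p\<in>P. 1 / real p)" by simp
    then show False using no that by blast
  qed
  define f :: "nat \<Rightarrow> real" where "f n = (if prime n then 1 / real n else 0)" for n
  have f0: "0 \<le> f n" for n by (simp add: f_def)
  have lf0: "0 \<le> ln (real d) * f d" for d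
    by (cases "prime d") (use prime_gt_0_nat[of d] in \<open>auto simp: f_def\<close>)
  have "summable f"
  proof (rule summableI_nonneg_bounded[OF f0])
    fix n
    have "sum f {..<n} = (\<Sum>p\<in>{p\<in>{..<n}. prime p}. 1 / real p)"
      unfolding f_def by (subst sum.inter_filter) auto
    also have "\<dots> \<le> B" by (rule B) auto
    finally show "sum f {..<n} \<le> B" .
  qed
  then obtain M where M: "\<And>m n. m \<ge> M \<Longrightarrow> norm (sum f {m..<n}) < 1/2"
    unfolding summable_Cauchy by (metis half_gt_zero zero_less_one)
  obtain C where C: "\<And>x. (\<Sum>d\<in>{d\<in>nats_le x. \<not> prime d}. mangoldt d / real d) \<le> C"
    by (rule sum_nonprime_mangoldt_le) blast
  define K where "K = (\<Sum>d<M. ln (real d) * f d)"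
  have "ln (real N) \<le> 12 + C + K + ln (real N) / 2" if N: "N \<ge> max 1 M" for N
  proof -
    have "ln (real N) - 12 \<le> (\<Sum>d\<in>nats_le (real N). mangoldt d / real d)"
      using mertens_first[of "real N"] N unfolding abs_le_iff by auto
    also have "\<dots> = (\<Sum>d\<in>{d\<in>nats_le (real N). \<not> prime d}. mangoldt d / real d)
        + (\<Sum>d\<in>{d\<in>nats_le (real N). prime d}. mangoldt d / real d)"
      by (subst sum.union_disjoint[symmetric]) (auto intro!: sum.cong)
    also have "(\<Sum>d\<in>{d\<in>nats_le (real N). prime d}. mangoldt d / real d) = (\<Sum>d\<in>{1..N}. ln (real d) * f d)"
      unfolding nats_le_of_nat by (subst sum.inter_filter) (auto intro!: sum.cong simp: f_def)
    also have "\<dots> \<le> (\<Sum>d<Suc N. ln (real d) * f d)"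
      by (intro sum_mono2 lf0) auto
    also have "\<dots> = K + (\<Sum>d=M..<Suc N. ln (real d) * f d)"
      unfolding K_def using N sum.atLeastLessThan_concat[of 0 M "Suc N" "\<lambda>d. ln (real d) * f d"]
      by (simp add: atLeast0LessThan)
    also have "(\<Sum>d=M..<Suc N. ln (real d) * f d) \<le> (\<Sum>d=M..<Suc N. ln (real N) * f d)"
    proof (rule sum_mono)
      fix d assume d: "d \<in> {M..<Suc N}"
      show "ln (real d) * f d \<le> ln (real N) * f d"
      proof (cases "prime d")
        case True
        then have "0 < d" by (rule prime_gt_0_nat)
        then show ?thesis using d f0[of d] N by (intro mult_right_mono) auto
      qed (simp add: f_def)
    qed
    also have "\<dots> = ln (real N) * sum f {M..<Suc N}" by (rule sum_distrib_left[symmetric])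
    also have "\<dots> \<le> ln (real N) * (1/2)"
    proof (rule mult_left_mono)
      show "sum f {M..<Suc N} \<le> 1/2" using M[of M "Suc N"] unfolding real_norm_def by linarith
    qed (use N in auto)
    finally show ?thesis using C[of "real N"] by linarith
  qed
  then have *: "ln (real N) \<le> 2 * (12 + C + K)" if "N \<ge> max 1 M" for N
    using that by fastforce
  have "filterlim (\<lambda>N. ln (real N)) at_top sequentially" by real_asymp
  then have "eventually (\<lambda>N. ln (real N) > 2 * (12 + C + K)) sequentially"
    by (simp add: filterlim_at_top_dense)
  then have "eventually (\<lambda>N::nat. False) sequentially"
    using eventually_ge_at_top[of "max 1 M"] by eventually_elim (use * in force)
  then show False by simp
qed

section \<open>Averaging over primes\<close>

lemma card_multiples: "d > 0 \<Longrightarrow> card {n\<in>{1..N}. d dvd n} = N div (d::nat)"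
proof -
  assume d: "d > 0"
  have "{n\<in>{1..N}. d dvd n} = (\<lambda>m. d * m) ` {1..N div d}"
  proof (intro set_eqI iffI)
    fix n assume "n \<in> {n\<in>{1..N}. d dvd n}"
    then show "n \<in> (\<lambda>m. d * m) ` {1..N div d}"
      using d by (auto elim!: dvdE simp: less_eq_div_iff_mult_less_eq mult.commute)
  qed (use d in \<open>auto simp: less_eq_div_iff_mult_less_eq mult.commute\<close>)
  then show ?thesis using d by (simp add: card_image inj_on_def)
qed

lemma of_nat_div_bounds:
  assumes "d > 0"
  shows "real (N div d) \<le> real N / real d" "real N / real d - 1 \<le> real (N div d)"
proof -
  have "real (N div d) = of_int \<lfloor>real N / real d\<rfloor>"
    by (simp add: floor_divide_of_nat_eq)
  then show "real (N div d) \<le> real N / real d" "real N / real d - 1 \<le> real (N div d)" by linarith+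
qed

text \<open>The variance of the number of prime divisors in P. Distinct p and q both divide at most
  N/(p q) integers up to N, so the terms N L^2 cancel; the diagonal leaves N L, and rounding in the
  first moment leaves 2 L card P.\<close>

lemma turan_kubilius:
  assumes P: "finite P" "\<And>p. p \<in> P \<Longrightarrow> prime (p::nat)"
  defines "L \<equiv> \<Sum>p\<in>P. 1 / real p"
  shows "(\<Sum>n=1..N. (L - (\<Sum>p\<in>P. if p dvd n then 1 else 0))\<^sup>2) \<le> real N * L + 2 * L * real (card P)"
proof -
  let ?\<omega> = "\<lambda>n. \<Sum>p\<in>P. if p dvd n then 1 else 0 :: real"
  have pos: "p > 0" if "p \<in> P" for p using P(2)[OF that] prime_gt_0_nat by blast
  have L0: "0 \<le> L" unfolding L_def by (intro sum_nonneg) auto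
  have cnt: "(\<Sum>n=1..N. if d dvd n then 1 else 0) = real (N div d)" if "d > 0" for d
    using card_multiples[OF that, of N] by (simp add: sum.inter_filter[symmetric])
  have "real N * L - real (card P) = (\<Sum>p\<in>P. real N / real p - 1)"
    by (simp add: L_def sum_distrib_left sum_subtractf)
  also have "\<dots> \<le> (\<Sum>p\<in>P. real (N div p))" using pos by (intro sum_mono of_nat_div_bounds) auto
  also have "\<dots> = (\<Sum>p\<in>P. \<Sum>n=1..N. if p dvd n then 1 else 0)" using pos cnt by (intro sum.cong) auto
  also have "\<dots> = (\<Sum>n=1..N. ?\<omega> n)" by (rule sum.swap)
  finally have 1: "real N * L - real (card P) \<le> (\<Sum>n=1..N. ?\<omega> n)" .
  have "(\<Sum>n=1..N. (?\<omega> n)\<^sup>2) = (\<Sum>n=1..N. \<Sum>p\<in>P. \<Sum>q\<in>P. if p dvd n \<and> q dvd n then 1 else 0)"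
    unfolding power2_eq_square sum_product by (intro sum.cong refl) auto
  also have "\<dots> = (\<Sum>p\<in>P. \<Sum>q\<in>P. \<Sum>n=1..N. if p dvd n \<and> q dvd n then 1 else 0)"
    by (rule trans[OF sum.swap], rule sum.cong[OF refl], rule sum.swap)
  also have "\<dots> \<le> (\<Sum>p\<in>P. \<Sum>q\<in>P. real N * (1 / real p) * (1 / real q) + (if p = q then real N * (1 / real p) else 0))"
  proof (intro sum_mono)
    fix p q assume pq: "p \<in> P" "q \<in> P"
    show "(\<Sum>n=1..N. if p dvd n \<and> q dvd n then 1 else 0) \<le> real N * (1 / real p) * (1 / real q) + (if p = q then real N * (1 / real p) else 0)"
    proof (cases "p = q")
      case True
      then show ?thesis using cnt[OF pos[OF pq(1)]] of_nat_div_bounds(1)[OF pos[OF pq(1)], of N]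
        by (simp add: add_increasing)
    next
      case False
      have "coprime p q" using P(2) pq False by (simp add: primes_coprime)
      then have "p dvd n \<and> q dvd n \<longleftrightarrow> p * q dvd n" for n
        using divides_mult by (auto intro: dvd_mult_left dvd_mult_right)
      then show ?thesis using cnt[of "p * q"] of_nat_div_bounds(1)[of "p * q" N] pos pq False by simp
    qed
  qed
  also have "\<dots> = real N * L * L + real N * L"
  proof -
    have "(\<Sum>p\<in>P. \<Sum>q\<in>P. real N * (1 / real p) * (1 / real q)) = real N * L * L"
    proof -
      have "real N * L = (\<Sum>p\<in>P. real N * (1 / real p))" by (simp only: L_def sum_distrib_left)
      then show ?thesis unfolding L_def by (simp only: sum_product)
    qed
    moreover have "(\<Sum>p\<in>P. \<Sum>q\<in>P. if p = q then real N * (1 / real p) else 0) = (\<Sum>p\<in>P. real N * (1 / real p))"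
      using P(1) by (intro sum.cong refl) simp
    moreover have "(\<Sum>p\<in>P. real N * (1 / real p)) = real N * L"
      by (simp only: L_def sum_distrib_left)
    ultimately show ?thesis by (simp only: sum.distrib)
  qed
  finally have 2: "(\<Sum>n=1..N. (?\<omega> n)\<^sup>2) \<le> real N * L * L + real N * L" .
  have "(\<Sum>n=1..N. (L - ?\<omega> n)\<^sup>2) = real N * L * L - 2 * L * (\<Sum>n=1..N. ?\<omega> n) + (\<Sum>n=1..N. (?\<omega> n)\<^sup>2)"
  proof -
    have "(\<Sum>n=1..N. (L - w n)\<^sup>2) = real N * L * L - 2 * L * (\<Sum>n=1..N. w n) + (\<Sum>n=1..N. (w n)\<^sup>2)" for w
      by (simp add: power2_diff sum.distrib sum_subtractf sum_distrib_left mult.assoc power2_eq_square[of L])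
    then show ?thesis .
  qed
  also have "2 * L * (real N * L - real (card P)) \<le> 2 * L * (\<Sum>n=1..N. ?\<omega> n)"
    using L0 1 by (intro mult_left_mono) auto
  then have "real N * L * L - 2 * L * (\<Sum>n=1..N. ?\<omega> n) + (\<Sum>n=1..N. (?\<omega> n)\<^sup>2)
    \<le> real N * L * L - 2 * L * (real N * L - real (card P)) + (real N * L * L + real N * L)"
    using 2 by linarith
  also have "\<dots> = real N * L + 2 * L * real (card P)" by (simp add: algebra_simps)
  finally show ?thesis .
qed

lemma sum_multiples:
  fixes f :: "nat \<Rightarrow> 'a :: comm_monoid_add"
  assumes "p > 0"
  shows "(\<Sum>n=1..N. if p dvd n then f n else 0) = (\<Sum>m=1..N div p. f (p * m))"
proof -
  have "(\<Sum>n=1..N. if p dvd n then f n else 0) = (\<Sum>n\<in>{n\<in>{1..N}. p dvd n}. f n)"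
    by (rule sum.inter_filter[symmetric]) simp
  also have "\<dots> = (\<Sum>m=1..N div p. f (p * m))"
    by (rule sum.reindex_bij_witness[of _ "\<lambda>m. p * m" "\<lambda>n. n div p"])
      (use assms in \<open>auto elim!: dvdE simp: less_eq_div_iff_mult_less_eq mult.commute\<close>)
  finally show ?thesis .
qed

text \<open>The double sum counts f(n) once for every p in P dividing n, that is L times on average;
  the deviation is handled by Cauchy--Schwarz and \<open>turan_kubilius\<close>. The condition on N
  absorbs the rounding term 2 L card P into a second L N.\<close>

lemma prime_average:
  fixes f :: "nat \<Rightarrow> complex"
  assumes P: "finite P" "\<And>p. p \<in> P \<Longrightarrow> prime (p::nat)" and f: "\<And>n. norm (f n) \<le> 1"
  defines "L \<equiv> \<Sum>p\<in>P. 1 / real p"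
  assumes N: "2 * card P \<le> N"
  shows "norm (of_real L * (\<Sum>n=1..N. f n) - (\<Sum>p\<in>P. \<Sum>m=1..N div p. f (p * m))) \<le> sqrt (2 * L) * real N"
proof -
  let ?\<omega> = "\<lambda>n. \<Sum>p\<in>P. if p dvd n then 1 else 0 :: real"
  have pos: "p > 0" if "p \<in> P" for p using P(2)[OF that] prime_gt_0_nat by blast
  have L0: "0 \<le> L" unfolding L_def by (intro sum_nonneg) auto
  have "(\<Sum>p\<in>P. \<Sum>m=1..N div p. f (p * m)) = (\<Sum>p\<in>P. \<Sum>n=1..N. if p dvd n then f n else 0)"
    using pos by (intro sum.cong refl sum_multiples[symmetric]) auto
  also have "\<dots> = (\<Sum>n=1..N. \<Sum>p\<in>P. if p dvd n then f n else 0)" by (rule sum.swap)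
  also have "\<dots> = (\<Sum>n=1..N. of_real (?\<omega> n) * f n)"
    unfolding of_real_sum sum_distrib_right by (intro sum.cong refl) auto
  finally have "of_real L * (\<Sum>n=1..N. f n) - (\<Sum>p\<in>P. \<Sum>m=1..N div p. f (p * m))
      = (\<Sum>n=1..N. of_real (L - ?\<omega> n) * f n)"
    by (simp add: sum_distrib_left sum_subtractf[symmetric] left_diff_distrib)
  also have "(norm \<dots>)\<^sup>2 \<le> real N * (\<Sum>n=1..N. (norm (of_real (L - ?\<omega> n) * f n))\<^sup>2)"
    using norm_sum_squared_le[of "\<lambda>n. of_real (L - ?\<omega> n) * f n" "{1..N}"] by simp
  also have "\<dots> \<le> real N * (\<Sum>n=1..N. (L - ?\<omega> n)\<^sup>2)"
  proof (intro mult_left_mono sum_mono)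
    fix n
    have "norm (of_real (L - ?\<omega> n) * f n) \<le> \<bar>L - ?\<omega> n\<bar> * 1"
      unfolding norm_mult norm_of_real using f by (intro mult_left_mono) auto
    then have "(norm (of_real (L - ?\<omega> n) * f n))\<^sup>2 \<le> \<bar>L - ?\<omega> n\<bar>\<^sup>2" by (intro power_mono) auto
    then show "(norm (of_real (L - ?\<omega> n) * f n))\<^sup>2 \<le> (L - ?\<omega> n)\<^sup>2" by simp
  qed auto
  also have "\<dots> \<le> real N * (real N * L + 2 * L * real (card P))"
    unfolding L_def by (intro mult_left_mono turan_kubilius P) auto
  also have "\<dots> \<le> real N * (real N * L + L * real N)"
  proof (intro mult_left_mono add_left_mono)
    have "L * real (2 * card P) \<le> L * real N" using L0 N by (intro mult_left_mono) (auto simp del: of_nat_mult)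
    then show "2 * L * real (card P) \<le> L * real N" by simp
  qed auto
  also have "\<dots> = (sqrt (2 * L) * real N)\<^sup>2" using L0 by (simp add: power_mult_distrib power2_eq_square[of "real N"])
  finally show ?thesis by (rule power2_le_imp_le) (use L0 in auto)
qed

text \<open>Closes both prime averages: an error 2 sqrt(2L) against the weight L. Since sqrt(2L) <=
  2 sqrt L, it suffices that 4 sqrt L < e L.\<close>

lemma less_of_weight_bound:
  assumes "0 < e" "(4 / e)\<^sup>2 < L" "L * r \<le> 2 * sqrt (2 * L) * t" "0 < t"
  shows "r < e * t"
proof -
  have L: "0 < L" using assms(2) by (meson le_less_trans zero_le_power2)
  have "sqrt (2 * L) \<le> sqrt (4 * L)" using L by simp
  also have "\<dots> = 2 * sqrt L" by (simp add: real_sqrt_mult)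
  finally have 1: "2 * sqrt (2 * L) * t \<le> 4 * (sqrt L * t)" using assms(4) by simp
  have "4 / e < sqrt L" using assms(2) by (rule real_less_rsqrt)
  then have "4 < sqrt L * e" using assms(1) by (simp only: pos_divide_less_eq)
  then have 2: "4 * (sqrt L * t) < (sqrt L * e) * (sqrt L * t)"
    using L assms(4) by (intro mult_strict_right_mono) auto
  note assms(3)
  also note 1
  also note 2
  also have "(sqrt L * e) * (sqrt L * t) = (sqrt L * sqrt L) * (e * t)" by (simp only: mult_ac)
  also have "\<dots> = L * (e * t)" using L by simp
  finally show ?thesis using L by simp
qed

lemma Omega_mean_shift:
  assumes a: "\<And>k. norm (a k) \<le> 1"
  shows "(\<lambda>N. Omega_mean a N - Omega_mean (\<lambda>k. a (Suc k)) N) \<longlonglongrightarrow> 0"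
proof (rule tendstoI)
  fix e :: real assume e: "e > 0"
  let ?S = "Omega_mean (\<lambda>k. a (Suc k))"
  \<comment> \<open>For each p, the cost of replacing the mean at N div p with weight (N div p)/N by
    the mean at N with weight 1/p: first the change of scale, then rounding.\<close>
  let ?E = "\<lambda>N p. of_real (1 / real p) * (?S (N div p) - ?S N)
      + of_real (real (N div p) / real N - 1 / real p) * ?S (N div p)"
  obtain P where P: "finite P" "\<And>p. p \<in> P \<Longrightarrow> prime (p::nat)" "(4 / e)\<^sup>2 + 1 \<le> (\<Sum>p\<in>P. 1 / real p)"
    using sum_inverse_primes_unbounded[of "(4 / e)\<^sup>2 + 1"] by blast
  have pos: "p > 0" if "p \<in> P" for p using P(2)[OF that] prime_gt_0_nat by blast
  define L where "L = (\<Sum>p\<in>P. 1 / real p)"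
  have L: "(4 / e)\<^sup>2 < L" using P(3) by (simp add: L_def)
  then have L0: "0 < L" using e by (meson le_less_trans zero_le_power2)
  define X where "X N = (\<Sum>p\<in>P. \<Sum>m=1..N div p. a (Suc (big_Omega m)))" for N
  have S1: "norm (?S N) \<le> 1" for N
  proof (cases "N = 0")
    case False
    have "norm (\<Sum>n=1..N. a (Suc (big_Omega n))) \<le> (\<Sum>n=1..N. 1)" by (intro sum_norm_le a)
    then show ?thesis using False by (simp add: Omega_mean_def norm_divide)
  qed (simp add: Omega_mean_def)
  have "(\<lambda>N. \<Sum>p\<in>P. ?E N p) \<longlonglongrightarrow> (\<Sum>p\<in>P. of_real (1 / real p) * 0 + 0)"
  proof (intro tendsto_sum tendsto_add tendsto_mult tendsto_const)
    fix p assume p: "p \<in> P"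
    show "(\<lambda>N. ?S (N div p) - ?S N) \<longlonglongrightarrow> 0"
      using a pos[OF p] by (intro Omega_mean_slowly_varying)
    show "(\<lambda>N. of_real (real (N div p) / real N - 1 / real p) * ?S (N div p)) \<longlonglongrightarrow> 0"
    proof (rule Lim_null_comparison)
      show "eventually (\<lambda>N. norm (of_real (real (N div p) / real N - 1 / real p) * ?S (N div p)) \<le> 1 / real N) sequentially"
        using eventually_gt_at_top[of 0]
      proof eventually_elim
        case (elim N)
        have "\<bar>real (N div p) / real N - 1 / real p\<bar> \<le> 1 / real N"
        proof -
          have "real (N div p) / real N - 1 / real p = (real (N div p) - real N / real p) / real N"
            using elim by (simp add: diff_divide_distrib)
          moreover have "\<bar>real (N div p) - real N / real p\<bar> \<le> 1"
            using of_nat_div_bounds[OF pos[OF p], of N] by (simp add: abs_le_iff)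
          ultimately show ?thesis by (simp add: abs_divide divide_right_mono)
        qed
        then have "\<bar>real (N div p) / real N - 1 / real p\<bar> * norm (?S (N div p)) \<le> 1 / real N * 1"
          by (intro mult_mono S1) auto
        then show ?case by (simp only: norm_mult norm_of_real mult_1_right)
      qed
      show "((\<lambda>N. 1 / real N) \<longlongrightarrow> 0) sequentially" by real_asymp
    qed
  qed
  then have lim: "(\<lambda>N. \<Sum>p\<in>P. ?E N p) \<longlonglongrightarrow> 0" by simp
  \<comment> \<open>The finite sum of errors tends to 0; the threshold sqrt L is taken because it
    merges with the sqrt(2L) of \<open>prime_average\<close> into 2 sqrt(2L).\<close>
  have "sqrt L > 0" using L0 by simp
  from tendstoD[OF lim this] have "eventually (\<lambda>N. norm (\<Sum>p\<in>P. ?E N p) < sqrt L) sequentially"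
    by (simp add: dist_norm)
  moreover have "eventually (\<lambda>N. N \<ge> max 1 (2 * card P)) sequentially" by (rule eventually_ge_at_top)
  ultimately show "eventually (\<lambda>N. dist (Omega_mean a N - ?S N) 0 < e) sequentially"
  proof eventually_elim
    case (elim N)
    have N: "real N > 0" "2 * card P \<le> N" using elim by auto
    have XN: "X N / of_nat N = of_real L * ?S N + (\<Sum>p\<in>P. ?E N p)"
    proof -
      have "X N = (\<Sum>p\<in>P. of_nat (N div p) * ?S (N div p))"
        unfolding X_def by (rule sum.cong[OF refl]) (auto simp: Omega_mean_def)
      then have "X N / of_nat N = (\<Sum>p\<in>P. of_nat (N div p) * ?S (N div p) / of_nat N)"
        by (simp only: sum_divide_distrib)
      also have "\<dots> = (\<Sum>p\<in>P. of_real (real (N div p) / real N) * ?S (N div p))"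
        by (rule sum.cong[OF refl]) simp
      also have "\<dots> = (\<Sum>p\<in>P. of_real (1 / real p) * ?S N + ?E N p)"
        unfolding of_real_diff by (intro sum.cong refl) (simp only: left_diff_distrib right_diff_distrib, simp)
      also have "\<dots> = of_real L * ?S N + (\<Sum>p\<in>P. ?E N p)"
        by (simp only: sum.distrib L_def of_real_sum sum_distrib_right)
      finally show ?thesis .
    qed
    have "norm (of_real L * (\<Sum>n=1..N. a (big_Omega n)) - (\<Sum>p\<in>P. \<Sum>m=1..N div p. a (big_Omega (p * m)))) \<le> sqrt (2 * L) * real N"
      unfolding L_def using N by (intro prime_average P a) auto
    also have "(\<Sum>p\<in>P. \<Sum>m=1..N div p. a (big_Omega (p * m))) = X N"
      unfolding X_def using P(2) pos by (intro sum.cong refl) (simp add: big_Omega_mult big_Omega_prime)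
    finally have "norm (of_real L * (\<Sum>n=1..N. a (big_Omega n)) - X N) / real N \<le> sqrt (2 * L)"
      using N by (simp add: field_simps)
    moreover have "of_real L * Omega_mean a N - X N / of_nat N = (of_real L * (\<Sum>n=1..N. a (big_Omega n)) - X N) / of_nat N"
      by (simp add: Omega_mean_def diff_divide_distrib)
    ultimately have A: "norm (of_real L * Omega_mean a N - X N / of_nat N) \<le> sqrt (2 * L)"
      by (simp add: norm_divide)
    have B: "norm (X N / of_nat N - of_real L * ?S N) \<le> sqrt L"
      unfolding XN using elim(1) by simp
    have "norm (of_real L * (Omega_mean a N - ?S N)) \<le> sqrt (2 * L) + sqrt L"
      using norm_triangle_ineq[of "of_real L * Omega_mean a N - X N / of_nat N" "X N / of_nat N - of_real L * ?S N"] A B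
      by (simp add: right_diff_distrib)
    also have "\<dots> \<le> 2 * sqrt (2 * L) * 1" using L0 by simp
    finally have "L * norm (Omega_mean a N - ?S N) \<le> 2 * sqrt (2 * L) * 1"
      using L0 by (simp add: norm_mult)
    from less_of_weight_bound[OF e L this] show ?case by (simp add: dist_norm)
  qed
qed

lemma Omega_mean_shifts:
  assumes a: "\<And>k. norm (a k) \<le> 1"
  shows "(\<lambda>N. Omega_mean a N - Omega_mean (\<lambda>k. a (k + j)) N) \<longlonglongrightarrow> 0"
proof (induction j)
  case (Suc j)
  have "(\<lambda>N. Omega_mean (\<lambda>k. a (k + j)) N - Omega_mean (\<lambda>k. a (Suc k + j)) N) \<longlonglongrightarrow> 0"
    by (rule Omega_mean_shift) (rule a)
  from tendsto_add[OF Suc this] show ?case by simp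
qed simp

text \<open>Averaging \<open>Omega_mean_shifts\<close> over j < J replaces a(Omega(n)) by the mean
  of a over the window of length J starting at Omega(n), which is small uniformly in n. J is fixed
  before N grows.\<close>

lemma Omega_mean_uniform_mean_zero:
  assumes a: "\<And>k. norm (a k) \<le> 1" and u: "uniform_mean_zero a"
  shows "Omega_mean a \<longlonglongrightarrow> 0"
proof (rule tendstoI)
  fix e :: real assume e: "e > 0"
  obtain J0 where J0: "\<And>J m. J \<ge> J0 \<Longrightarrow> norm (\<Sum>j<J. a (m + j)) \<le> (e / 2) * real J"
    using u e unfolding uniform_mean_zero_def by (meson half_gt_zero)
  define J where "J = max 1 J0"
  have J: "real J > 0" "norm (\<Sum>j<J. a (m + j)) \<le> (e / 2) * real J" for m
    using J0[of J m] by (auto simp: J_def)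
  have "(\<lambda>N. \<Sum>j<J. Omega_mean a N - Omega_mean (\<lambda>k. a (k + j)) N) \<longlonglongrightarrow> (\<Sum>j<J. 0)"
    by (intro tendsto_sum Omega_mean_shifts a)
  then have lim: "(\<lambda>N. \<Sum>j<J. Omega_mean a N - Omega_mean (\<lambda>k. a (k + j)) N) \<longlonglongrightarrow> 0" by simp
  have "eventually (\<lambda>N. norm (\<Sum>j<J. Omega_mean a N - Omega_mean (\<lambda>k. a (k + j)) N) < e / 2 * real J) sequentially"
    using tendstoD[OF lim, of "e / 2 * real J"] e J(1) by (simp add: dist_norm)
  then show "eventually (\<lambda>N. dist (Omega_mean a N) 0 < e) sequentially"
    using eventually_gt_at_top[of 0]
  proof eventually_elim
    case (elim N)
    let ?M = "\<Sum>j<J. Omega_mean (\<lambda>k. a (k + j)) N"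
    have M: "?M = (\<Sum>n=1..N. \<Sum>j<J. a (big_Omega n + j)) / of_nat N"
      unfolding Omega_mean_def sum_divide_distrib[symmetric] by (subst sum.swap) simp
    have "norm (\<Sum>n=1..N. \<Sum>j<J. a (big_Omega n + j)) \<le> (\<Sum>n=1..N. e / 2 * real J)"
      by (intro sum_norm_le J)
    then have "norm ?M \<le> (\<Sum>n=1..N. e / 2 * real J) / real N"
      unfolding M norm_divide norm_of_nat by (intro divide_right_mono) auto
    also have "\<dots> = e / 2 * real J" using elim by simp
    finally have "norm ?M \<le> e / 2 * real J" .
    moreover have "(\<Sum>j<J. Omega_mean a N - Omega_mean (\<lambda>k. a (k + j)) N) = of_nat J * Omega_mean a N - ?M"
      by (simp add: sum_subtractf)
    ultimately have "norm (of_nat J * Omega_mean a N) < e * real J"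
      using elim(1) norm_triangle_ineq[of "of_nat J * Omega_mean a N - ?M" ?M] by simp
    then show ?case using J(1) by (simp add: norm_mult dist_norm mult.commute)
  qed
qed

text \<open>After Turan--Kubilius, Cauchy--Schwarz removes the bounded function of \<open>\<Omega>(m)\<close>.\<close>

lemma daboussi_katai:
  fixes g a :: "nat \<Rightarrow> complex"
  assumes g: "\<And>n. norm (g n) \<le> 1" and a: "\<And>k. norm (a k) \<le> 1"
    and corr: "\<And>p q. prime p \<Longrightarrow> prime q \<Longrightarrow> p \<noteq> q \<Longrightarrow>
      (\<lambda>N. (\<Sum>m=1..N. g (p * m) * cnj (g (q * m))) / of_nat N) \<longlonglongrightarrow> 0"
  shows "(\<lambda>N. (\<Sum>n=1..N. g n * a (big_Omega n)) / of_nat N) \<longlonglongrightarrow> 0"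
proof (rule tendstoI)
  fix e :: real assume e: "e > 0"
  obtain P where P: "finite P" "\<And>p. p \<in> P \<Longrightarrow> prime (p::nat)" "(4 / e)\<^sup>2 + 1 \<le> (\<Sum>p\<in>P. 1 / real p)"
    using sum_inverse_primes_unbounded[of "(4 / e)\<^sup>2 + 1"] by blast
  have pos: "p > 0" if "p \<in> P" for p using P(2)[OF that] prime_gt_0_nat by blast
  define L where "L = (\<Sum>p\<in>P. 1 / real p)"
  have L: "(4 / e)\<^sup>2 < L" using P(3) by (simp add: L_def)
  then have L0: "0 < L" using e by (meson le_less_trans zero_le_power2)
  \<comment> \<open>Then all off-diagonal correlations together contribute at most L N, the same as
    the diagonal.\<close>
  define \<delta> where "\<delta> = L / (real (card P))\<^sup>2"
  have "card P > 0" using P(1) L0 by (auto simp: L_def card_gt_0_iff)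
  then have \<delta>: "\<delta> > 0" "real (card P) * real (card P) * \<delta> = L"
    using L0 by (auto simp: \<delta>_def power2_eq_square)
  let ?C = "\<lambda>p q M. \<Sum>m=1..M. g (p * m) * cnj (g (q * m))"
  \<comment> \<open>The correlations occur with length \<open>min (N div p) (N div q)\<close>, not
    N. Long sums are small by \<open>corr\<close>; those with M < M0 are trivially small once N >=
    M0/\<delta>.\<close>
  have small: "\<exists>N0. \<forall>N\<ge>N0. \<forall>M\<le>N. norm (?C p q M) \<le> \<delta> * real N" if pq: "p \<in> P" "q \<in> P" "p \<noteq> q" for p q
  proof -
    have "eventually (\<lambda>M. norm (?C p q M / of_nat M) < \<delta>) sequentially"
      using tendstoD[OF corr[OF P(2)[OF pq(1)] P(2)[OF pq(2)] pq(3)] \<delta>(1)] by (simp add: dist_norm)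
    then obtain M0 where M0: "\<And>M. M \<ge> M0 \<Longrightarrow> norm (?C p q M / of_nat M) < \<delta>"
      by (auto simp: eventually_sequentially)
    have triv: "norm (?C p q M) \<le> real M" for M
    proof -
      have "norm (?C p q M) \<le> (\<Sum>m=1..M. 1)"
        by (intro sum_norm_le) (auto simp: norm_mult intro!: mult_le_one g)
      then show ?thesis by simp
    qed
    define N0 where "N0 = nat \<lceil>real M0 / \<delta>\<rceil>"
    have "norm (?C p q M) \<le> \<delta> * real N" if N: "N \<ge> N0" and M: "M \<le> N" for N M
    proof (cases "M \<ge> max 1 M0")
      case True
      then have "norm (?C p q M) / real M < \<delta>" using M0[of M] by (simp add: norm_divide)
      then have "norm (?C p q M) \<le> \<delta> * real M" using True by (simp add: pos_divide_less_eq)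
      also have "\<dots> \<le> \<delta> * real N" using M \<delta> by simp
      finally show ?thesis .
    next
      case False
      then have "real M \<le> real M0" by auto
      also have "real M0 \<le> \<delta> * real N"
      proof -
        have "real M0 / \<delta> \<le> real N" using N unfolding N0_def by linarith
        then show ?thesis using \<delta> by (simp only: pos_divide_le_eq mult.commute)
      qed
      finally show ?thesis using triv[of M] by linarith
    qed
    then show ?thesis by blast
  qed
  have "\<exists>N0. \<forall>N\<ge>N0. \<forall>M\<le>N. p \<noteq> q \<longrightarrow> norm (?C p q M) \<le> \<delta> * real N" if "p \<in> P" "q \<in> P" for p q
    using small[OF that] by (cases "p = q") auto
  then obtain T where T: "\<And>p q N M. p \<in> P \<Longrightarrow> q \<in> P \<Longrightarrow> N \<ge> T p q \<Longrightarrow> M \<le> N \<Longrightarrow> p \<noteq> q \<Longrightarrow> norm (?C p q M) \<le> \<delta> * real N"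
    by metis
  have "eventually (\<lambda>N. \<forall>x\<in>P \<times> P. T (fst x) (snd x) \<le> N) sequentially"
    by (rule eventually_ball_finite) (use P(1) in \<open>auto intro: eventually_ge_at_top\<close>)
  moreover have "eventually (\<lambda>N. N \<ge> max 1 (2 * card P)) sequentially" by (rule eventually_ge_at_top)
  ultimately show "eventually (\<lambda>N. dist ((\<Sum>n=1..N. g n * a (big_Omega n)) / of_nat N) 0 < e) sequentially"
  proof eventually_elim
    case (elim N)
    have N: "real N > 0" "2 * card P \<le> N" using elim by auto
    define f where "f n = g n * a (big_Omega n)" for n
    have nf: "norm (f n) \<le> 1" for n unfolding f_def norm_mult by (intro mult_le_one g a) auto
    define X where "X = (\<Sum>p\<in>P. \<Sum>m=1..N div p. f (p * m))"
    \<comment> \<open>Truncation by zero lets all inner sums run up to the same N, so the factor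
      a(Omega(m) + 1) comes out of the sum over p before Cauchy--Schwarz.\<close>
    define h where "h p m = (if m \<le> N div p then g (p * m) else 0)" for p m
    have A: "norm (of_real L * (\<Sum>n=1..N. f n) - X) \<le> sqrt (2 * L) * real N"
      unfolding L_def X_def using N by (intro prime_average P nf)
    have "X = (\<Sum>p\<in>P. \<Sum>m=1..N. a (Suc (big_Omega m)) * h p m)"
      unfolding X_def
    proof (rule sum.cong[OF refl])
      fix p assume p: "p \<in> P"
      have "(\<Sum>m=1..N. a (Suc (big_Omega m)) * h p m) = (\<Sum>m=1..N div p. a (Suc (big_Omega m)) * h p m)"
      proof (rule sum.mono_neutral_right)
        show "{1..N div p} \<subseteq> {1..N}" using div_le_dividend[of N p] by auto
      qed (auto simp: h_def)
      also have "\<dots> = (\<Sum>m=1..N div p. f (p * m))"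
        using P(2)[OF p] pos[OF p]
        by (intro sum.cong refl) (auto simp: h_def f_def big_Omega_mult big_Omega_prime)
      finally show "(\<Sum>m=1..N div p. f (p * m)) = (\<Sum>m=1..N. a (Suc (big_Omega m)) * h p m)" ..
    qed
    also have "\<dots> = (\<Sum>m=1..N. a (Suc (big_Omega m)) * (\<Sum>p\<in>P. h p m))"
      by (subst sum.swap) (simp add: sum_distrib_left)
    finally have X: "X = \<dots>" .
    have "(norm X)\<^sup>2 \<le> real N * (\<Sum>m=1..N. (norm (a (Suc (big_Omega m)) * (\<Sum>p\<in>P. h p m)))\<^sup>2)"
      unfolding X using norm_sum_squared_le[of "\<lambda>m. a (Suc (big_Omega m)) * (\<Sum>p\<in>P. h p m)" "{1..N}"] by simp
    also have "\<dots> \<le> real N * (\<Sum>m=1..N. (norm (\<Sum>p\<in>P. h p m))\<^sup>2)"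
    proof (intro mult_left_mono sum_mono power_mono)
      fix m
      show "norm (a (Suc (big_Omega m)) * (\<Sum>p\<in>P. h p m)) \<le> norm (\<Sum>p\<in>P. h p m)"
        unfolding norm_mult using a by (intro mult_left_le_one_le) auto
    qed auto
    also have "(\<Sum>m=1..N. (norm (\<Sum>p\<in>P. h p m))\<^sup>2) \<le> (\<Sum>p\<in>P. \<Sum>q\<in>P. \<delta> * real N + (if p = q then real N * (1 / real p) else 0))"
    proof -
      have "(\<Sum>m=1..N. (norm (\<Sum>p\<in>P. h p m))\<^sup>2) = norm (\<Sum>p\<in>P. \<Sum>q\<in>P. \<Sum>m=1..N. h p m * cnj (h q m))"
        by (rule sum_norm_sum_squared)
      also have "\<dots> \<le> (\<Sum>p\<in>P. \<Sum>q\<in>P. \<delta> * real N + (if p = q then real N * (1 / real p) else 0))"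
      proof (intro sum_norm_le)
        fix p q assume pq: "p \<in> P" "q \<in> P"
        let ?M = "min (N div p) (N div q)"
        have MN: "?M \<le> N" using div_le_dividend[of N p] by (rule min.coboundedI1)
        have eq: "(\<Sum>m=1..N. h p m * cnj (h q m)) = ?C p q ?M"
        proof -
          have "(\<Sum>m=1..N. h p m * cnj (h q m)) = (\<Sum>m=1..?M. h p m * cnj (h q m))"
            by (rule sum.mono_neutral_right) (use MN in \<open>auto simp: h_def\<close>)
          also have "\<dots> = ?C p q ?M" by (intro sum.cong refl) (auto simp: h_def)
          finally show ?thesis .
        qed
        show "norm (\<Sum>m=1..N. h p m * cnj (h q m)) \<le> \<delta> * real N + (if p = q then real N * (1 / real p) else 0)"
        proof (cases "p = q")
          case True
          have "norm (?C p q ?M) \<le> (\<Sum>m=1..?M. 1)"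
            by (intro sum_norm_le) (auto simp: norm_mult intro!: mult_le_one g)
          also have "\<dots> \<le> real N * (1 / real p)"
            using of_nat_div_bounds(1)[OF pos[OF pq(1)], of N] True by simp
          also have "\<dots> \<le> \<delta> * real N + (if p = q then real N * (1 / real p) else 0)"
            using True \<delta> by simp
          finally show ?thesis unfolding eq .
        next
          case False
          have "norm (?C p q ?M) \<le> \<delta> * real N"
            using elim(1) pq False MN by (intro T) auto
          then show ?thesis unfolding eq using False by simp
        qed
      qed
      finally show ?thesis .
    qed
    also have "\<dots> = 2 * L * real N"
    proof -
      have "(\<Sum>p\<in>P. \<Sum>q\<in>P. if p = q then real N * (1 / real p) else 0) = (\<Sum>p\<in>P. real N * (1 / real p))"
        using P(1) by (intro sum.cong refl) simp
      moreover have "(\<Sum>p\<in>P. real N * (1 / real p)) = real N * L"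
        by (simp only: L_def sum_distrib_left)
      moreover have "(\<Sum>p\<in>P. \<Sum>q\<in>P. \<delta> * real N) = (real (card P) * real (card P) * \<delta>) * real N" by simp
      ultimately show ?thesis by (simp only: sum.distrib \<delta>(2)) simp
    qed
    finally have "(norm X)\<^sup>2 \<le> real N * (2 * L * real N)" by (simp add: mult_left_mono)
    also have "\<dots> = (sqrt (2 * L) * real N)\<^sup>2"
      using L0 by (simp add: power_mult_distrib power2_eq_square[of "real N"])
    finally have B: "norm X \<le> sqrt (2 * L) * real N" by (rule power2_le_imp_le) (use L0 in auto)
    have "norm (of_real L * (\<Sum>n=1..N. f n)) \<le> 2 * sqrt (2 * L) * real N"
      using norm_triangle_ineq[of "of_real L * (\<Sum>n=1..N. f n) - X" X] A B by simp
    then have "L * norm (\<Sum>n=1..N. f n) \<le> 2 * sqrt (2 * L) * real N" using L0 by (simp add: norm_mult)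
    from less_of_weight_bound[OF e L this N(1)] have "norm (\<Sum>n=1..N. f n) < e * real N" .
    then show ?case using N unfolding f_def by (simp add: dist_norm norm_divide pos_divide_less_eq)
  qed
qed

lemma uniform_mean_zero_imp_mean_tendsto_0:
  assumes "uniform_mean_zero f"
  shows "(\<lambda>N. (\<Sum>n=1..N. f n) / of_nat N) \<longlonglongrightarrow> 0"
proof (rule tendstoI)
  fix e :: real assume e: "e > 0"
  obtain N0 where N0: "\<And>N m. N \<ge> N0 \<Longrightarrow> norm (\<Sum>n<N. f (m + n)) \<le> (e / 2) * real N"
    using assms e unfolding uniform_mean_zero_def by (meson half_gt_zero)
  show "eventually (\<lambda>N. dist ((\<Sum>n=1..N. f n) / of_nat N) 0 < e) sequentially"
    using eventually_ge_at_top[of "max 1 N0"]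
  proof eventually_elim
    case (elim N)
    have "(\<Sum>n=1..N. f n) = (\<Sum>n<N. f (1 + n))"
      by (rule sum.reindex_bij_witness[of _ "\<lambda>n. 1 + n" "\<lambda>n. n - 1"]) auto
    then have "norm (\<Sum>n=1..N. f n) \<le> (e / 2) * real N" using N0[of N 1] elim by simp
    also have "\<dots> < e * real N" using e elim by simp
    finally show ?case using elim by (simp add: dist_norm norm_divide pos_divide_less_eq)
  qed
qed

lemma ex_irrational_coeff_smult:
  fixes p :: "real poly"
  assumes "\<exists>i\<in>{1..degree p}. coeff p i \<notin> \<rat>" and h: "h \<noteq> 0"
  shows "\<exists>i\<in>{1..degree (smult (of_int h) p)}. coeff (smult (of_int h) p) i \<notin> \<rat>"
proof -
  obtain i where i: "i \<in> {1..degree p}" "coeff p i \<notin> \<rat>" using assms by blast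
  have "of_int h * coeff p i \<notin> \<rat>"
  proof
    assume "of_int h * coeff p i \<in> \<rat>"
    then have "of_int h * coeff p i / of_int h \<in> \<rat>" by (intro Rats_divide) auto
    then show False using i h by simp
  qed
  then show ?thesis using i h by (intro bexI[of _ i]) auto
qed

text \<open>Dilation by r and by s multiplies the i-th coefficient by r^i and s^i. As r^i - s^i is a
  nonzero integer for i >= 1, an irrational coefficient stays irrational in the difference.\<close>

lemma poly_dilation_correlation:
  fixes p :: "real poly"
  assumes "\<exists>i\<in>{1..degree p}. coeff p i \<notin> \<rat>" and rs: "r \<noteq> (s::nat)"
  shows "uniform_mean_zero (\<lambda>m. circle_exp (poly p (real (r * m))) * cnj (circle_exp (poly p (real (s * m)))))"
proof -
  obtain i where i: "i \<in> {1..degree p}" "coeff p i \<notin> \<rat>" using assms by blast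
  define d where "d = pcompose p [:0, real r:] - pcompose p [:0, real s:]"
  have ci: "coeff d i = coeff p i * (real r ^ i - real s ^ i)"
    by (simp add: d_def coeff_pcompose_linear right_diff_distrib mult.commute)
  have ne: "real r ^ i - real s ^ i \<noteq> 0"
    using rs i by (simp add: power_eq_iff_eq_base)
  have "coeff d i \<notin> \<rat>"
  proof
    assume "coeff d i \<in> \<rat>"
    then have "coeff d i / (real r ^ i - real s ^ i) \<in> \<rat>" by (intro Rats_divide) auto
    then show False using i ne by (simp add: ci)
  qed
  moreover have "i \<le> degree d"
  proof (rule le_degree)
    show "coeff d i \<noteq> 0" using \<open>coeff d i \<notin> \<rat>\<close> by auto
  qed
  ultimately have "uniform_mean_zero (\<lambda>n. circle_exp (poly d (real n)))"
    using i by (intro uniform_mean_zero_poly) auto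
  then show ?thesis by (simp add: d_def poly_pcompose circle_exp_diff mult.commute)
qed

theorem exponential_sum_poly_big_Omega:
  fixes p q :: "real poly"
  assumes p: "\<exists>i\<in>{1..degree p}. coeff p i \<notin> \<rat>" and q: "\<exists>j\<in>{1..degree q}. coeff q j \<notin> \<rat>"
    and hk: "(h, k) \<noteq> (0, 0)"
  shows "(\<lambda>N. (\<Sum>n=1..N. circle_exp (of_int h * poly p (real n) + of_int k * poly q (real (big_Omega n)))) / of_nat N)
    \<longlonglongrightarrow> 0"
proof (cases "h = 0")
  case True
  let ?a = "\<lambda>j. circle_exp (poly (smult (of_int k) q) (real j))"
  have "uniform_mean_zero ?a"
    using ex_irrational_coeff_smult[OF q, of k] hk True by (intro uniform_mean_zero_poly) auto
  then have "Omega_mean ?a \<longlonglongrightarrow> 0" by (intro Omega_mean_uniform_mean_zero) auto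
  moreover have "Omega_mean ?a = (\<lambda>N. (\<Sum>n=1..N. circle_exp (of_int h * poly p (real n) + of_int k * poly q (real (big_Omega n)))) / of_nat N)"
    by (rule ext) (simp add: Omega_mean_def True)
  ultimately show ?thesis by simp
next
  case False
  let ?p = "smult (of_int h) p"
  let ?g = "\<lambda>n. circle_exp (poly ?p (real n))"
  let ?a = "\<lambda>j. circle_exp (of_int k * poly q (real j))"
  have "(\<lambda>N. (\<Sum>n=1..N. ?g n * ?a (big_Omega n)) / of_nat N) \<longlonglongrightarrow> 0"
  proof (rule daboussi_katai)
    fix r s :: nat assume "r \<noteq> s"
    then show "(\<lambda>N. (\<Sum>m=1..N. ?g (r * m) * cnj (?g (s * m))) / of_nat N) \<longlonglongrightarrow> 0"
      by (intro uniform_mean_zero_imp_mean_tendsto_0 poly_dilation_correlation ex_irrational_coeff_smult p False)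
  qed simp_all
  then show ?thesis by (simp add: circle_exp_add)
qed

section \<open>Weyl criterion on the torus\<close>

definition torus_exp :: "real \<times> real \<Rightarrow> complex \<times> complex" where
  "torus_exp xy = (circle_exp (fst xy), circle_exp (snd xy))"

lemma continuous_circle_exp: "continuous_on A circle_exp"
  unfolding circle_exp_def by (intro continuous_intros)

lemma circle_exp_uminus: "circle_exp (- x) = cnj (circle_exp x)"
  by (simp add: circle_exp_def cis_cnj)

lemma circle_exp_eq_iff: "circle_exp x = circle_exp y \<longleftrightarrow> x - y \<in> \<int>"
proof
  assume "circle_exp x = circle_exp y"
  then have "circle_exp (x - y) = circle_exp y * cnj (circle_exp y)" by (simp add: circle_exp_diff)
  also have "\<dots> = 1" by (simp add: complex_norm_square[symmetric])
  finally show "x - y \<in> \<int>" by (simp add: circle_exp_eq_1_iff)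
qed (rule circle_exp_cong)

text \<open>The closed square is taken, although opposite edges have the same image, because its
  compactness makes \<open>torus_exp\<close> a quotient map.\<close>

lemma torus_exp_image: "torus_exp ` ({0..1} \<times> {0..1}) = sphere 0 1 \<times> sphere 0 1"
proof -
  have ex: "\<exists>x\<in>{0..1}. circle_exp x = z" if "norm z = 1" for z
  proof -
    have "circle_exp (Arg2pi z / (2 * pi)) = z"
      using Arg2pi_eq[of z] that by (simp add: circle_exp_def cis_conv_exp)
    then show ?thesis using Arg2pi_ge_0[of z] Arg2pi_lt_2pi[of z]
      by (intro bexI[of _ "Arg2pi z / (2 * pi)"]) auto
  qed
  show ?thesis
  proof (intro set_eqI iffI)
    fix zw :: "complex \<times> complex" assume "zw \<in> sphere 0 1 \<times> sphere 0 1"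
    then have "norm (fst zw) = 1" "norm (snd zw) = 1" by auto
    then obtain x y where "x \<in> {0..1}" "y \<in> {0..1}" "circle_exp x = fst zw" "circle_exp y = snd zw"
      using ex[of "fst zw"] ex[of "snd zw"] by blast
    then show "zw \<in> torus_exp ` ({0..1} \<times> {0..1})"
      by (intro image_eqI[of _ _ "(x, y)"]) (auto simp: torus_exp_def)
  qed (auto simp: torus_exp_def)
qed

text \<open>A continuous function on \<open>torus2\<close> descends to the product of two unit circles in \<open>\<complex>\<times>\<complex>\<close>,
  where the Stone--Weierstrass theorem for polynomial functions applies.\<close>

lemma continuous_torus2_sphere:
  fixes f :: "torus2 \<Rightarrow> complex"
  assumes f: "continuous_on UNIV f"
  shows "\<exists>F. continuous_on (sphere 0 1 \<times> sphere 0 1) F \<and>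
    (\<forall>x y. F (circle_exp x, circle_exp y) = f (to_circle x, to_circle y))"
proof -
  \<comment> \<open>Two preimages of a point under \<open>circle_exp\<close> differ by an integer,
    so \<open>to_circle\<close> makes the choice irrelevant on the unit circle.\<close>
  define c where "c z = to_circle (SOME x. circle_exp x = z)" for z
  have c: "c (circle_exp x) = to_circle x" for x
  proof -
    have "circle_exp (SOME y. circle_exp y = circle_exp x) = circle_exp x" by (rule someI) simp
    then show ?thesis by (simp add: c_def to_circle_eq_iff circle_exp_eq_iff)
  qed
  define F where "F zw = f (c (fst zw), c (snd zw))" for zw
  have F: "F (circle_exp x, circle_exp y) = f (to_circle x, to_circle y)" for x y
    by (simp add: F_def c)
  let ?S = "{0..1} \<times> {0..1} :: (real \<times> real) set" and ?T = "sphere 0 1 \<times> sphere 0 1 :: (complex \<times> complex) set"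
  have te: "continuous_on ?S torus_exp"
    unfolding torus_exp_def
    by (intro continuous_on_Pair continuous_on_compose2[OF continuous_circle_exp[of UNIV]] continuous_on_fst continuous_on_snd continuous_on_id) auto
  have comp: "continuous_on ?S (F \<circ> torus_exp)"
  proof -
    have "continuous_on UNIV (\<lambda>xy :: real \<times> real. f (to_circle (fst xy), to_circle (snd xy)))"
      by (intro continuous_on_compose2[OF f] continuous_on_Pair continuous_on_compose2[OF continuous_to_circle]
          continuous_on_fst continuous_on_snd continuous_on_id) auto
    moreover have "F \<circ> torus_exp = (\<lambda>xy. f (to_circle (fst xy), to_circle (snd xy)))"
      by (rule ext) (simp add: torus_exp_def F)
    ultimately show ?thesis by (metis continuous_on_subset subset_UNIV)
  qed
  have "continuous_on ?T F"
    unfolding continuous_openin_preimage_eq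
  proof (intro allI impI)
    fix B :: "complex set" assume B: "open B"
    \<comment> \<open>A continuous map from a compact space onto a Hausdorff space is a quotient
      map, so openness can be tested on the square, where \<open>F \<circ> torus_exp\<close> is f
      composed with the projections.\<close>
    have "openin (top_of_set ?S) (?S \<inter> torus_exp -` (?T \<inter> F -` B)) = openin (top_of_set ?T) (?T \<inter> F -` B)"
      by (rule Abstract_Topology_2.continuous_imp_quotient_map[OF te torus_exp_image]) (auto intro: compact_Times)
    moreover have "?S \<inter> torus_exp -` (?T \<inter> F -` B) = ?S \<inter> (F \<circ> torus_exp) -` B"
      using torus_exp_image by auto
    moreover have "openin (top_of_set ?S) (?S \<inter> (F \<circ> torus_exp) -` B)"
      using comp B unfolding continuous_openin_preimage_eq by blast
    ultimately show "openin (top_of_set ?T) (?T \<inter> F -` B)" by simp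
  qed
  with F show ?thesis by blast
qed

section \<open>Trigonometric polynomials and their density\<close>

definition trig_polynomial :: "(real \<Rightarrow> real \<Rightarrow> complex) \<Rightarrow> bool" where
  "trig_polynomial T \<longleftrightarrow> (\<exists>(K :: (int \<times> int) set) c. finite K \<and>
     (\<forall>x y. T x y = (\<Sum>(h, k)\<in>K. c (h, k) * circle_exp (of_int h * x + of_int k * y))))"

lemma trig_polynomial_char:
  "trig_polynomial (\<lambda>x y. c * circle_exp (of_int h * x + of_int k * y))"
  unfolding trig_polynomial_def by (intro exI[of _ "{(h, k)}"] exI[of _ "\<lambda>_. c"]) simp

lemma trig_polynomial_add:
  assumes "trig_polynomial S" "trig_polynomial T"
  shows "trig_polynomial (\<lambda>x y. S x y + T x y)"
proof -
  obtain K c where S: "finite K" "\<And>x y. S x y = (\<Sum>(h, k)\<in>K. c (h, k) * circle_exp (of_int h * x + of_int k * y))"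
    using assms(1) unfolding trig_polynomial_def by blast
  obtain M d where T: "finite M" "\<And>x y. T x y = (\<Sum>(h, k)\<in>M. d (h, k) * circle_exp (of_int h * x + of_int k * y))"
    using assms(2) unfolding trig_polynomial_def by blast
  let ?c = "\<lambda>i. (if i \<in> K then c i else 0) + (if i \<in> M then d i else 0)"
  have "S x y + T x y = (\<Sum>(h, k)\<in>K \<union> M. ?c (h, k) * circle_exp (of_int h * x + of_int k * y))" for x y
  proof -
    let ?e = "\<lambda>i. circle_exp (of_int (fst i) * x + of_int (snd i) * y)"
    have "S x y = (\<Sum>i\<in>K \<union> M. (if i \<in> K then c i else 0) * ?e i)"
      unfolding S case_prod_unfold using S(1) T(1) by (intro sum.mono_neutral_cong_left) auto
    moreover have "T x y = (\<Sum>i\<in>K \<union> M. (if i \<in> M then d i else 0) * ?e i)"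
      unfolding T case_prod_unfold using S(1) T(1) by (intro sum.mono_neutral_cong_left) auto
    ultimately show ?thesis by (simp only: case_prod_unfold sum.distrib distrib_right prod.collapse)
  qed
  then show ?thesis unfolding trig_polynomial_def using S(1) T(1)
    by (intro exI[of _ "K \<union> M"] exI[of _ ?c]) simp
qed

lemma trig_polynomial_const: "trig_polynomial (\<lambda>x y. c)"
  using trig_polynomial_char[of c 0 0] by simp

lemma trig_polynomial_sum:
  assumes "\<And>i. i \<in> I \<Longrightarrow> trig_polynomial (S i)"
  shows "trig_polynomial (\<lambda>x y. \<Sum>i\<in>I. S i x y)"
  using assms by (induction I rule: infinite_finite_induct) (auto intro: trig_polynomial_const trig_polynomial_add)

lemma trig_polynomial_mult:
  assumes "trig_polynomial S" "trig_polynomial T"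
  shows "trig_polynomial (\<lambda>x y. S x y * T x y)"
proof -
  obtain K c where S: "finite K" "\<And>x y. S x y = (\<Sum>(h, k)\<in>K. c (h, k) * circle_exp (of_int h * x + of_int k * y))"
    using assms(1) unfolding trig_polynomial_def by blast
  obtain M d where T: "finite M" "\<And>x y. T x y = (\<Sum>(h, k)\<in>M. d (h, k) * circle_exp (of_int h * x + of_int k * y))"
    using assms(2) unfolding trig_polynomial_def by blast
  have "S x y * T x y = (\<Sum>i\<in>K. \<Sum>j\<in>M. (c i * d j) * circle_exp (of_int (fst i + fst j) * x + of_int (snd i + snd j) * y))" for x y
  proof -
    have "circle_exp (of_int (fst i + fst j) * x + of_int (snd i + snd j) * y)
      = circle_exp (of_int (fst i) * x + of_int (snd i) * y) * circle_exp (of_int (fst j) * x + of_int (snd j) * y)"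
      for i j :: "int \<times> int"
      unfolding circle_exp_add[symmetric] by (simp add: algebra_simps)
    then show ?thesis unfolding S T case_prod_unfold sum_product by (simp add: mult_ac)
  qed
  then show ?thesis
    by (simp only:) (intro trig_polynomial_sum trig_polynomial_char)
qed

text \<open>A real-linear functional of (z, w) is a combination of Re z, Im z, Re w and Im w. On the
  torus these are combinations of a character and its conjugate, the character of opposite
  frequency; closure under sums and products gives the rest.\<close>

lemma trig_polynomial_real_polynomial_function:
  fixes g :: "complex \<times> complex \<Rightarrow> real"
  assumes "real_polynomial_function g"
  shows "trig_polynomial (\<lambda>x y. of_real (g (circle_exp x, circle_exp y)))"
  using assms
proof (induction rule: real_polynomial_function.induct)
  case (linear f)
  interpret f: bounded_linear f by fact
  have re: "trig_polynomial (\<lambda>x y. of_real (Re (circle_exp (of_int h * x + of_int k * y))))"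
    and im: "trig_polynomial (\<lambda>x y. of_real (Im (circle_exp (of_int h * x + of_int k * y))))" for h k
  proof -
    have e: "circle_exp (of_int (- h) * x + of_int (- k) * y) = cnj (circle_exp (of_int h * x + of_int k * y))" for x y
      unfolding circle_exp_uminus[symmetric] by simp
    have "of_real (Re z) = (1/2) * z + (1/2) * cnj z" "of_real (Im z) = (-\<i>/2) * z + (\<i>/2) * cnj z" for z
      by (auto simp: complex_eq_iff)
    note * = this[of "circle_exp (of_int h * x + of_int k * y)" for x y, folded e]
    show "trig_polynomial (\<lambda>x y. of_real (Re (circle_exp (of_int h * x + of_int k * y))))"
      "trig_polynomial (\<lambda>x y. of_real (Im (circle_exp (of_int h * x + of_int k * y))))"
      unfolding * by (intro trig_polynomial_add trig_polynomial_char)+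
  qed
  have lin: "f (z, w) = Re z * f (1, 0) + Im z * f (\<i>, 0) + Re w * f (0, 1) + Im w * f (0, \<i>)" for z w
  proof -
    have "(z, w) = Re z *\<^sub>R (1, 0) + Im z *\<^sub>R (\<i>, 0) + Re w *\<^sub>R (0, 1) + Im w *\<^sub>R (0, \<i>)"
      by (simp add: complex_eq_iff)
    then have "f (z, w) = f (Re z *\<^sub>R (1, 0) + Im z *\<^sub>R (\<i>, 0) + Re w *\<^sub>R (0, 1) + Im w *\<^sub>R (0, \<i>))"
      by (rule arg_cong)
    then show ?thesis by (simp only: f.add f.scaleR real_scaleR_def)
  qed
  show ?case
    unfolding lin[of "circle_exp x" "circle_exp y" for x y] of_real_add of_real_mult
    using re[of 1 0] re[of 0 1] im[of 1 0] im[of 0 1]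
    by (intro trig_polynomial_add trig_polynomial_mult trig_polynomial_const) auto
next
  case (const c)
  show ?case by (rule trig_polynomial_const)
next
  case (add f g)
  then show ?case by (simp only: of_real_add trig_polynomial_add)
next
  case (mult f g)
  then show ?case by (simp only: of_real_mult trig_polynomial_mult)
qed

lemma trig_polynomial_dense:
  fixes f :: "torus2 \<Rightarrow> complex"
  assumes f: "continuous_on UNIV f" and e: "e > 0"
  obtains T where "trig_polynomial T" "\<And>x y. norm (f (to_circle x, to_circle y) - T x y) < e"
proof -
  obtain F where F: "continuous_on (sphere 0 1 \<times> sphere 0 1) F"
    "\<And>x y. F (circle_exp x, circle_exp y) = f (to_circle x, to_circle y)"
    using continuous_torus2_sphere[OF f] by blast
  let ?T = "sphere 0 1 \<times> sphere 0 1 :: (complex \<times> complex) set"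
  have cpt: "compact ?T" by (intro compact_Times compact_sphere)
  have "continuous_on ?T (\<lambda>z. Re (F z))" "continuous_on ?T (\<lambda>z. Im (F z))"
    using F(1) by (intro continuous_intros; simp)+
  then obtain g h where g: "real_polynomial_function g" "\<And>z. z \<in> ?T \<Longrightarrow> \<bar>Re (F z) - g z\<bar> < e / 2"
    and h: "real_polynomial_function h" "\<And>z. z \<in> ?T \<Longrightarrow> \<bar>Im (F z) - h z\<bar> < e / 2"
    using Stone_Weierstrass_real_polynomial_function[OF cpt] e by (metis half_gt_zero)
  define T where "T x y = of_real (g (circle_exp x, circle_exp y)) + \<i> * of_real (h (circle_exp x, circle_exp y))" for x y
  have "trig_polynomial T"
    unfolding T_def[abs_def]
    by (intro trig_polynomial_add trig_polynomial_mult trig_polynomial_const trig_polynomial_real_polynomial_function g h)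
  moreover have "norm (f (to_circle x, to_circle y) - T x y) < e" for x y
  proof -
    let ?z = "(circle_exp x, circle_exp y)"
    have z: "?z \<in> ?T" by simp
    have "norm (F ?z - T x y) \<le> \<bar>Re (F ?z - T x y)\<bar> + \<bar>Im (F ?z - T x y)\<bar>" by (rule cmod_le)
    also have "\<dots> < e / 2 + e / 2"
      using g(2)[OF z] h(2)[OF z] by (intro add_strict_mono) (simp_all add: T_def)
    finally show ?thesis by (simp add: F(2))
  qed
  ultimately show ?thesis using that by blast
qed


section \<open>Characters of the torus and Weyl's criterion\<close>

lift_definition circle_char :: "int \<Rightarrow> circle \<Rightarrow> complex" is "\<lambda>h x. circle_exp (of_int h * x)"
proof -
  fix h :: int and x y :: real assume "x - y \<in> \<int>"
  then have "of_int h * (x - y) \<in> \<int>" by (intro Ints_mult) auto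
  then show "circle_exp (of_int h * x) = circle_exp (of_int h * y)"
    by (intro circle_exp_cong) (simp add: right_diff_distrib)
qed

lemma continuous_circle_char: "continuous_on UNIV (circle_char h)"
proof -
  have "open (circle_char h -` V)" if "open V" for V
  proof -
    have "to_circle -` (circle_char h -` V) = (\<lambda>x. circle_exp (of_int h * x)) -` V"
      by (auto simp: circle_char.abs_eq)
    moreover have "open ((\<lambda>x. circle_exp (of_int h * x)) -` V)"
      by (rule open_vimage[OF that]) (intro continuous_on_compose2[OF continuous_circle_exp[of UNIV]] continuous_intros, auto)
    ultimately show ?thesis by (simp add: open_circle_def)
  qed
  then show ?thesis by (simp add: continuous_on_open_vimage)
qed

lemma norm_circle_char [simp]: "norm (circle_char h c) = 1"
  by transfer simp

lemma circle_char_add: "circle_char h (b + c) = circle_char h b * circle_char h c"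
  by transfer (simp add: distrib_left circle_exp_add)

text \<open>The point 1/(2h) works: the phase there is 1/2, not an integer.\<close>

lemma ex_circle_char_ne_1: "h \<noteq> 0 \<Longrightarrow> \<exists>c. circle_char h c \<noteq> 1"
proof -
  assume h: "h \<noteq> 0"
  have "circle_exp (of_int h * (1 / (2 * of_int h))) \<noteq> 1"
  proof
    assume "circle_exp (of_int h * (1 / (2 * of_int h))) = 1"
    then have "(1/2 :: real) \<in> \<int>" using h by (simp add: circle_exp_eq_1_iff)
    then obtain n :: int where "1/2 = (of_int n :: real)" by (elim Ints_cases)
    then have "(of_int 1 :: real) = of_int (2 * n)" by simp
    then have "1 = 2 * n" by (simp only: of_int_eq_iff)
    then show False by presburger
  qed
  then show ?thesis by (intro exI[of _ "to_circle (1 / (2 * of_int h))"]) (simp add: circle_char.abs_eq)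
qed

definition torus_char :: "int \<Rightarrow> int \<Rightarrow> torus2 \<Rightarrow> complex" where
  "torus_char h k z = circle_char h (fst z) * circle_char k (snd z)"

lemma torus_char_to_circle:
  "torus_char h k (to_circle x, to_circle y) = circle_exp (of_int h * x + of_int k * y)"
  by (simp add: torus_char_def circle_char.abs_eq circle_exp_add)

lemma continuous_torus_char: "continuous_on UNIV (torus_char h k)"
  unfolding torus_char_def
  by (intro continuous_on_mult continuous_on_compose2[OF continuous_circle_char] continuous_on_fst continuous_on_snd continuous_on_id) auto

lemma norm_torus_char [simp]: "norm (torus_char h k z) = 1"
  by (simp add: torus_char_def norm_mult)

lemma torus_char_add: "torus_char h k (z + w) = torus_char h k z * torus_char h k w"
  by (simp add: torus_char_def circle_char_add)

interpretation haar_torus2: prob_space haar_torus2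
  by (rule prob_space_haar_torus2)

lemma integrable_continuous_bounded_torus2:
  fixes f :: "torus2 \<Rightarrow> complex"
  assumes "continuous_on UNIV f" "\<And>z. norm (f z) \<le> B"
  shows "integrable haar_torus2 f"
proof (rule haar_torus2.integrable_const_bound[of _ B])
  show "f \<in> borel_measurable haar_torus2"
    using borel_measurable_continuous_onI[OF assms(1)] measurable_cong_sets[OF sets_haar_torus2 refl] by blast
qed (use assms(2) in auto)

text \<open>Translation by a point where the character is not 1 multiplies the integral by that value.\<close>

lemma integral_torus_char:
  assumes "(h, k) \<noteq> (0, 0)"
  shows "integral\<^sup>L haar_torus2 (torus_char h k) = 0"
proof -
  have "\<exists>g. torus_char h k g \<noteq> 1"
  proof (cases "h = 0")
    case True
    then obtain c where "circle_char k c \<noteq> 1" using assms ex_circle_char_ne_1[of k] by auto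
    moreover have "circle_char 0 d = 1" for d by transfer simp
    ultimately show ?thesis using True by (intro exI[of _ "(0, c)"]) (simp add: torus_char_def)
  next
    case False
    then obtain c where "circle_char h c \<noteq> 1" using ex_circle_char_ne_1 by blast
    moreover have "circle_char k 0 = 1" by transfer simp
    ultimately show ?thesis by (intro exI[of _ "(c, 0)"]) (simp add: torus_char_def)
  qed
  then obtain g where g: "torus_char h k g \<noteq> 1" by blast
  have meas: "torus_char h k \<in> borel_measurable borel"
    by (rule borel_measurable_continuous_onI[OF continuous_torus_char])
  have shift: "(+) g \<in> measurable haar_torus2 borel"
  proof -
    have "(\<lambda>z :: torus2. (fst g + fst z, snd g + snd z)) \<in> measurable (borel \<Otimes>\<^sub>M borel) (borel \<Otimes>\<^sub>M borel)"
      using measurable_plus_circle by measurable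
    moreover have "(\<lambda>z :: torus2. (fst g + fst z, snd g + snd z)) = (+) g" by (auto simp: plus_prod_def)
    ultimately have "(+) g \<in> measurable borel (borel :: torus2 measure)" by (simp only: borel_prod)
    then show ?thesis using measurable_cong_sets[OF sets_haar_torus2 refl] by blast
  qed
  have "integral\<^sup>L haar_torus2 (torus_char h k) = integral\<^sup>L (distr haar_torus2 borel ((+) g)) (torus_char h k)"
    by (simp only: haar_torus2_invariant)
  also have "\<dots> = (\<integral>z. torus_char h k (g + z) \<partial>haar_torus2)"
    by (rule integral_distr[OF shift meas])
  also have "\<dots> = torus_char h k g * integral\<^sup>L haar_torus2 (torus_char h k)"
    by (simp add: torus_char_add)
  finally show ?thesis using g by (metis mult_cancel_right1)
qed

text \<open>Approximate f within e/3 everywhere by a trigonometric polynomial t. Means and integrals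
  of f and t then differ by at most e/3 each, and for t the claim is a finite combination of limits
  for characters.\<close>

lemma weyl_criterion_torus2:
  fixes x :: "nat \<Rightarrow> torus2"
  assumes chars: "\<And>h k. (h, k) \<noteq> (0, 0) \<Longrightarrow> (\<lambda>N. (\<Sum>n=1..N. torus_char h k (x n)) / of_nat N) \<longlonglongrightarrow> 0"
  shows "uniformly_distributed haar_torus2 x"
  unfolding uniformly_distributed_def
proof (intro allI impI tendstoI)
  fix f :: "torus2 \<Rightarrow> complex" and e :: real
  assume f: "continuous_on UNIV f" and e: "e > 0"
  obtain T where T: "trig_polynomial T" "\<And>x y. norm (f (to_circle x, to_circle y) - T x y) < e / 3"
    using trig_polynomial_dense[OF f, of "e / 3"] e by auto
  obtain K c where K: "finite K" "\<And>x y. T x y = (\<Sum>(h, k)\<in>K. c (h, k) * circle_exp (of_int h * x + of_int k * y))"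
    using T(1) unfolding trig_polynomial_def by blast
  define t where "t z = (\<Sum>(h, k)\<in>K. c (h, k) * torus_char h k z)" for z
  have close: "norm (f z - t z) \<le> e / 3" for z
  proof -
    obtain x y where z: "z = (to_circle x, to_circle y)"
      using to_circle_surj[of "fst z"] to_circle_surj[of "snd z"] by (metis prod.collapse)
    have "t z = T x y" by (simp add: t_def z K torus_char_to_circle)
    then show ?thesis using T(2)[of x y] by (simp add: z less_imp_le)
  qed
  have t_cont: "continuous_on UNIV t"
    unfolding t_def case_prod_unfold by (intro continuous_intros continuous_torus_char)
  have t_bound: "norm (t z) \<le> (\<Sum>i\<in>K. norm (c i))" for z
    unfolding t_def by (rule sum_norm_le) (auto simp: norm_mult)
  have t_int: "integrable haar_torus2 t" using t_cont t_bound by (rule integrable_continuous_bounded_torus2)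
  \<comment> \<open>The bound on f that integrability requires is read off from the approximant
    t.\<close>
  have f_int: "integrable haar_torus2 f"
  proof (rule integrable_continuous_bounded_torus2[OF f])
    fix z show "norm (f z) \<le> e / 3 + (\<Sum>i\<in>K. norm (c i))"
      using norm_triangle_ineq[of "f z - t z" "t z"] close[of z] t_bound[of z] by simp
  qed
  have "integral\<^sup>L haar_torus2 f - integral\<^sup>L haar_torus2 t = (\<integral>z. f z - t z \<partial>haar_torus2)"
    by (rule Bochner_Integration.integral_diff[symmetric]) (rule f_int t_int)+
  also have "norm \<dots> \<le> (\<integral>z. norm (f z - t z) \<partial>haar_torus2)" by (rule integral_norm_bound)
  also have "\<dots> \<le> (\<integral>z. e / 3 \<partial>haar_torus2)"
    using f_int t_int close by (intro integral_mono) auto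
  also have "\<dots> = e / 3" by (simp add: haar_torus2.prob_space)
  finally have ints: "norm (integral\<^sup>L haar_torus2 f - integral\<^sup>L haar_torus2 t) \<le> e / 3" .
  have "(\<lambda>N. (\<Sum>n=1..N. t (x n)) / of_nat N) \<longlonglongrightarrow> integral\<^sup>L haar_torus2 t"
  proof -
    have char_int: "integrable haar_torus2 (torus_char h k)" for h k
      by (rule integrable_continuous_bounded_torus2[OF continuous_torus_char, of _ _ 1]) simp
    have char_lim: "(\<lambda>N. (\<Sum>n=1..N. torus_char h k (x n)) / of_nat N) \<longlonglongrightarrow> integral\<^sup>L haar_torus2 (torus_char h k)" for h k
    proof (cases "(h, k) = (0, 0)")
      case True
      have one: "torus_char 0 0 z = 1" for z
      proof -
        have "circle_char 0 d = 1" for d by transfer simp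
        then show ?thesis by (simp add: torus_char_def)
      qed
      have "(\<lambda>N::nat. 1 :: complex) \<longlonglongrightarrow> 1" by simp
      then have "(\<lambda>N. (\<Sum>n=1..N. torus_char 0 0 (x n)) / of_nat N) \<longlonglongrightarrow> 1"
        by (rule Lim_transform_eventually)
          (use eventually_gt_at_top[of "0::nat"] in \<open>eventually_elim, simp add: one\<close>)
      moreover have "integral\<^sup>L haar_torus2 (torus_char 0 0) = 1"
        by (simp add: one haar_torus2.prob_space cong: Bochner_Integration.integral_cong)
      ultimately show ?thesis using True by simp
    next
      case False
      then show ?thesis using chars[OF False] integral_torus_char[OF False] by simp
    qed
    have "(\<lambda>N. \<Sum>i\<in>K. c i * ((\<Sum>n=1..N. torus_char (fst i) (snd i) (x n)) / of_nat N))
      \<longlonglongrightarrow> (\<Sum>i\<in>K. c i * integral\<^sup>L haar_torus2 (torus_char (fst i) (snd i)))"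
      by (intro tendsto_intros char_lim)
    moreover have "(\<Sum>i\<in>K. c i * ((\<Sum>n=1..N. torus_char (fst i) (snd i) (x n)) / of_nat N)) = (\<Sum>n=1..N. t (x n)) / of_nat N" for N
      unfolding t_def case_prod_unfold
      by (subst sum.swap) (simp add: sum_divide_distrib sum_distrib_left)
    moreover have "(\<Sum>i\<in>K. c i * integral\<^sup>L haar_torus2 (torus_char (fst i) (snd i))) = integral\<^sup>L haar_torus2 t"
      unfolding t_def case_prod_unfold
      by (subst Bochner_Integration.integral_sum) (use char_int in auto)
    ultimately show ?thesis by simp
  qed
  from tendstoD[OF this, of "e / 3"] e
  have "eventually (\<lambda>N. dist ((\<Sum>n=1..N. t (x n)) / of_nat N) (integral\<^sup>L haar_torus2 t) < e / 3) sequentially" by simp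
  then show "eventually (\<lambda>N. dist ((\<Sum>n=1..N. f (x n)) / of_nat N) (integral\<^sup>L haar_torus2 f) < e) sequentially"
    using eventually_gt_at_top[of 0]
  proof eventually_elim
    case (elim N)
    let ?F = "(\<Sum>n=1..N. f (x n)) / of_nat N" and ?T = "(\<Sum>n=1..N. t (x n)) / of_nat N"
    have "norm (\<Sum>n=1..N. f (x n) - t (x n)) \<le> (\<Sum>n=1..N. e / 3)" by (intro sum_norm_le close)
    then have "norm (\<Sum>n=1..N. f (x n) - t (x n)) / real N \<le> (real N * (e / 3)) / real N"
      by (intro divide_right_mono) auto
    moreover have "?F - ?T = (\<Sum>n=1..N. f (x n) - t (x n)) / of_nat N"
      by (simp add: sum_subtractf diff_divide_distrib)
    ultimately have "norm (?F - ?T) \<le> e / 3" using elim by (simp add: norm_divide)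
    moreover have "norm (?F - integral\<^sup>L haar_torus2 f) \<le> norm (?F - ?T) + norm (?T - integral\<^sup>L haar_torus2 t)
        + norm (integral\<^sup>L haar_torus2 t - integral\<^sup>L haar_torus2 f)"
      using norm_triangle_ineq[of "?F - ?T" "?T - integral\<^sup>L haar_torus2 f"]
        norm_triangle_ineq[of "?T - integral\<^sup>L haar_torus2 t" "integral\<^sup>L haar_torus2 t - integral\<^sup>L haar_torus2 f"] by simp
    ultimately show ?case using elim(1) ints by (simp add: dist_norm norm_minus_commute)
  qed
qed

theorem corollary1p27:
  fixes p q :: "real poly"
  assumes "\<exists>i\<in>{1..degree p}. coeff p i \<notin> \<rat>"
    and "\<exists>j\<in>{1..degree q}. coeff q j \<notin> \<rat>"
  shows "uniformly_distributed haar_torus2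
    (\<lambda>n. (to_circle (poly p (real n)), to_circle (poly q (real (big_Omega n)))))"
proof (rule weyl_criterion_torus2)
  fix h k :: int assume "(h, k) \<noteq> (0, 0)"
  from exponential_sum_poly_big_Omega[OF assms this]
  show "(\<lambda>N. (\<Sum>n=1..N. torus_char h k (to_circle (poly p (real n)), to_circle (poly q (real (big_Omega n))))) / of_nat N)
    \<longlonglongrightarrow> 0"
    by (simp add: torus_char_to_circle)
qed

end
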